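(* Let $d\ge1$, let $\gamma$ be a measure on $(\mathbb{R}^d,\mathcal{B}(\mathbb{R}^d))$ with $\gamma(\mathbb{R}^d)<1$ (offspring intensity), and let $\xi$ be the descendant cluster with offspring intensity $\gamma$. Let $n\ge2$ and let $f_1,\ldots,f_n:\mathbb{R}^d\to\mathbb{R}$ be measurable with $\mathbb{E}\big[\big(|f_i(z)|+\sum_{x\in\xi}|f_i(z+x)|\big)^p\big]<\infty$ for all $z\in\mathbb{R}^d$, $p\ge1$ and $i=1,\ldots,n$. For $z\in\mathbb{R}^d$ and a nonempty subset $A\subset\{1,\ldots,n\}$, let $\kappa_z^{(|A|)}\big((f_i)_{i\in A}\big)$ be the joint cumulant of the random variables $f_i(z)+\sum_{x\in\xi}f_i(z+x)$, $i\in A$ (the sums of the $f_i$ over the cluster started from a single point at $z$). Then, for all $z\in\mathbb{R}^d$, $$\kappa_z^{(n)}(f_1,\ldots,f_n)=\sum_{k=2}^n\ \sum_{\pi_1\cup\cdots\cup\pi_k=\{1,\ldots,n\}}\ \sum_{m=1}^\infty\int_{\mathbb{R}^d}\cdots\int_{\mathbb{R}^d}\prod_{j=1}^k\kappa_{z+x_1+\cdots+x_m}^{(|\pi_j|)}\big((f_i)_{i\in\pi_j}\big)\,\gamma(dx_1)\cdots\gamma(dx_m),$$ where the second sum is over all set partitions $\{\pi_1,\ldots,\pi_k\}$ of $\{1,\ldots,n\}$ into $k$ nonempty blocks.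
   Context: Cluster: start from an ancestor at $0\in\mathbb{R}^d$. Each point $y$ of each generation independently produces offspring located at $y+u$, where $u$ ranges over the points of a Poisson point process on $\mathbb{R}^d$ with intensity measure $\gamma$. The random point configuration $\xi$ (identified with a point measure, points counted with multiplicity) consists of all descendants, of all generations $\ge1$, of the ancestor at $0$; the ancestor itself is not included. Since $\gamma(\mathbb{R}^d)<1$, $\xi$ is almost surely finite. The cluster started from a single point at $z$ consists of $z$ together with the points $z+x$, $x\in\xi$. Joint cumulant of random variables $Y_1,\ldots,Y_p$ with moments of all orders: $\sum_{k=1}^p(k-1)!(-1)^{k-1}\sum_{\pi_1\cup\cdots\cup\pi_k=\{1,\ldots,p\}}\prod_{j=1}^k\mathbb{E}\big[\prod_{i\in\pi_j}Y_i\big]$, the inner sum being over set partitions of $\{1,\ldots,p\}$ into $k$ nonempty blocks; equivalently, the coefficient of $t_1\cdots t_p$ in the formal power series $\log\mathbb{E}[e^{t_1Y_1+\cdots+t_pY_p}]$. For $p=1$ it is the expectation. *)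

theory Defs
  imports "HOL-Probability.Probability"
begin

(* Point configurations are finite multisets, which suffices for finite intensity measures.
   The Poisson weights are written out because poisson_pmf is only specified for positive rates,
   whereas sets of intensity 0 must be allowed. *)
definition (in prob_space) poisson_point_process ::
    "'b measure \<Rightarrow> ('a \<Rightarrow> 'b multiset) \<Rightarrow> bool" where
  "poisson_point_process \<gamma> \<eta> \<longleftrightarrow>
     (\<forall>B\<in>sets \<gamma>. (\<lambda>\<omega>. size {#x \<in># \<eta> \<omega>. x \<in> B#}) \<in> measurable M (count_space UNIV) \<and>
        (\<forall>k. prob {\<omega> \<in> space M. size {#x \<in># \<eta> \<omega>. x \<in> B#} = k} =
               measure \<gamma> B ^ k / fact k * exp (- measure \<gamma> B))) \<and>
     (\<forall>(n::nat) (B :: nat \<Rightarrow> 'b set).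
        (\<forall>i<n. B i \<in> sets \<gamma>) \<longrightarrow> disjoint_family_on B {..<n} \<longrightarrow>
        indep_vars (\<lambda>_. count_space UNIV) (\<lambda>i \<omega>. size {#x \<in># \<eta> \<omega>. x \<in> B i#}) {..<n})"

(* Individuals carry Ulam-Harris labels: the ancestor is [], and the i-th child of u is u @ [i].
   The individual u has N u children; the i-th one is displaced by X u i from u.
   The values X u i with i \<ge> N u play no role. *)
locale poisson_branching = prob_space M
  for M :: "'w measure" +
  fixes \<gamma> :: "'a::euclidean_space measure"
    and N :: "nat list \<Rightarrow> 'w \<Rightarrow> nat"
    and X :: "nat list \<Rightarrow> nat \<Rightarrow> 'w \<Rightarrow> 'a"
  assumes offspring_poisson:
      "\<And>u. poisson_point_process \<gamma> (\<lambda>\<omega>. image_mset (\<lambda>i. X u i \<omega>) (mset_set {..<N u \<omega>}))"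
    and offspring_indep:
      "indep_vars (\<lambda>_. count_space UNIV \<Otimes>\<^sub>M (\<Pi>\<^sub>M i\<in>UNIV. borel))
         (\<lambda>u \<omega>. (N u \<omega>, \<lambda>i. X u i \<omega>)) UNIV"

definition alive :: "(nat list \<Rightarrow> 'w \<Rightarrow> nat) \<Rightarrow> 'w \<Rightarrow> nat list \<Rightarrow> bool" where
  "alive N \<omega> u \<longleftrightarrow> (\<forall>j<length u. u ! j < N (take j u) \<omega>)"

(* relative to the ancestor *)
definition position :: "(nat list \<Rightarrow> nat \<Rightarrow> 'w \<Rightarrow> 'a::euclidean_space) \<Rightarrow> 'w \<Rightarrow> nat list \<Rightarrow> 'a" where
  "position X \<omega> u = (\<Sum>j<length u. X (take j u) (u ! j) \<omega>)"

(* The ancestor is excluded. For \<gamma> of total mass less than 1 there are almost surely only finitely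
   many individuals; on the exceptional null set mset_set makes the cluster empty. *)
definition cluster ::
    "(nat list \<Rightarrow> 'w \<Rightarrow> nat) \<Rightarrow> (nat list \<Rightarrow> nat \<Rightarrow> 'w \<Rightarrow> 'a::euclidean_space) \<Rightarrow> 'w \<Rightarrow> 'a multiset"
  where "cluster N X \<omega> = image_mset (position X \<omega>) (mset_set {u. u \<noteq> [] \<and> alive N \<omega> u})"

definition joint_cumulant :: "'w measure \<Rightarrow> 'i set \<Rightarrow> ('i \<Rightarrow> 'w \<Rightarrow> real) \<Rightarrow> real" where
  "joint_cumulant M A Y =
     (\<Sum>k=1..card A. fact (k - 1) * (-1) ^ (k - 1) *
        (\<Sum>P | partition_on A P \<and> card P = k. \<Prod>B\<in>P. \<integral>\<omega>. (\<Prod>i\<in>B. Y i \<omega>) \<partial>M))"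

definition cluster_cumulant ::
    "'w measure \<Rightarrow> ('w \<Rightarrow> 'a::euclidean_space multiset) \<Rightarrow> ('i \<Rightarrow> 'a \<Rightarrow> real) \<Rightarrow> 'i set \<Rightarrow> 'a \<Rightarrow> real"
  where "cluster_cumulant M \<xi> f A z =
     joint_cumulant M A (\<lambda>i \<omega>. f i z + (\<Sum>x\<in>#\<xi> \<omega>. f i (z + x)))"

end

theory Submission
  imports Defs
begin

text \<open>
  Write S(i) for the sum of f i over the cluster started at z. Splitting the cluster at the children of
  the ancestor, S(i) equals f i z plus a sum over the points x of a Poisson process of independent copies
  of the corresponding sum for the cluster started at z + x. The Mecke formula gives, for a in A,
  E (prod S over A) = f a z * E (prod S over A - {a}) + (sum over a in B, B a subset of A, of
  nu(B) * E (prod S over A - B)) with nu(B) the integral over gamma(dx) of the moment of B at z + x.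
  Joint cumulants satisfy the same kind of recursion and are determined by it, so for at least two
  functions the joint cumulant is nu(A). Expanding the moment inside nu(A) into cumulants again yields
  kappa = K (kappa + rho), where K is the convolution operator of gamma and rho collects the partitions
  with at least two blocks. Iterating, kappa is the sum of K^m rho for m from 1 to L, plus K^L kappa, and
  K^L kappa tends to 0 because the mass of the L-th convolution power of gamma decays geometrically
  while all moments are finite.
\<close>

section \<open>Moments and cumulants of set functions\<close>

text \<open>The obstacle in the last step is that moments are finite but possibly unbounded in the
  starting point, so the small mass of the L-th convolution power does not by itself make K^L kappa
  small. All functions are therefore dominated by g = |f_1| + ... + |f_n|, every cumulant and every
  product of cumulants is bounded, up to a constant, by one power moment of the cluster sum of g,
  and the missing decay is bought by passing to the moment of twice the order, which K does not
  increase. The other obstacle is measurability. A Poisson process is known only through its counts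
  on measurable sets, so the Mecke formula is proved for marks with finitely many values, where the
  process becomes a random multiset of labels, and is extended by monotone limits. The recursion is
  likewise established for extended nonnegative sums over trees cut off at generation k, where
  monotone convergence justifies every limit; finiteness and signs enter only afterwards.\<close>

lemma sum_partition_on_block:
  fixes h :: "'a set set \<Rightarrow> 'a set \<Rightarrow> 'b::comm_monoid_add"
  assumes "finite A"
  shows "(\<Sum>Q | partition_on A Q. \<Sum>D\<in>Q. h Q D) =
         (\<Sum>D | D \<subseteq> A \<and> D \<noteq> {}. \<Sum>P | partition_on (A - D) P. h (insert D P) D)"
proof -
  have fin: "finite {Q. partition_on A Q}"
    by (rule finitely_many_partition_on[OF assms])
  have bl: "\<forall>Q\<in>{Q. partition_on A Q}. finite Q"
    using assms finite_elements by auto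
  have sub: "finite {D. D \<subseteq> A \<and> D \<noteq> {}}"
    using assms by simp
  have fin': "\<forall>D\<in>{D. D \<subseteq> A \<and> D \<noteq> {}}. finite {P. partition_on (A - D) P}"
    using assms finitely_many_partition_on by (metis finite_Diff)
  have notin: "D \<notin> P" if "partition_on (A - D) P" "D \<noteq> {}" for D P
    using that by (auto simp: partition_on_def)
  have ins: "partition_on A (insert D P)"
    if "partition_on (A - D) P" "D \<noteq> {}" "D \<subseteq> A" for D P
    using that by (subst partition_on_insert) (auto simp: partition_on_def disjnt_def)
  have del: "partition_on (A - D) (Q - {D})" if "partition_on A Q" "D \<in> Q" for D Q
    using that by (auto simp: partition_on_def disjoint_def; blast)
  have "(\<Sum>Q | partition_on A Q. \<Sum>D\<in>Q. h Q D) =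
        (\<Sum>(Q, D)\<in>(SIGMA Q:{Q. partition_on A Q}. Q). h Q D)"
    by (rule sum.Sigma[OF fin bl])
  \<comment> \<open>Removing the marked block D from Q is undone by inserting it into a partition of
    A - D; since D is nonempty, it cannot already be a block there.\<close>
  also have "\<dots> = (\<Sum>(D, P)\<in>(SIGMA D:{D. D \<subseteq> A \<and> D \<noteq> {}}. {P. partition_on (A - D) P}).
                     h (insert D P) D)"
    by (rule sum.reindex_bij_witness[where i = "\<lambda>(D, P). (insert D P, D)"
          and j = "\<lambda>(Q, D). (D, Q - {D})"])
      (use notin ins del in \<open>auto simp: insert_absorb dest: partition_onD1 partition_onD3\<close>)
  also have "\<dots> = (\<Sum>D | D \<subseteq> A \<and> D \<noteq> {}. \<Sum>P | partition_on (A - D) P. h (insert D P) D)"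
    by (rule sum.Sigma[symmetric, OF sub fin'])
  finally show ?thesis .
qed

text \<open>The moments enter as an arbitrary set function, which separates the combinatorics from
  integration; \<open>m B\<close> stands for the expectation of the product over B.\<close>

definition set_cumulant :: "('i set \<Rightarrow> real) \<Rightarrow> 'i set \<Rightarrow> real" where
  "set_cumulant m A =
     (\<Sum>k=1..card A. fact (k - 1) * (-1) ^ (k - 1) *
        (\<Sum>P | partition_on A P \<and> card P = k. \<Prod>B\<in>P. m B))"

lemma card_partition_on_le:
  assumes "finite A" "partition_on A P"
  shows "card P \<le> card A"
proof -
  have "\<exists>f. \<forall>B\<in>P. f B \<in> B"
    using assms(2) by (metis all_not_in_conv partition_onD3)
  then obtain f where f: "\<And>B. B \<in> P \<Longrightarrow> f B \<in> B" by blast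
  have "inj_on f P"
    using f assms(2) by (intro inj_onI) (metis disjointD disjoint_iff partition_onD2)
  moreover have "f ` P \<subseteq> A"
    using f assms(2) by (auto dest: partition_onD1)
  ultimately show ?thesis
    by (metis assms(1) card_image card_mono)
qed

lemma card_partition_on_pos:
  assumes "finite A" "partition_on A P" "A \<noteq> {}"
  shows "card P \<ge> 1"
proof -
  have "finite P" "P \<noteq> {}"
    using assms finite_elements by (auto simp: partition_on_def)
  then show ?thesis by (simp add: Suc_le_eq card_gt_0_iff)
qed

text \<open>Used with l = 1 for the definition of the cumulant and with l = 2 for the right-hand
  side of the theorem.\<close>

lemma sum_partition_on_by_card:
  fixes h :: "'a set set \<Rightarrow> 'b::comm_monoid_add"
  assumes "finite A"
  shows "(\<Sum>k=l..card A. \<Sum>P | partition_on A P \<and> card P = k. h P) =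
         (\<Sum>P | partition_on A P \<and> l \<le> card P. h P)"
proof -
  have fin: "finite {P. partition_on A P \<and> l \<le> card P}"
    by (rule finite_subset[OF _ finitely_many_partition_on[OF assms]]) auto
  have "(\<Sum>P | partition_on A P \<and> l \<le> card P. h P) =
        (\<Sum>k=l..card A. \<Sum>P | P \<in> {P. partition_on A P \<and> l \<le> card P} \<and> card P = k. h P)"
    by (rule sum.group[symmetric]) (use fin card_partition_on_le[OF assms] in auto)
  also have "\<dots> = (\<Sum>k=l..card A. \<Sum>P | partition_on A P \<and> card P = k. h P)"
    by (rule sum.cong[OF refl], rule sum.cong) auto
  finally show ?thesis ..
qed

lemma set_cumulant_alt:
  assumes "finite A" "A \<noteq> {}"
  shows "set_cumulant m A =
    (\<Sum>P | partition_on A P. fact (card P - 1) * (-1) ^ (card P - 1) * (\<Prod>B\<in>P. m B))"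
proof -
  have "set_cumulant m A = (\<Sum>k=1..card A. \<Sum>P | partition_on A P \<and> card P = k.
          fact (card P - 1) * (-1) ^ (card P - 1) * (\<Prod>B\<in>P. m B))"
    unfolding set_cumulant_def by (simp add: sum_distrib_left)
  also have "\<dots> = (\<Sum>P | partition_on A P \<and> 1 \<le> card P.
          fact (card P - 1) * (-1) ^ (card P - 1) * (\<Prod>B\<in>P. m B))"
    by (rule sum_partition_on_by_card[OF assms(1)])
  also have "{P. partition_on A P \<and> 1 \<le> card P} = {P. partition_on A P}"
    using card_partition_on_pos[OF assms(1) _ assms(2)] by auto
  finally show ?thesis .
qed

lemma partition_on_block_of:
  assumes "partition_on A P" "a \<in> A"
  obtains C where "C \<in> P" "\<And>D. D \<in> P \<Longrightarrow> a \<in> D \<longleftrightarrow> D = C"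
proof -
  from assms obtain C where "C \<in> P" "a \<in> C" by (auto simp: partition_on_def)
  with assms show ?thesis
    by (intro that[of C]) (auto simp: partition_on_def disjoint_def)
qed

lemma partition_on_card_1:
  assumes "finite A" "A \<noteq> {}"
  shows "partition_on A P \<and> card P = 1 \<longleftrightarrow> P = {A}"
proof
  assume "partition_on A P \<and> card P = 1"
  then show "P = {A}"
    by (metis card_1_singletonE cSup_singleton partition_onD1)
qed (use assms in \<open>auto simp: partition_on_space\<close>)

text \<open>For a partition into k blocks, the coefficient (-1)^(k-1) (k-1)! of the cumulant of the whole
  set cancels against the k-1 ways of singling out a block that avoids a, unless k = 1.\<close>

lemma moment_recursion:
  fixes m :: "'i set \<Rightarrow> real"
  assumes A: "finite A" "a \<in> A" and m: "m {} = 1"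
  shows "(\<Sum>B | a \<in> B \<and> B \<subseteq> A. set_cumulant m B * m (A - B)) = m A"
proof -
  define \<mu> :: "nat \<Rightarrow> real" where "\<mu> k = fact (k - 1) * (-1) ^ (k - 1)" for k
  define h where "h Q D = (if a \<in> D then 0 else \<mu> (card Q - 1) * (\<Prod>B\<in>Q. m B))" for Q D
  have ne: "A \<noteq> {}" using A by auto
  have fin: "finite {Q. partition_on A Q}"
    by (rule finitely_many_partition_on[OF A(1)])
  have cum: "set_cumulant m B = (\<Sum>P | partition_on B P. \<mu> (card P) * (\<Prod>C\<in>P. m C))"
    if "B \<subseteq> A" "B \<noteq> {}" for B
    using set_cumulant_alt[of B m] that A(1) finite_subset unfolding \<mu>_def by blast
  have "(\<Sum>B | a \<in> B \<and> B \<subseteq> A. set_cumulant m B * m (A - B)) =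
        set_cumulant m A * m (A - A) +
        (\<Sum>B\<in>{B. a \<in> B \<and> B \<subseteq> A} - {A}. set_cumulant m B * m (A - B))"
    by (rule sum.remove) (use A in auto)
  \<comment> \<open>The complement D = A - B becomes the marked block avoiding a. The term B = A was
    split off because its complement is empty and hence not a block.\<close>
  also have "(\<Sum>B\<in>{B. a \<in> B \<and> B \<subseteq> A} - {A}. set_cumulant m B * m (A - B)) =
      (\<Sum>D | D \<subseteq> A \<and> D \<noteq> {} \<and> a \<notin> D. set_cumulant m (A - D) * m D)"
    by (rule sum.reindex_bij_witness[where i = "\<lambda>D. A - D" and j = "\<lambda>D. A - D"])
      (use A in \<open>auto simp: double_diff\<close>)
  also have "\<dots> = (\<Sum>D | D \<subseteq> A \<and> D \<noteq> {} \<and> a \<notin> D. \<Sum>P | partition_on (A - D) P. h (insert D P) D)"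
  proof (rule sum.cong[OF refl], clarify)
    fix D assume D: "D \<subseteq> A" "D \<noteq> {}" "a \<notin> D"
    have "set_cumulant m (A - D) * m D =
      (\<Sum>P | partition_on (A - D) P. \<mu> (card P) * (\<Prod>C\<in>P. m C) * m D)"
      using D A by (subst cum) (auto simp: sum_distrib_right)
    also have "\<dots> = (\<Sum>P | partition_on (A - D) P. h (insert D P) D)"
    proof (rule sum.cong[OF refl], clarify)
      fix P assume P: "partition_on (A - D) P"
      then have "D \<notin> P" "finite P"
        using D finite_elements[OF _ P] A by (auto simp: partition_on_def)
      then show "\<mu> (card P) * (\<Prod>C\<in>P. m C) * m D = h (insert D P) D"
        using D by (simp add: h_def)
    qed
    finally show "set_cumulant m (A - D) * m D =
      (\<Sum>P | partition_on (A - D) P. h (insert D P) D)" .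
  qed
  also have "\<dots> = (\<Sum>D | D \<subseteq> A \<and> D \<noteq> {}. \<Sum>P | partition_on (A - D) P. h (insert D P) D)"
    by (rule sum.mono_neutral_left) (use A in \<open>auto simp: h_def\<close>)
  also have "\<dots> = (\<Sum>Q | partition_on A Q. \<Sum>D\<in>Q. h Q D)"
    by (rule sum_partition_on_block[OF A(1), symmetric])
  also have "\<dots> = (\<Sum>Q | partition_on A Q. real (card Q - 1) * (\<mu> (card Q - 1) * (\<Prod>B\<in>Q. m B)))"
  proof (rule sum.cong[OF refl], clarify)
    fix Q assume Q: "partition_on A Q"
    obtain C where C: "C \<in> Q" "\<And>D. D \<in> Q \<Longrightarrow> a \<in> D \<longleftrightarrow> D = C"
      using partition_on_block_of[OF Q A(2)] by blast
    have finQ: "finite Q" using finite_elements[OF A(1) Q] .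
    have "(\<Sum>D\<in>Q. h Q D) = (\<Sum>D\<in>Q - {C}. \<mu> (card Q - 1) * (\<Prod>B\<in>Q. m B))"
      by (rule sum.mono_neutral_cong_right) (use C finQ in \<open>auto simp: h_def\<close>)
    then show "(\<Sum>D\<in>Q. h Q D) = real (card Q - 1) * (\<mu> (card Q - 1) * (\<Prod>B\<in>Q. m B))"
      using C finQ by simp
  qed
  also have "set_cumulant m A * m (A - A) + \<dots> =
      (\<Sum>Q | partition_on A Q. (\<mu> (card Q) + real (card Q - 1) * \<mu> (card Q - 1)) * (\<Prod>B\<in>Q. m B))"
    using cum[of A] ne m by (simp add: sum.distrib[symmetric] algebra_simps)
  also have "\<dots> = (\<Sum>Q\<in>{{A}}. \<Prod>B\<in>Q. m B)"
  proof (rule sum.mono_neutral_cong_right[OF fin])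
    show "{{A}} \<subseteq> {Q. partition_on A Q}" using ne by (simp add: partition_on_space)
    show "\<forall>Q\<in>{Q. partition_on A Q} - {{A}}.
        (\<mu> (card Q) + real (card Q - 1) * \<mu> (card Q - 1)) * (\<Prod>B\<in>Q. m B) = 0"
    proof
      fix Q assume Q: "Q \<in> {Q. partition_on A Q} - {{A}}"
      then have "card Q \<ge> 1" "card Q \<noteq> 1"
        using card_partition_on_pos[OF A(1)] partition_on_card_1[OF A(1) ne] ne by auto
      then obtain k where "card Q = Suc (Suc k)"
        by (metis One_nat_def not_one_le_zero old.nat.exhaust)
      then show "(\<mu> (card Q) + real (card Q - 1) * \<mu> (card Q - 1)) * (\<Prod>B\<in>Q. m B) = 0"
        by (simp add: \<mu>_def)
    qed
  qed (simp add: \<mu>_def)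
  finally show ?thesis by simp
qed

text \<open>The summand B = A carries the factor \<open>m {}\<close> = 1, so the recursion can be
  solved for \<open>c A\<close> in terms of c on smaller sets, and \<open>set_cumulant m\<close>
  satisfies the same recursion. The pivot a may be chosen anew for every A', which permits the
  choice \<open>Min A'\<close> later.\<close>

lemma set_cumulant_unique:
  fixes m c :: "'i set \<Rightarrow> real"
  assumes A: "finite A" "A \<noteq> {}" and m: "m {} = 1"
    and rec: "\<And>A'. A' \<subseteq> A \<Longrightarrow> A' \<noteq> {} \<Longrightarrow>
       \<exists>a\<in>A'. m A' = (\<Sum>B | a \<in> B \<and> B \<subseteq> A'. c B * m (A' - B))"
  shows "set_cumulant m A = c A"
  using A rec
proof (induction A rule: finite_psubset_induct)
  case (psubset A)
  obtain a where a: "a \<in> A" "m A = (\<Sum>B | a \<in> B \<and> B \<subseteq> A. c B * m (A - B))"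
    using psubset.prems(2)[of A] psubset.prems(1) by auto
  have split: "(\<Sum>B | a \<in> B \<and> B \<subseteq> A. k B * m (A - B)) =
      k A + (\<Sum>B\<in>{B. a \<in> B \<and> B \<subseteq> A} - {A}. k B * m (A - B))" for k
    by (subst sum.remove[of _ A]) (use a psubset.hyps m in auto)
  have eq: "set_cumulant m B = c B" if "a \<in> B" "B \<subset> A" for B
    by (rule psubset.IH) (use that psubset.prems in auto)
  have "(\<Sum>B\<in>{B. a \<in> B \<and> B \<subseteq> A} - {A}. set_cumulant m B * m (A - B)) =
      (\<Sum>B\<in>{B. a \<in> B \<and> B \<subseteq> A} - {A}. c B * m (A - B))"
    by (rule sum.cong[OF refl]) (use eq in auto)
  moreover have "(\<Sum>B | a \<in> B \<and> B \<subseteq> A. set_cumulant m B * m (A - B)) = m A"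
    by (rule moment_recursion) (use psubset.hyps a m in auto)
  ultimately show ?case
    using a(2) split[of c] split[of "set_cumulant m"] by linarith
qed

text \<open>Every partition has exactly one block B containing a. Splitting it off leaves a
  partition of A - B, so induction on A turns the moment recursion into the full expansion.\<close>

lemma moment_eq_sum_cumulants:
  fixes m :: "'i set \<Rightarrow> real"
  assumes A: "finite A" and m: "m {} = 1"
  shows "m A = (\<Sum>P | partition_on A P. \<Prod>B\<in>P. set_cumulant m B)"
  using A
proof (induction A rule: finite_psubset_induct)
  case (psubset A)
  show ?case
  proof (cases "A = {}")
    case True
    then show ?thesis using m by (simp add: partition_on_empty)
  next
    case False
    then obtain a where a: "a \<in> A" by auto
    \<comment> \<open>The default 0 for blocks avoiding a makes the sum over marked blocks pick each
      partition once.\<close>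
    define h where "h Q D = (if a \<in> D then \<Prod>B\<in>Q. set_cumulant m B else 0)" for Q D
    have "m A = (\<Sum>B | a \<in> B \<and> B \<subseteq> A. set_cumulant m B * m (A - B))"
      by (rule moment_recursion[symmetric]) (use psubset.hyps a m in auto)
    also have "\<dots> = (\<Sum>B | a \<in> B \<and> B \<subseteq> A. \<Sum>P | partition_on (A - B) P. h (insert B P) B)"
    proof (rule sum.cong[OF refl], clarify)
      fix B assume B: "a \<in> B" "B \<subseteq> A"
      have "set_cumulant m B * m (A - B) =
        (\<Sum>P | partition_on (A - B) P. set_cumulant m B * (\<Prod>B\<in>P. set_cumulant m B))"
        using B by (subst psubset.IH) (auto simp: sum_distrib_left)
      also have "\<dots> = (\<Sum>P | partition_on (A - B) P. h (insert B P) B)"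
      proof (rule sum.cong[OF refl], clarify)
        fix P assume P: "partition_on (A - B) P"
        then have "B \<notin> P" "finite P"
          using B finite_elements[OF _ P] psubset.hyps by (auto simp: partition_on_def)
        then show "set_cumulant m B * (\<Prod>B\<in>P. set_cumulant m B) = h (insert B P) B"
          using B by (simp add: h_def)
      qed
      finally show "set_cumulant m B * m (A - B) =
        (\<Sum>P | partition_on (A - B) P. h (insert B P) B)" .
    qed
    also have "\<dots> = (\<Sum>D | D \<subseteq> A \<and> D \<noteq> {}. \<Sum>P | partition_on (A - D) P. h (insert D P) D)"
    proof (rule sum.mono_neutral_left)
      show "\<forall>D\<in>{D. D \<subseteq> A \<and> D \<noteq> {}} - {B. a \<in> B \<and> B \<subseteq> A}.
          (\<Sum>P | partition_on (A - D) P. h (insert D P) D) = 0"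
      proof
        fix D assume "D \<in> {D. D \<subseteq> A \<and> D \<noteq> {}} - {B. a \<in> B \<and> B \<subseteq> A}"
        then have "a \<notin> D" by auto
        then show "(\<Sum>P | partition_on (A - D) P. h (insert D P) D) = 0" by (simp add: h_def)
      qed
    qed (use psubset.hyps in auto)
    also have "\<dots> = (\<Sum>Q | partition_on A Q. \<Sum>D\<in>Q. h Q D)"
      by (rule sum_partition_on_block[OF psubset.hyps(1), symmetric])
    also have "\<dots> = (\<Sum>Q | partition_on A Q. \<Prod>B\<in>Q. set_cumulant m B)"
    proof (rule sum.cong[OF refl], clarify)
      fix Q assume Q: "partition_on A Q"
      obtain C where C: "C \<in> Q" "\<And>D. D \<in> Q \<Longrightarrow> a \<in> D \<longleftrightarrow> D = C"
        using partition_on_block_of[OF Q a] by blast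
      have finQ: "finite Q" using finite_elements[OF _ Q] psubset.hyps by simp
      have "(\<Sum>D\<in>Q. h Q D) = (\<Sum>D\<in>{C}. \<Prod>B\<in>Q. set_cumulant m B)"
        by (rule sum.mono_neutral_cong_right) (use C finQ in \<open>auto simp: h_def\<close>)
      then show "(\<Sum>D\<in>Q. h Q D) = (\<Prod>B\<in>Q. set_cumulant m B)" by simp
    qed
    finally show ?thesis .
  qed
qed

section \<open>Products over Poisson processes\<close>

text \<open>The conditional expectation of the product over i in A of c i + (sum of the i-th marks of the points
  of \<eta>), given \<eta>, when different points carry independent marks and the marks of a point x have the
  joint moments m B x.\<close>

function (sequential) cluster_moment ::
    "(nat \<Rightarrow> ennreal) \<Rightarrow> (nat set \<Rightarrow> 'b \<Rightarrow> ennreal) \<Rightarrow> nat set \<Rightarrow> 'b multiset \<Rightarrow> ennreal" where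
  "cluster_moment c m A \<eta> =
     (if finite A \<and> A \<noteq> {} then
        c (Min A) * cluster_moment c m (A - {Min A}) \<eta> +
        (\<Sum>B | Min A \<in> B \<and> B \<subseteq> A. \<Sum>x\<in>#\<eta>. m B x * cluster_moment c m (A - B) (\<eta> - {#x#}))
      else 1)"
  by pat_completeness auto
termination
proof (relation "Wellfounded.measure (\<lambda>(c, m, A, \<eta>). card A)", goal_cases)
  case (2 c m A \<eta>)
  then have "Min A \<in> A" by auto
  then show ?case using 2 by (auto simp: card_gt_0_iff)
next
  case (3 c m A \<eta> B x)
  then have "A - B \<subset> A" by auto
  then show ?case using 3 by (auto intro: psubset_card_mono)
qed auto

declare cluster_moment.simps [simp del]

lemma cluster_moment_empty [simp]: "cluster_moment c m {} \<eta> = 1"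
  by (simp add: cluster_moment.simps)

text \<open>In the second sum, B collects the indices whose factors contribute a mark of the same
  point x as the factor of the pivot; the remaining factors then draw only on the other points,
  hence the removal of x. \<open>Min A\<close> merely makes the pivot definite.\<close>

lemma cluster_moment_rec:
  assumes "finite A" "A \<noteq> {}"
  shows "cluster_moment c m A \<eta> = c (Min A) * cluster_moment c m (A - {Min A}) \<eta> +
    (\<Sum>B | Min A \<in> B \<and> B \<subseteq> A. \<Sum>x\<in>#\<eta>. m B x * cluster_moment c m (A - B) (\<eta> - {#x#}))"
  using assms by (simp add: cluster_moment.simps[of c m A])

lemma sum_mset_cong':
  assumes "\<And>x. x \<in># \<eta> \<Longrightarrow> f x = g x"
  shows "(\<Sum>x\<in>#\<eta>. f x) = (\<Sum>x\<in>#\<eta>. g x)"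
  using assms by (metis image_mset_cong)

lemma cluster_moment_cong:
  assumes "finite A" "\<And>B x. B \<subseteq> A \<Longrightarrow> m B x = m' B x"
  shows "cluster_moment c m A \<eta> = cluster_moment c m' A \<eta>"
  using assms
proof (induction A arbitrary: \<eta> rule: finite_psubset_induct)
  case (psubset A)
  show ?case
  proof (cases "A = {}")
    case False
    then have a: "Min A \<in> A" using psubset.hyps by simp
    have 1: "cluster_moment c m (A - B) \<eta> = cluster_moment c m' (A - B) \<eta>"
      if "Min A \<in> B" for B \<eta>
      by (rule psubset.IH) (use a that psubset.prems in auto)
    show ?thesis
      unfolding cluster_moment_rec[OF psubset.hyps(1) False]
      by (intro arg_cong2[where f = "(+)"] sum.cong arg_cong[where f = "\<lambda>x. c _ * x"] sum_mset_cong')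
        (use 1 psubset.prems in auto)
  qed simp
qed

text \<open>Used in two ways: to replace points by finitely many labels, and to translate points by
  the position z of the parent.\<close>

lemma cluster_moment_image_mset:
  assumes "finite A"
  shows "cluster_moment c m A (image_mset f \<eta>) = cluster_moment c (\<lambda>B x. m B (f x)) A \<eta>"
  using assms
proof (induction A arbitrary: \<eta> rule: finite_psubset_induct)
  case (psubset A)
  show ?case
  proof (cases "A = {}")
    case False
    then have a: "Min A \<in> A" using psubset.hyps by simp
    have 1: "cluster_moment c m (A - B) (image_mset f \<eta>) = cluster_moment c (\<lambda>B x. m B (f x)) (A - B) \<eta>"
      if "Min A \<in> B" for B \<eta>
      by (rule psubset.IH) (use a that in auto)
    have 2: "(\<Sum>x\<in>#image_mset f \<eta>. m B x * cluster_moment c m (A - B) (image_mset f \<eta> - {#x#})) =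
      (\<Sum>x\<in>#\<eta>. m B (f x) * cluster_moment c (\<lambda>B x. m B (f x)) (A - B) (\<eta> - {#x#}))"
      if B: "Min A \<in> B" for B
      unfolding image_mset.compositionality comp_def
    proof (rule sum_mset_cong')
      fix x assume "x \<in># \<eta>"
      then have "image_mset f \<eta> - {#f x#} = image_mset f (\<eta> - {#x#})"
        by (simp add: image_mset_Diff)
      then show "m B (f x) * cluster_moment c m (A - B) (image_mset f \<eta> - {#f x#}) =
         m B (f x) * cluster_moment c (\<lambda>B x. m B (f x)) (A - B) (\<eta> - {#x#})"
        using 1[OF B] by simp
    qed
    show ?thesis
      unfolding cluster_moment_rec[OF psubset.hyps(1) False]
      by (intro arg_cong2[where f = "(+)"] sum.cong arg_cong[where f = "\<lambda>x. c _ * x"])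
        (use 1 2 in auto)
  qed simp
qed

section \<open>Monotone limits in the extended nonnegative reals\<close>

lemma SUP_mult_incseq_ennreal:
  fixes f g :: "nat \<Rightarrow> ennreal"
  assumes f: "incseq f" and g: "incseq g"
  shows "(SUP n. f n * g n) = (SUP n. f n) * (SUP n. g n)"
proof (rule antisym)
  show "(SUP n. f n * g n) \<le> (SUP n. f n) * (SUP n. g n)"
    by (intro SUP_least mult_mono SUP_upper) auto
  have "f i * g j \<le> (SUP n. f n * g n)" for i j
    by (rule SUP_upper2[of "max i j"]) (use f g in \<open>auto intro!: mult_mono simp: incseq_def\<close>)
  then show "(SUP n. f n) * (SUP n. g n) \<le> (SUP n. f n * g n)"
    unfolding SUP_mult_left_ennreal SUP_mult_right_ennreal by (intro SUP_least)
qed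

lemma incseq_mult_ennreal:
  fixes f g :: "nat \<Rightarrow> ennreal"
  assumes "incseq f" "incseq g"
  shows "incseq (\<lambda>n. f n * g n)"
  using assms by (auto simp: incseq_def intro!: mult_mono)

lemma incseq_add_ennreal:
  fixes f g :: "nat \<Rightarrow> ennreal"
  assumes "incseq f" "incseq g"
  shows "incseq (\<lambda>n. f n + g n)"
  using assms by (auto simp: incseq_def intro!: add_mono)

lemma incseq_sum_ennreal:
  fixes f :: "'i \<Rightarrow> nat \<Rightarrow> ennreal"
  assumes "\<And>i. i \<in> I \<Longrightarrow> incseq (f i)"
  shows "incseq (\<lambda>n. \<Sum>i\<in>I. f i n)"
  using assms by (auto simp: incseq_def intro!: sum_mono)

lemma incseq_sum_mset_ennreal:
  fixes f :: "'i \<Rightarrow> nat \<Rightarrow> ennreal"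
  assumes "\<And>i. i \<in># I \<Longrightarrow> incseq (f i)"
  shows "incseq (\<lambda>n. \<Sum>i\<in>#I. f i n)"
  using assms by (auto simp: incseq_def intro!: sum_mset_mono)

lemma SUP_sum_mset_ennreal:
  fixes f :: "'i \<Rightarrow> nat \<Rightarrow> ennreal"
  assumes "\<And>i. i \<in># I \<Longrightarrow> incseq (f i)"
  shows "(SUP n. \<Sum>i\<in>#I. f i n) = (\<Sum>i\<in>#I. SUP n. f i n)"
  using assms
proof (induction I)
  case (add x I)
  then show ?case
    by (simp add: ennreal_SUP_add incseq_sum_mset_ennreal)
qed simp

text \<open>Monotonicity and the limit are proved in one induction, because the supremum of a
  product or a sum splits only along increasing sequences. This is how marks with finitely many
  values later give way to measurable ones.\<close>

lemma cluster_moment_SUP: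
  assumes "finite A" and m: "\<And>B x. B \<subseteq> A \<Longrightarrow> incseq (\<lambda>n. m n B x)"
  shows "incseq (\<lambda>n. cluster_moment c (m n) A \<eta>) \<and>
    (SUP n. cluster_moment c (m n) A \<eta>) = cluster_moment c (\<lambda>B x. SUP n. m n B x) A \<eta>"
  using assms
proof (induction A arbitrary: \<eta> rule: finite_psubset_induct)
  case (psubset A)
  show ?case
  proof (cases "A = {}")
    case False
    then have a: "Min A \<in> A" using psubset.hyps by simp
    have IH: "incseq (\<lambda>n. cluster_moment c (m n) (A - B) \<eta>)"
        "(SUP n. cluster_moment c (m n) (A - B) \<eta>) = cluster_moment c (\<lambda>B x. SUP n. m n B x) (A - B) \<eta>"
      if "Min A \<in> B" for B \<eta>
      using psubset.IH[of "A - B" \<eta>] a that psubset.prems by auto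
    have 1: "incseq (\<lambda>n. c (Min A) * cluster_moment c (m n) (A - {Min A}) \<eta>)"
      by (rule incseq_mult_ennreal) (use IH in \<open>auto simp: incseq_def\<close>)
    have 2: "incseq (\<lambda>n. m n B x * cluster_moment c (m n) (A - B) (\<eta> - {#x#}))"
      if "Min A \<in> B" "B \<subseteq> A" for B x
      by (rule incseq_mult_ennreal) (use IH psubset.prems that in auto)
    have 3: "incseq (\<lambda>n. \<Sum>x\<in>#\<eta>. m n B x * cluster_moment c (m n) (A - B) (\<eta> - {#x#}))"
      if "Min A \<in> B" "B \<subseteq> A" for B
      by (rule incseq_sum_mset_ennreal) (use 2 that in auto)
    have 4: "incseq (\<lambda>n. \<Sum>B | Min A \<in> B \<and> B \<subseteq> A. \<Sum>x\<in>#\<eta>. m n B x * cluster_moment c (m n) (A - B) (\<eta> - {#x#}))"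
      by (rule incseq_sum_ennreal) (use 3 in auto)
    have 5: "(SUP n. \<Sum>x\<in>#\<eta>. m n B x * cluster_moment c (m n) (A - B) (\<eta> - {#x#})) =
      (\<Sum>x\<in>#\<eta>. (SUP n. m n B x) * cluster_moment c (\<lambda>B x. SUP n. m n B x) (A - B) (\<eta> - {#x#}))"
      if "Min A \<in> B" "B \<subseteq> A" for B
      using that psubset.prems
      by (subst SUP_sum_mset_ennreal) (auto simp: 2 SUP_mult_incseq_ennreal IH intro!: sum_mset_cong')
    have "(SUP n. \<Sum>B | Min A \<in> B \<and> B \<subseteq> A. \<Sum>x\<in>#\<eta>. m n B x * cluster_moment c (m n) (A - B) (\<eta> - {#x#})) =
      (\<Sum>B | Min A \<in> B \<and> B \<subseteq> A. \<Sum>x\<in>#\<eta>. (SUP n. m n B x) * cluster_moment c (\<lambda>B x. SUP n. m n B x) (A - B) (\<eta> - {#x#}))"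
      by (subst ennreal_SUP_sum) (auto simp: 3 5)
    moreover have "(SUP n. c (Min A) * cluster_moment c (m n) (A - {Min A}) \<eta>) =
      c (Min A) * cluster_moment c (\<lambda>B x. SUP n. m n B x) (A - {Min A}) \<eta>"
      by (subst SUP_mult_left_ennreal[symmetric]) (simp add: IH)
    ultimately show ?thesis
      unfolding cluster_moment_rec[OF psubset.hyps(1) False]
      using incseq_add_ennreal[OF 1 4] by (simp add: ennreal_SUP_add[OF 1 4])
  qed simp
qed

section \<open>The Mecke formula for finitely many labels\<close>

instance multiset :: (countable) countable
proof
  have "inj (\<lambda>\<theta> :: 'a multiset. SOME xs. mset xs = \<theta>)"
    by (rule inj_on_inverseI[where g = mset]) (rule someI_ex[OF ex_mset])
  then have "inj (to_nat \<circ> (\<lambda>\<theta> :: 'a multiset. SOME xs. mset xs = \<theta>))"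
    by (intro inj_compose inj_to_nat)
  then show "\<exists>to_nat :: 'a multiset \<Rightarrow> nat. inj to_nat" by blast
qed

text \<open>Multisets of labels form a countable type, so the law of a random label multiset is its
  family of point masses and expectations become sums over configurations.\<close>

lemma (in prob_space) nn_integral_countable_rv:
  fixes \<zeta> :: "'a \<Rightarrow> 'b::countable" and F :: "'b \<Rightarrow> ennreal"
  assumes [measurable]: "\<zeta> \<in> measurable M (count_space UNIV)"
  shows "(\<integral>\<^sup>+\<omega>. F (\<zeta> \<omega>) \<partial>M) =
    (\<integral>\<^sup>+\<theta>. ennreal (prob {\<omega>\<in>space M. \<zeta> \<omega> = \<theta>}) * F \<theta> \<partial>count_space UNIV)"
proof -
  have eq: "distr M (count_space UNIV) \<zeta> =
      density (count_space UNIV) (\<lambda>\<theta>. ennreal (prob {\<omega>\<in>space M. \<zeta> \<omega> = \<theta>}))"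
  proof (rule measure_eqI_countable[of _ UNIV])
    fix a
    have "emeasure (distr M (count_space UNIV) \<zeta>) {a} = emeasure M {\<omega>\<in>space M. \<zeta> \<omega> = a}"
      by (subst emeasure_distr) (auto intro!: arg_cong[where f = "emeasure M"])
    then show "emeasure (distr M (count_space UNIV) \<zeta>) {a} =
      emeasure (density (count_space UNIV) (\<lambda>\<theta>. ennreal (prob {\<omega>\<in>space M. \<zeta> \<omega> = \<theta>}))) {a}"
      by (subst emeasure_density) (auto simp: emeasure_eq_measure)
  qed auto
  have "(\<integral>\<^sup>+\<omega>. F (\<zeta> \<omega>) \<partial>M) = (\<integral>\<^sup>+\<theta>. F \<theta> \<partial>distr M (count_space UNIV) \<zeta>)"
    by (subst nn_integral_distr) auto
  also have "\<dots> = (\<integral>\<^sup>+\<theta>. ennreal (prob {\<omega>\<in>space M. \<zeta> \<omega> = \<theta>}) * F \<theta> \<partial>count_space UNIV)"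
    unfolding eq by (subst nn_integral_density) auto
  finally show ?thesis .
qed

text \<open>The Mecke formula for finitely many labels rests on the identity
  (j + 1) p(j + 1) = r p(j) for the weights p of the Poisson distribution with rate r.\<close>

lemma (in prob_space) mecke_labels_single:
  fixes \<zeta> :: "'a \<Rightarrow> nat multiset" and F :: "nat multiset \<Rightarrow> ennreal"
  assumes [measurable]: "\<zeta> \<in> measurable M (count_space UNIV)"
    and r: "\<And>r. r < K \<Longrightarrow> 0 \<le> l r"
    and law: "\<And>\<theta>. prob {\<omega>\<in>space M. \<zeta> \<omega> = \<theta>} =
      (if set_mset \<theta> \<subseteq> {..<K} then \<Prod>r<K. l r ^ count \<theta> r / fact (count \<theta> r) * exp (- l r) else 0)"
    and k: "k < K"
  shows "(\<integral>\<^sup>+\<omega>. of_nat (count (\<zeta> \<omega>) k) * F (\<zeta> \<omega> - {#k#}) \<partial>M) = ennreal (l k) * (\<integral>\<^sup>+\<omega>. F (\<zeta> \<omega>) \<partial>M)"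
proof -
  define p where "p \<theta> = prob {\<omega>\<in>space M. \<zeta> \<omega> = \<theta>}" for \<theta>
  have p: "p (add_mset k \<theta>) * real (Suc (count \<theta> k)) = l k * p \<theta>" for \<theta>
  proof (cases "set_mset \<theta> \<subseteq> {..<K}")
    case True
    define q where "q \<theta> r = l r ^ count \<theta> r / fact (count \<theta> r) * exp (- l r)" for \<theta> r
    have "p (add_mset k \<theta>) = q (add_mset k \<theta>) k * (\<Prod>r\<in>{..<K} - {k}. q (add_mset k \<theta>) r)"
      using True k by (simp add: p_def law q_def prod.remove[of "{..<K}" k])
    also have "(\<Prod>r\<in>{..<K} - {k}. q (add_mset k \<theta>) r) = (\<Prod>r\<in>{..<K} - {k}. q \<theta> r)"
      by (rule prod.cong) (auto simp: q_def)
    also have "q (add_mset k \<theta>) k = l k / real (Suc (count \<theta> k)) * q \<theta> k"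
      by (simp add: q_def field_simps)
    finally have "p (add_mset k \<theta>) * real (Suc (count \<theta> k)) = l k * (q \<theta> k * (\<Prod>r\<in>{..<K} - {k}. q \<theta> r))"
      by (simp add: field_simps)
    also have "q \<theta> k * (\<Prod>r\<in>{..<K} - {k}. q \<theta> r) = p \<theta>"
      using True k by (simp add: p_def law q_def prod.remove[of "{..<K}" k])
    finally show ?thesis .
  qed (auto simp: p_def law)
  \<comment> \<open>Adding a point with label k matches all configurations with those containing k;
    the others are weighted by \<open>count \<theta> k\<close> = 0.\<close>
  have bij: "bij_betw (add_mset k) UNIV {\<theta>. k \<in># \<theta>}"
    by (rule bij_betwI[where g = "\<lambda>\<theta>. \<theta> - {#k#}"]) auto
  have "(\<integral>\<^sup>+\<omega>. of_nat (count (\<zeta> \<omega>) k) * F (\<zeta> \<omega> - {#k#}) \<partial>M) =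
      (\<integral>\<^sup>+\<theta>. ennreal (p \<theta>) * (of_nat (count \<theta> k) * F (\<theta> - {#k#})) \<partial>count_space UNIV)"
    unfolding p_def
    by (rule nn_integral_countable_rv[OF assms(1), of "\<lambda>\<theta>. of_nat (count \<theta> k) * F (\<theta> - {#k#})"])
  also have "\<dots> = (\<integral>\<^sup>+\<theta>. ennreal (p \<theta>) * (of_nat (count \<theta> k) * F (\<theta> - {#k#})) \<partial>count_space {\<theta>. k \<in># \<theta>})"
    by (rule nn_integral_count_space_eq) (auto simp: not_in_iff)
  also have "\<dots> = (\<integral>\<^sup>+\<theta>. ennreal (p (add_mset k \<theta>)) * (of_nat (Suc (count \<theta> k)) * F \<theta>) \<partial>count_space UNIV)"
    by (subst nn_integral_bij_count_space[OF bij, symmetric]) simp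
  also have "\<dots> = (\<integral>\<^sup>+\<theta>. ennreal (l k) * (ennreal (p \<theta>) * F \<theta>) \<partial>count_space UNIV)"
  proof (rule nn_integral_cong)
    fix \<theta>
    have "ennreal (p (add_mset k \<theta>)) * of_nat (Suc (count \<theta> k)) = ennreal (l k) * ennreal (p \<theta>)"
    proof -
      have "ennreal (p (add_mset k \<theta>)) * of_nat (Suc (count \<theta> k)) =
          ennreal (p (add_mset k \<theta>) * real (Suc (count \<theta> k)))"
        unfolding ennreal_of_nat_eq_real_of_nat by (rule ennreal_mult[symmetric]) (auto simp: p_def)
      also have "\<dots> = ennreal (l k) * ennreal (p \<theta>)"
        unfolding p using r[OF k] by (intro ennreal_mult) (auto simp: p_def)
      finally show ?thesis .
    qed
    then show "ennreal (p (add_mset k \<theta>)) * (of_nat (Suc (count \<theta> k)) * F \<theta>) =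
        ennreal (l k) * (ennreal (p \<theta>) * F \<theta>)"
      by (simp only: mult.assoc[symmetric])
  qed
  also have "\<dots> = ennreal (l k) * (\<integral>\<^sup>+\<omega>. F (\<zeta> \<omega>) \<partial>M)"
    unfolding p_def by (subst nn_integral_cmult) (auto simp: nn_integral_countable_rv)
  finally show ?thesis .
qed

lemma sum_mset_eq_sum_count:
  fixes h :: "'b \<Rightarrow> ennreal"
  assumes "finite S" "set_mset \<theta> \<subseteq> S"
  shows "(\<Sum>x\<in>#\<theta>. h x) = (\<Sum>x\<in>S. of_nat (count \<theta> x) * h x)"
  using assms(2)
proof (induction \<theta>)
  case (add x \<theta>)
  have "(\<Sum>y\<in>S. of_nat (count (add_mset x \<theta>) y) * h y) =
      (\<Sum>y\<in>S. (if y = x then h y else 0) + of_nat (count \<theta> y) * h y)"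
    by (rule sum.cong) (auto simp: algebra_simps)
  then show ?case
    using add assms(1) by (simp add: sum.distrib)
qed simp

text \<open>Points with the same label contribute equally, so the sum over points is a sum over the
  K labels weighted by multiplicity, and the formula for one label applies to each summand.\<close>

lemma (in prob_space) mecke_labels:
  fixes \<zeta> :: "'a \<Rightarrow> nat multiset" and F :: "nat multiset \<Rightarrow> ennreal"
  assumes [measurable]: "\<zeta> \<in> measurable M (count_space UNIV)"
    and r: "\<And>r. r < K \<Longrightarrow> 0 \<le> l r"
    and law: "\<And>\<theta>. prob {\<omega>\<in>space M. \<zeta> \<omega> = \<theta>} =
      (if set_mset \<theta> \<subseteq> {..<K} then \<Prod>r<K. l r ^ count \<theta> r / fact (count \<theta> r) * exp (- l r) else 0)"
    and sub: "\<And>\<omega>. set_mset (\<zeta> \<omega>) \<subseteq> {..<K}"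
  shows "(\<integral>\<^sup>+\<omega>. (\<Sum>x\<in>#\<zeta> \<omega>. g x * F (\<zeta> \<omega> - {#x#})) \<partial>M) =
    (\<Sum>r<K. ennreal (l r) * g r) * (\<integral>\<^sup>+\<omega>. F (\<zeta> \<omega>) \<partial>M)"
proof -
  have [measurable]: "(\<lambda>\<omega>. G (\<zeta> \<omega>)) \<in> borel_measurable M" for G :: "nat multiset \<Rightarrow> ennreal"
    by (rule measurable_compose[OF assms(1)]) simp
  have "(\<integral>\<^sup>+\<omega>. (\<Sum>x\<in>#\<zeta> \<omega>. g x * F (\<zeta> \<omega> - {#x#})) \<partial>M) =
      (\<integral>\<^sup>+\<omega>. (\<Sum>r<K. g r * (of_nat (count (\<zeta> \<omega>) r) * F (\<zeta> \<omega> - {#r#}))) \<partial>M)"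
    by (subst sum_mset_eq_sum_count[of "{..<K}"]) (auto simp: sub mult_ac)
  also have "\<dots> = (\<Sum>r<K. g r * (\<integral>\<^sup>+\<omega>. of_nat (count (\<zeta> \<omega>) r) * F (\<zeta> \<omega> - {#r#}) \<partial>M))"
    by (subst nn_integral_sum)
      (auto intro!: sum.cong nn_integral_cmult measurable_compose[OF assms(1)])
  also have "\<dots> = (\<Sum>r<K. ennreal (l r) * g r * (\<integral>\<^sup>+\<omega>. F (\<zeta> \<omega>) \<partial>M))"
    by (intro sum.cong refl) (simp add: mecke_labels_single[OF assms(1) r law] mult_ac)
  finally show ?thesis by (simp add: sum_distrib_right)
qed

text \<open>Jointly, the finitely many simple functions \<open>s B\<close> form one map with finite
  range. Numbering its values gives a single label that determines all of them at once, and each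
  label set is a finite intersection of level sets.\<close>

lemma finite_valued_family_label:
  fixes s :: "nat set \<Rightarrow> 'b \<Rightarrow> ennreal"
  assumes \<gamma>: "space \<gamma> = UNIV" and A: "finite A"
    and s: "\<And>B. B \<subseteq> A \<Longrightarrow> simple_function \<gamma> (s B)"
  shows "\<exists>(e :: 'b \<Rightarrow> nat) K m. e \<in> measurable \<gamma> (count_space UNIV) \<and> (\<forall>x. e x < K) \<and>
    (\<forall>B x. B \<subseteq> A \<longrightarrow> s B x = m B (e x))"
proof -
  \<comment> \<open>The value 0 outside \<open>Pow A\<close> keeps the range of g finite.\<close>
  define g where "g x B = (if B \<subseteq> A then s B x else 0)" for x B
  have R: "range g \<subseteq> {f. \<forall>B. (B \<in> Pow A \<longrightarrow> f B \<in> (\<Union>B\<in>Pow A. range (s B))) \<and> (B \<notin> Pow A \<longrightarrow> f B = 0)}"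
  proof (rule image_subsetI, rule CollectI, intro allI conjI impI)
    fix x B
    show "g x B \<in> (\<Union>B\<in>Pow A. range (s B))" if "B \<in> Pow A"
      using that by (intro UN_I[of B]) (auto simp: g_def)
    show "g x B = 0" if "B \<notin> Pow A"
      using that by (simp add: g_def)
  qed
  have F: "finite (\<Union>B\<in>Pow A. range (s B))"
  proof (rule finite_UN_I)
    show "finite (range (s B))" if "B \<in> Pow A" for B
      using s[of B] that \<gamma> unfolding simple_function_def by simp
  qed (use A in simp)
  have fin: "finite (range g)"
    by (rule finite_subset[OF R finite_set_of_finite_funs[OF _ F]]) (use A in simp)
  from finite_imp_inj_to_nat_seg[OF this]
  obtain h and K :: nat where h: "h ` range g = {i. i < K}" "inj_on h (range g)"
    by (elim exE conjE)
  define m where "m B i = inv_into (range g) h i B" for B i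
  have s_eq: "s B x = m B (h (g x))" if "B \<subseteq> A" for B x
  proof -
    have "inv_into (range g) h (h (g x)) = g x"
      using h(2) by (rule inv_into_f_f) simp
    then show ?thesis using that by (simp add: m_def g_def)
  qed
  have lt: "h (g x) < K" for x
  proof -
    have "h (g x) \<in> h ` range g" by (intro imageI rangeI)
    then show ?thesis unfolding h(1) by simp
  qed
  have [measurable]: "s B \<in> borel_measurable \<gamma>" if "B \<subseteq> A" for B
    using s[OF that] by (rule borel_measurable_simple_function)
  have "(\<lambda>x. h (g x)) \<in> measurable \<gamma> (count_space UNIV)"
    unfolding measurable_count_space_eq2_countable
  proof safe
    fix i
    show "(\<lambda>x. h (g x)) -` {i} \<inter> space \<gamma> \<in> sets \<gamma>"
    proof (cases "i < K")
      case True
      then have "i \<in> h ` range g" unfolding h(1) by simp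
      then obtain y where y: "i = h (g y)" by blast
      have "h (g x) = h (g y) \<longleftrightarrow> (\<forall>B\<in>Pow A. s B x = s B y)" for x
      proof -
        have "h (g x) = h (g y) \<longleftrightarrow> g x = g y"
          by (rule inj_on_eq_iff[OF h(2)]) simp_all
        also have "\<dots> \<longleftrightarrow> (\<forall>B\<in>Pow A. s B x = s B y)"
          unfolding fun_eq_iff by (simp add: g_def Ball_def)
        finally show ?thesis .
      qed
      then have "(\<lambda>x. h (g x)) -` {i} \<inter> space \<gamma> = {x\<in>space \<gamma>. \<forall>B\<in>Pow A. s B x = s B y}"
        by (auto simp: y)
      also have "\<dots> \<in> sets \<gamma>"
        by (intro sets.sets_Collect_finite_All) (use A in auto)
      finally show ?thesis .
    next
      case False
      then have "(\<lambda>x. h (g x)) -` {i} \<inter> space \<gamma> = {}" using lt by auto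
      then show ?thesis by (simp only: sets.empty_sets)
    qed
  qed simp
  then show ?thesis using lt s_eq by (intro exI[of _ "\<lambda>x. h (g x)"] exI[of _ K] exI[of _ m]) simp
qed

section \<open>The Mecke formula for general intensity measures\<close>

context prob_space
begin

lemma poisson_point_process_labels:
  fixes \<eta> :: "'a \<Rightarrow> 'b multiset" and c :: "'b \<Rightarrow> nat"
  assumes ppp: "poisson_point_process \<gamma> \<eta>" and \<gamma>: "space \<gamma> = UNIV"
    and c: "c \<in> measurable \<gamma> (count_space UNIV)" "\<And>x. c x < K"
  shows "(\<lambda>\<omega>. image_mset c (\<eta> \<omega>)) \<in> measurable M (count_space UNIV)"
    and "prob {\<omega>\<in>space M. image_mset c (\<eta> \<omega>) = \<theta>} =
      (if set_mset \<theta> \<subseteq> {..<K} then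
        \<Prod>r<K. measure \<gamma> (c -` {r}) ^ count \<theta> r / fact (count \<theta> r) * exp (- measure \<gamma> (c -` {r})) else 0)"
proof -
  define n where "n r \<omega> = size {#x \<in># \<eta> \<omega>. x \<in> c -` {r}#}" for r \<omega>
  have count: "count (image_mset c (\<eta> \<omega>)) r = n r \<omega>" for r \<omega>
    by (simp add: n_def count_conv_size_mset filter_mset_image_mset)
  have sub: "set_mset (image_mset c (\<eta> \<omega>)) \<subseteq> {..<K}" for \<omega>
    using c by auto
  have B: "c -` {r} \<in> sets \<gamma>" for r
    using measurable_sets[OF c(1), of "{r}"] \<gamma> by simp
  have n[measurable]: "n r \<in> measurable M (count_space UNIV)"
    and law: "prob {\<omega>\<in>space M. n r \<omega> = k} =
      measure \<gamma> (c -` {r}) ^ k / fact k * exp (- measure \<gamma> (c -` {r}))" for r k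
    using ppp B[of r] unfolding poisson_point_process_def n_def[abs_def] by blast+
  have "disjoint_family_on (\<lambda>r. c -` {r}) {..<K}"
    by (auto simp: disjoint_family_on_def)
  then have "indep_vars (\<lambda>_. count_space UNIV) (\<lambda>i \<omega>. size {#x \<in># \<eta> \<omega>. x \<in> c -` {i}#}) {..<K}"
    using ppp B unfolding poisson_point_process_def
    by (elim conjE allE[of _ K] allE[of _ "\<lambda>r. c -` {r}"]) simp
  then have indep: "indep_vars (\<lambda>_. count_space UNIV) n {..<K}"
    unfolding n_def[abs_def] .
  have eq: "image_mset c (\<eta> \<omega>) = \<theta> \<longleftrightarrow> (\<forall>r<K. n r \<omega> = count \<theta> r)"
    if "set_mset \<theta> \<subseteq> {..<K}" for \<theta> \<omega>
  proof -
    have "image_mset c (\<eta> \<omega>) = \<theta>" if "\<forall>r<K. n r \<omega> = count \<theta> r"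
    proof (rule multiset_eqI)
      fix r show "count (image_mset c (\<eta> \<omega>)) r = count \<theta> r"
        using that sub[of \<omega>] \<open>set_mset \<theta> \<subseteq> {..<K}\<close> unfolding count[symmetric]
        by (cases "r < K") (simp, metis count_eq_zero_iff lessThan_iff subsetD)
    qed
    then show ?thesis by (auto simp: count[symmetric])
  qed
  \<comment> \<open>The product rule for independent events requires a nonempty index set; K cannot
    be 0 because some label lies below it.\<close>
  have K: "{..<K} \<noteq> {}" using c(2)[of undefined] by auto
  show "(\<lambda>\<omega>. image_mset c (\<eta> \<omega>)) \<in> measurable M (count_space UNIV)"
    unfolding measurable_count_space_eq2_countable
  proof safe
    fix \<theta>
    show "(\<lambda>\<omega>. image_mset c (\<eta> \<omega>)) -` {\<theta>} \<inter> space M \<in> sets M"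
    proof (cases "set_mset \<theta> \<subseteq> {..<K}")
      case True
      have "(\<lambda>\<omega>. image_mset c (\<eta> \<omega>)) -` {\<theta>} \<inter> space M = {\<omega>\<in>space M. \<forall>r<K. n r \<omega> = count \<theta> r}"
        using eq[OF True] by auto
      then show ?thesis by simp
    next
      case False
      then have "(\<lambda>\<omega>. image_mset c (\<eta> \<omega>)) -` {\<theta>} \<inter> space M = {}"
        using sub by (auto simp del: set_image_mset)
      then show ?thesis by (simp only: sets.empty_sets)
    qed
  qed simp
  show "prob {\<omega>\<in>space M. image_mset c (\<eta> \<omega>) = \<theta>} =
      (if set_mset \<theta> \<subseteq> {..<K} then
        \<Prod>r<K. measure \<gamma> (c -` {r}) ^ count \<theta> r / fact (count \<theta> r) * exp (- measure \<gamma> (c -` {r})) else 0)"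
  proof (cases "set_mset \<theta> \<subseteq> {..<K}")
    case True
    have "{\<omega>\<in>space M. image_mset c (\<eta> \<omega>) = \<theta>} = (\<Inter>r\<in>{..<K}. n r -` {count \<theta> r} \<inter> space M)"
      using eq[OF True] K by auto
    also have "prob \<dots> = (\<Prod>r<K. prob (n r -` {count \<theta> r} \<inter> space M))"
      by (rule indep_varsD_finite[OF indep K]) auto
    also have "\<dots> = (\<Prod>r<K. measure \<gamma> (c -` {r}) ^ count \<theta> r / fact (count \<theta> r) * exp (- measure \<gamma> (c -` {r})))"
      by (intro prod.cong refl, subst law[symmetric]) (auto intro!: arg_cong[where f = prob])
    finally show ?thesis using True by simp
  next
    case False
    then have "{\<omega>\<in>space M. image_mset c (\<eta> \<omega>) = \<theta>} = {}"
      using sub by (auto simp del: set_image_mset)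
    then show ?thesis using False by (simp only: measure_empty if_False)
  qed
qed

text \<open>After passing to labels, the recursion of \<open>cluster_moment\<close> has exactly the
  form treated by the Mecke formula: a function of a point times a function of the configuration
  without that point.\<close>

lemma poisson_cluster_moment_labels:
  fixes \<eta> :: "'a \<Rightarrow> 'b multiset" and e :: "'b \<Rightarrow> nat" and m :: "nat set \<Rightarrow> nat \<Rightarrow> ennreal"
  assumes ppp: "poisson_point_process \<gamma> \<eta>" and \<gamma>: "space \<gamma> = UNIV" "finite_measure \<gamma>"
    and e: "e \<in> measurable \<gamma> (count_space UNIV)" "\<And>x. e x < K"
    and A: "finite A" "A \<noteq> {}"
  defines "\<mu> \<equiv> \<lambda>B x. m B (e x)"
  shows "(\<lambda>\<omega>. cluster_moment c \<mu> A' (\<eta> \<omega>)) \<in> borel_measurable M"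
    and "(\<integral>\<^sup>+\<omega>. cluster_moment c \<mu> A (\<eta> \<omega>) \<partial>M) =
      c (Min A) * (\<integral>\<^sup>+\<omega>. cluster_moment c \<mu> (A - {Min A}) (\<eta> \<omega>) \<partial>M) +
      (\<Sum>B | Min A \<in> B \<and> B \<subseteq> A. (\<integral>\<^sup>+x. \<mu> B x \<partial>\<gamma>) * (\<integral>\<^sup>+\<omega>. cluster_moment c \<mu> (A - B) (\<eta> \<omega>) \<partial>M))"
proof -
  interpret \<gamma>: finite_measure \<gamma> by fact
  define \<zeta> where "\<zeta> \<omega> = image_mset e (\<eta> \<omega>)" for \<omega>
  note lab = poisson_point_process_labels[OF ppp \<gamma>(1) e, folded \<zeta>_def]
  have \<zeta>: "\<zeta> \<in> measurable M (count_space UNIV)"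
    using lab(1) by (simp add: \<zeta>_def[abs_def])
  have eq: "cluster_moment c \<mu> B (\<eta> \<omega>) = cluster_moment c m B (\<zeta> \<omega>)" if "finite B" for B \<omega>
    unfolding \<mu>_def \<zeta>_def by (rule cluster_moment_image_mset[OF that, symmetric])
  have meas: "(\<lambda>\<omega>. G (\<zeta> \<omega>)) \<in> borel_measurable M" for G :: "nat multiset \<Rightarrow> ennreal"
    by (rule measurable_compose[OF \<zeta>]) simp
  show "(\<lambda>\<omega>. cluster_moment c \<mu> A' (\<eta> \<omega>)) \<in> borel_measurable M"
  proof (cases "finite A'")
    case True
    show ?thesis unfolding eq[OF True] by (rule meas)
  qed (simp add: cluster_moment.simps)
  have int: "(\<integral>\<^sup>+x. \<mu> B x \<partial>\<gamma>) = (\<Sum>r<K. ennreal (measure \<gamma> (e -` {r})) * m B r)" for B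
  proof -
    have "(\<integral>\<^sup>+x. \<mu> B x \<partial>\<gamma>) = (\<integral>\<^sup>+x. (\<Sum>r<K. m B r * indicator (e -` {r}) x) \<partial>\<gamma>)"
    proof (rule nn_integral_cong)
      fix x
      have "(\<Sum>r<K. m B r * indicator (e -` {r}) x) = (\<Sum>r\<in>{e x}. m B r * indicator (e -` {r}) x)"
        by (rule sum.mono_neutral_right) (use e in \<open>auto simp: indicator_def\<close>)
      then show "\<mu> B x = (\<Sum>r<K. m B r * indicator (e -` {r}) x)"
        by (simp add: \<mu>_def)
    qed
    also have "\<dots> = (\<Sum>r<K. m B r * emeasure \<gamma> (e -` {r}))"
    proof (subst nn_integral_sum)
      have [measurable]: "e -` {r} \<in> sets \<gamma>" for r
        using measurable_sets[OF e(1), of "{r}"] \<gamma> by simp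
      show "(\<lambda>x. m B r * indicator (e -` {r}) x) \<in> borel_measurable \<gamma>" for r
        by measurable
      show "(\<Sum>r<K. \<integral>\<^sup>+x. m B r * indicator (e -` {r}) x \<partial>\<gamma>) = (\<Sum>r<K. m B r * emeasure \<gamma> (e -` {r}))"
        by (simp add: nn_integral_cmult_indicator)
    qed
    finally show ?thesis by (simp add: \<gamma>.emeasure_eq_measure mult.commute)
  qed
  have "(\<integral>\<^sup>+\<omega>. cluster_moment c m A (\<zeta> \<omega>) \<partial>M) =
      (\<integral>\<^sup>+\<omega>. c (Min A) * cluster_moment c m (A - {Min A}) (\<zeta> \<omega>) \<partial>M) +
      (\<Sum>B | Min A \<in> B \<and> B \<subseteq> A.
        \<integral>\<^sup>+\<omega>. (\<Sum>x\<in>#\<zeta> \<omega>. m B x * cluster_moment c m (A - B) (\<zeta> \<omega> - {#x#})) \<partial>M)"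
  proof -
    let ?f = "\<lambda>\<theta>. c (Min A) * cluster_moment c m (A - {Min A}) \<theta>"
    let ?g = "\<lambda>B \<theta>. \<Sum>x\<in>#\<theta>. m B x * cluster_moment c m (A - B) (\<theta> - {#x#})"
    have "(\<integral>\<^sup>+\<omega>. ?f (\<zeta> \<omega>) + (\<Sum>B | Min A \<in> B \<and> B \<subseteq> A. ?g B (\<zeta> \<omega>)) \<partial>M) =
        (\<integral>\<^sup>+\<omega>. ?f (\<zeta> \<omega>) \<partial>M) + (\<integral>\<^sup>+\<omega>. (\<Sum>B | Min A \<in> B \<and> B \<subseteq> A. ?g B (\<zeta> \<omega>)) \<partial>M)"
      by (rule nn_integral_add[OF meas[of ?f] meas[of "\<lambda>\<theta>. \<Sum>B | Min A \<in> B \<and> B \<subseteq> A. ?g B \<theta>"]])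
    moreover have "(\<integral>\<^sup>+\<omega>. (\<Sum>B | Min A \<in> B \<and> B \<subseteq> A. ?g B (\<zeta> \<omega>)) \<partial>M) =
        (\<Sum>B | Min A \<in> B \<and> B \<subseteq> A. \<integral>\<^sup>+\<omega>. ?g B (\<zeta> \<omega>) \<partial>M)"
    proof (rule nn_integral_sum)
      show "(\<lambda>\<omega>. ?g B (\<zeta> \<omega>)) \<in> borel_measurable M" for B
        by (rule meas[of "?g B"])
    qed
    ultimately show ?thesis
      unfolding cluster_moment_rec[OF A] by (simp only:)
  qed
  also have "(\<integral>\<^sup>+\<omega>. c (Min A) * cluster_moment c m (A - {Min A}) (\<zeta> \<omega>) \<partial>M) =
      c (Min A) * (\<integral>\<^sup>+\<omega>. cluster_moment c m (A - {Min A}) (\<zeta> \<omega>) \<partial>M)"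
    by (rule nn_integral_cmult) (rule meas)
  also have "(\<Sum>B | Min A \<in> B \<and> B \<subseteq> A.
        \<integral>\<^sup>+\<omega>. (\<Sum>x\<in>#\<zeta> \<omega>. m B x * cluster_moment c m (A - B) (\<zeta> \<omega> - {#x#})) \<partial>M) =
      (\<Sum>B | Min A \<in> B \<and> B \<subseteq> A. (\<integral>\<^sup>+x. \<mu> B x \<partial>\<gamma>) * (\<integral>\<^sup>+\<omega>. cluster_moment c m (A - B) (\<zeta> \<omega>) \<partial>M))"
    unfolding int
    by (intro sum.cong refl mecke_labels[OF \<zeta> _ lab(2)]) (use e in \<open>auto simp: \<zeta>_def\<close>)
  finally show "(\<integral>\<^sup>+\<omega>. cluster_moment c \<mu> A (\<eta> \<omega>) \<partial>M) =
      c (Min A) * (\<integral>\<^sup>+\<omega>. cluster_moment c \<mu> (A - {Min A}) (\<eta> \<omega>) \<partial>M) +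
      (\<Sum>B | Min A \<in> B \<and> B \<subseteq> A. (\<integral>\<^sup>+x. \<mu> B x \<partial>\<gamma>) * (\<integral>\<^sup>+\<omega>. cluster_moment c \<mu> (A - B) (\<eta> \<omega>) \<partial>M))"
    using A(1) by (simp add: eq)
qed

text \<open>All \<open>m B\<close> with B a subset of A are approximated simultaneously by
  increasing simple functions. Each stage factors through finitely many labels, and both sides of
  the identity are continuous along increasing sequences.\<close>

theorem poisson_cluster_moment:
  fixes \<eta> :: "'a \<Rightarrow> 'b multiset"
  assumes ppp: "poisson_point_process \<gamma> \<eta>" and \<gamma>: "space \<gamma> = UNIV" "finite_measure \<gamma>"
    and A: "finite A" "A \<noteq> {}"
    and m: "\<And>B. B \<subseteq> A \<Longrightarrow> m B \<in> borel_measurable \<gamma>"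
  shows "(\<integral>\<^sup>+\<omega>. cluster_moment c m A (\<eta> \<omega>) \<partial>M) =
      c (Min A) * (\<integral>\<^sup>+\<omega>. cluster_moment c m (A - {Min A}) (\<eta> \<omega>) \<partial>M) +
      (\<Sum>B | Min A \<in> B \<and> B \<subseteq> A. (\<integral>\<^sup>+x. m B x \<partial>\<gamma>) * (\<integral>\<^sup>+\<omega>. cluster_moment c m (A - B) (\<eta> \<omega>) \<partial>M))"
proof -
  have "\<forall>B\<in>Pow A. \<exists>s. (\<forall>n. simple_function \<gamma> (s n)) \<and> incseq s \<and> (\<forall>x. (SUP n. s n x) = m B x)"
  proof
    fix B assume "B \<in> Pow A"
    then have "m B \<in> borel_measurable \<gamma>" using m by simp
    then obtain f where "\<And>i. simple_function \<gamma> (f i)" "incseq f" "\<And>x. (SUP i. f i x) = m B x"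
      by (rule borel_measurable_implies_simple_function_sequence') blast
    then show "\<exists>s. (\<forall>n. simple_function \<gamma> (s n)) \<and> incseq s \<and> (\<forall>x. (SUP n. s n x) = m B x)"
      by blast
  qed
  from bchoice[OF this] obtain s where s: "\<And>B n. B \<subseteq> A \<Longrightarrow> simple_function \<gamma> (s B n)"
      "\<And>B. B \<subseteq> A \<Longrightarrow> incseq (s B)" "\<And>B x. B \<subseteq> A \<Longrightarrow> (SUP n. s B n x) = m B x"
    by blast
  define \<sigma> where "\<sigma> n B x = s B n x" for n B x
  have inc: "incseq (\<lambda>n. \<sigma> n B x)" if "B \<subseteq> A" for B x
    using s(2)[OF that] by (auto simp: \<sigma>_def incseq_def le_fun_def)
  have sup: "(SUP n. \<sigma> n B x) = m B x" if "B \<subseteq> A" for B x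
    using s(3)[OF that] by (simp add: \<sigma>_def)
  have simp: "(\<lambda>\<omega>. cluster_moment c (\<sigma> n) A' (\<eta> \<omega>)) \<in> borel_measurable M"
      "A' \<noteq> {} \<Longrightarrow> (\<integral>\<^sup>+\<omega>. cluster_moment c (\<sigma> n) A' (\<eta> \<omega>) \<partial>M) =
      c (Min A') * (\<integral>\<^sup>+\<omega>. cluster_moment c (\<sigma> n) (A' - {Min A'}) (\<eta> \<omega>) \<partial>M) +
      (\<Sum>B | Min A' \<in> B \<and> B \<subseteq> A'. (\<integral>\<^sup>+x. \<sigma> n B x \<partial>\<gamma>) * (\<integral>\<^sup>+\<omega>. cluster_moment c (\<sigma> n) (A' - B) (\<eta> \<omega>) \<partial>M))"
    if A': "A' \<subseteq> A" for n A'
  proof -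
    have finA': "finite A'" by (rule finite_subset[OF A' A(1)])
    have "\<exists>(e :: 'b \<Rightarrow> nat) K \<mu>. e \<in> measurable \<gamma> (count_space UNIV) \<and> (\<forall>x. e x < K) \<and>
        (\<forall>B x. B \<subseteq> A \<longrightarrow> \<sigma> n B x = \<mu> B (e x))"
    proof (rule finite_valued_family_label[OF \<gamma>(1) A(1)])
      show "simple_function \<gamma> (\<sigma> n B)" if "B \<subseteq> A" for B
        using s(1)[OF that] by (simp add: \<sigma>_def[abs_def])
    qed
    then obtain e :: "'b \<Rightarrow> nat" and K \<mu> where e: "e \<in> measurable \<gamma> (count_space UNIV)" and K: "\<forall>x. e x < K"
        and \<mu>: "\<forall>B x. B \<subseteq> A \<longrightarrow> \<sigma> n B x = \<mu> B (e x)"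
      by (elim exE conjE)
    note e = e K[rule_format] and \<mu> = \<mu>[rule_format]
    have eq: "cluster_moment c (\<sigma> n) B y = cluster_moment c (\<lambda>B x. \<mu> B (e x)) B y" if "B \<subseteq> A" for B y
      by (rule cluster_moment_cong[OF finite_subset[OF that A(1)]]) (rule \<mu>, use that in blast)
    show "(\<lambda>\<omega>. cluster_moment c (\<sigma> n) A' (\<eta> \<omega>)) \<in> borel_measurable M"
      unfolding eq[OF A'] by (rule poisson_cluster_moment_labels[OF ppp \<gamma> e A])
    assume ne: "A' \<noteq> {}"
    have sub: "A' - B \<subseteq> A" for B using A' by auto
    have "(\<Sum>B | Min A' \<in> B \<and> B \<subseteq> A'. (\<integral>\<^sup>+x. \<mu> B (e x) \<partial>\<gamma>) *
          (\<integral>\<^sup>+\<omega>. cluster_moment c (\<lambda>B x. \<mu> B (e x)) (A' - B) (\<eta> \<omega>) \<partial>M)) =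
        (\<Sum>B | Min A' \<in> B \<and> B \<subseteq> A'. (\<integral>\<^sup>+x. \<sigma> n B x \<partial>\<gamma>) *
          (\<integral>\<^sup>+\<omega>. cluster_moment c (\<lambda>B x. \<mu> B (e x)) (A' - B) (\<eta> \<omega>) \<partial>M))"
      by (rule sum.cong) (use A' \<mu> in auto)
    then show "(\<integral>\<^sup>+\<omega>. cluster_moment c (\<sigma> n) A' (\<eta> \<omega>) \<partial>M) =
      c (Min A') * (\<integral>\<^sup>+\<omega>. cluster_moment c (\<sigma> n) (A' - {Min A'}) (\<eta> \<omega>) \<partial>M) +
      (\<Sum>B | Min A' \<in> B \<and> B \<subseteq> A'. (\<integral>\<^sup>+x. \<sigma> n B x \<partial>\<gamma>) * (\<integral>\<^sup>+\<omega>. cluster_moment c (\<sigma> n) (A' - B) (\<eta> \<omega>) \<partial>M))"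
      unfolding eq[OF A'] eq[OF sub]
      using poisson_cluster_moment_labels(2)[OF ppp \<gamma> e finA' ne, of c \<mu>] by simp
  qed
  define J where "J n B = (\<integral>\<^sup>+\<omega>. cluster_moment c (\<sigma> n) B (\<eta> \<omega>) \<partial>M)" for n B
  define I where "I n B = (\<integral>\<^sup>+x. \<sigma> n B x \<partial>\<gamma>)" for n B
  have Jinc: "incseq (\<lambda>n. J n B)"
    and Jsup: "(SUP n. J n B) = (\<integral>\<^sup>+\<omega>. cluster_moment c m B (\<eta> \<omega>) \<partial>M)" if B: "B \<subseteq> A" for B
  proof -
    have finB: "finite B" by (rule finite_subset[OF B A(1)])
    have 1: "incseq (\<lambda>n. cluster_moment c (\<sigma> n) B y)"
        "(SUP n. cluster_moment c (\<sigma> n) B y) = cluster_moment c m B y" for y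
    proof -
      have "cluster_moment c (\<lambda>B x. SUP n. \<sigma> n B x) B y = cluster_moment c m B y"
        by (rule cluster_moment_cong) (use B sup finB in auto)
      then show "incseq (\<lambda>n. cluster_moment c (\<sigma> n) B y)"
        "(SUP n. cluster_moment c (\<sigma> n) B y) = cluster_moment c m B y"
        using cluster_moment_SUP[OF finB, of \<sigma> c y] inc B by auto
    qed
    show "incseq (\<lambda>n. J n B)"
      unfolding J_def incseq_def using 1(1) by (auto intro!: nn_integral_mono simp: incseq_def)
    show "(SUP n. J n B) = (\<integral>\<^sup>+\<omega>. cluster_moment c m B (\<eta> \<omega>) \<partial>M)"
      unfolding J_def 1(2)[symmetric]
      by (rule nn_integral_monotone_convergence_SUP[symmetric])
        (use 1(1) simp(1)[OF B] in \<open>auto simp: incseq_def le_fun_def\<close>)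
  qed
  have \<sigma>_meas: "\<sigma> n B \<in> borel_measurable \<gamma>" if "B \<subseteq> A" for n B
    using borel_measurable_simple_function[OF s(1)[OF that]] by (simp add: \<sigma>_def[abs_def])
  have Iinc: "incseq (\<lambda>n. I n B)"
    and Isup: "(SUP n. I n B) = (\<integral>\<^sup>+x. m B x \<partial>\<gamma>)" if B: "B \<subseteq> A" for B
  proof -
    show "incseq (\<lambda>n. I n B)"
      unfolding I_def incseq_def using inc[OF B] by (auto intro!: nn_integral_mono simp: incseq_def)
    show "(SUP n. I n B) = (\<integral>\<^sup>+x. m B x \<partial>\<gamma>)"
      unfolding I_def sup[OF B, symmetric]
      by (rule nn_integral_monotone_convergence_SUP[symmetric])
        (use inc[OF B] \<sigma>_meas[OF B] in \<open>auto simp: incseq_def le_fun_def\<close>)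
  qed
  have rec: "J n A = c (Min A) * J n (A - {Min A}) + (\<Sum>B | Min A \<in> B \<and> B \<subseteq> A. I n B * J n (A - B))" for n
    unfolding J_def I_def by (rule simp(2)[OF subset_refl A(2)])
  have 1: "incseq (\<lambda>n. c (Min A) * J n (A - {Min A}))"
    by (rule incseq_mult_ennreal) (use Jinc in \<open>auto simp: incseq_def\<close>)
  have 2: "incseq (\<lambda>n. I n B * J n (A - B))" if "B \<subseteq> A" for B
    by (rule incseq_mult_ennreal) (use Iinc Jinc that in auto)
  have 3: "incseq (\<lambda>n. \<Sum>B | Min A \<in> B \<and> B \<subseteq> A. I n B * J n (A - B))"
    by (rule incseq_sum_ennreal) (use 2 in auto)
  have "(\<integral>\<^sup>+\<omega>. cluster_moment c m A (\<eta> \<omega>) \<partial>M) = (SUP n. J n A)"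
    by (simp add: Jsup)
  also have "\<dots> = (SUP n. c (Min A) * J n (A - {Min A})) + (SUP n. \<Sum>B | Min A \<in> B \<and> B \<subseteq> A. I n B * J n (A - B))"
    unfolding rec by (rule ennreal_SUP_add[OF 1 3])
  also have "(SUP n. c (Min A) * J n (A - {Min A})) = c (Min A) * (SUP n. J n (A - {Min A}))"
    by (rule SUP_mult_left_ennreal[symmetric])
  also have "(SUP n. \<Sum>B | Min A \<in> B \<and> B \<subseteq> A. I n B * J n (A - B)) =
      (\<Sum>B | Min A \<in> B \<and> B \<subseteq> A. SUP n. I n B * J n (A - B))"
    by (rule ennreal_SUP_sum) (use 2 in auto)
  also have "\<dots> = (\<Sum>B | Min A \<in> B \<and> B \<subseteq> A. (SUP n. I n B) * (SUP n. J n (A - B)))"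
    by (intro sum.cong refl SUP_mult_incseq_ennreal Iinc Jinc) auto
  also have "\<dots> = (\<Sum>B | Min A \<in> B \<and> B \<subseteq> A. (\<integral>\<^sup>+x. m B x \<partial>\<gamma>) * (\<integral>\<^sup>+\<omega>. cluster_moment c m (A - B) (\<eta> \<omega>) \<partial>M))"
    by (intro sum.cong refl arg_cong2[where f = "(*)"] Isup Jsup) auto
  also have "(SUP n. J n (A - {Min A})) = (\<integral>\<^sup>+\<omega>. cluster_moment c m (A - {Min A}) (\<eta> \<omega>) \<partial>M)"
    by (rule Jsup) auto
  finally show ?thesis .
qed

end

section \<open>Moments of truncated trees\<close>

type_synonym 'a offspring = "nat \<times> (nat \<Rightarrow> 'a)"

abbreviation offspring_space :: "'a::euclidean_space offspring measure" where
  "offspring_space \<equiv> count_space UNIV \<Otimes>\<^sub>M (\<Pi>\<^sub>M i\<in>UNIV. borel)"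

text \<open>Sums g over the generations 0 to k of the tree started at z. The recursion splits at the
  root rather than at the last generation, since the subtrees of the children depend on disjoint
  sets of labels; prefixing labels with j selects the subtree of child j.\<close>

primrec tree_sum ::
    "nat \<Rightarrow> ('a::euclidean_space \<Rightarrow> ennreal) \<Rightarrow> (nat list \<Rightarrow> 'a offspring) \<Rightarrow> 'a \<Rightarrow> ennreal" where
  "tree_sum 0 g d z = g z"
| "tree_sum (Suc k) g d z =
     g z + (\<Sum>j<fst (d []). tree_sum k g (\<lambda>w. d (j # w)) (z + snd (d []) j))"

lemma measurable_offspring_snd [measurable (raw)]:
  assumes "f \<in> measurable L offspring_space"
  shows "(\<lambda>x. snd (f x) j) \<in> measurable L borel"
proof -
  have "(\<lambda>x. snd (f x)) \<in> measurable L (\<Pi>\<^sub>M i\<in>UNIV. borel)"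
    using assms by simp
  then show ?thesis by (rule measurable_component_singleton') auto
qed

lemma measurable_tree_shift:
  assumes "f \<in> measurable L (PiM UNIV (\<lambda>_. offspring_space))"
  shows "(\<lambda>x w. f x (j # w)) \<in> measurable L (PiM (UNIV :: nat list set) (\<lambda>_. offspring_space))"
  by (rule measurable_PiM_single') (auto intro!: measurable_component_singleton'[OF assms] simp: space_pair_measure space_PiM)

text \<open>Joint measurability in the data and the starting point carries the induction, because
  the subtree of a child starts at a random place. The random number of children is handled by
  countable composition.\<close>

lemma measurable_tree_sum_pair:
  fixes g :: "'a::euclidean_space \<Rightarrow> ennreal"
  assumes [measurable]: "g \<in> borel_measurable borel"
  shows "(\<lambda>(d, z). tree_sum k g d z) \<in> borel_measurable (PiM UNIV (\<lambda>_. offspring_space) \<Otimes>\<^sub>M borel)"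
proof (induction k)
  case 0
  show ?case by simp
next
  case (Suc k)
  let ?T = "PiM UNIV (\<lambda>_. offspring_space) :: (nat list \<Rightarrow> 'a offspring) measure"
  have root[measurable]: "(\<lambda>p. fst p []) \<in> measurable (?T \<Otimes>\<^sub>M (borel :: 'a measure)) offspring_space"
    by (rule measurable_compose[OF measurable_fst measurable_component_singleton]) simp
  have sub: "(\<lambda>p. tree_sum k g (\<lambda>w. fst p (j # w)) (snd p + snd (fst p []) j))
      \<in> borel_measurable (?T \<Otimes>\<^sub>M borel)" for j
  proof -
    have "(\<lambda>p. (\<lambda>w. fst p (j # w), snd p + snd (fst p []) j)) \<in> measurable (?T \<Otimes>\<^sub>M (borel :: 'a measure)) (?T \<Otimes>\<^sub>M borel)"
      by (intro measurable_Pair measurable_tree_shift measurable_fst) measurable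
    from measurable_compose[OF this Suc] show ?thesis by simp
  qed
  have "(\<lambda>p. \<Sum>j<fst (fst p []). tree_sum k g (\<lambda>w. fst p (j # w)) (snd p + snd (fst p []) j))
      \<in> borel_measurable (?T \<Otimes>\<^sub>M borel)"
    by (rule measurable_compose_countable[where f = "\<lambda>n p. \<Sum>j<n. tree_sum k g (\<lambda>w. fst p (j # w)) (snd p + snd (fst p []) j)"])
      (intro borel_measurable_sum sub, measurable)
  then show ?case by (simp add: case_prod_beta)
qed

lemma measurable_tree_sum [measurable (raw)]:
  fixes g :: "'a::euclidean_space \<Rightarrow> ennreal"
  assumes "g \<in> borel_measurable borel"
    and "d \<in> measurable L (PiM UNIV (\<lambda>_. offspring_space))" "z \<in> borel_measurable L"
  shows "(\<lambda>x. tree_sum k g (d x) (z x)) \<in> borel_measurable L"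
  using measurable_compose[OF measurable_Pair[OF assms(2,3)] measurable_tree_sum_pair[OF assms(1)]]
  by simp

lemma tree_sum_mono: "k \<le> l \<Longrightarrow> tree_sum k g d z \<le> tree_sum l g d z"
proof (induction k arbitrary: l d z)
  case 0
  then show ?case by (cases l) auto
next
  case (Suc k)
  then obtain l' where "l = Suc l'" "k \<le> l'" by (cases l) auto
  then show ?case using Suc.IH by (auto intro!: add_mono sum_mono)
qed

text \<open>The deterministic counterpart of the recursion of \<open>cluster_moment\<close>: expand
  the factor of a, select the point j that it takes, and let B be the set of all indices whose
  factors take their summand from the same j.\<close>

lemma prod_split_first:
  fixes c :: "'i \<Rightarrow> 'b::comm_semiring_1" and v :: "'j \<Rightarrow> 'i \<Rightarrow> 'b"
  assumes A: "finite A" "a \<in> A" and J: "finite J"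
  shows "(\<Prod>i\<in>A. c i + (\<Sum>j\<in>J. v j i)) = c a * (\<Prod>i\<in>A - {a}. c i + (\<Sum>j\<in>J. v j i)) +
    (\<Sum>B | a \<in> B \<and> B \<subseteq> A. \<Sum>j\<in>J. (\<Prod>i\<in>B. v j i) * (\<Prod>i\<in>A - B. c i + (\<Sum>l\<in>J - {j}. v l i)))"
proof -
  have 1: "v j a * (\<Prod>i\<in>A - {a}. c i + (\<Sum>j\<in>J. v j i)) =
      (\<Sum>B | a \<in> B \<and> B \<subseteq> A. (\<Prod>i\<in>B. v j i) * (\<Prod>i\<in>A - B. c i + (\<Sum>l\<in>J - {j}. v l i)))"
    if j: "j \<in> J" for j
  proof -
    have "(\<Prod>i\<in>A - {a}. c i + (\<Sum>j\<in>J. v j i)) =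
        (\<Prod>i\<in>A - {a}. v j i + (c i + (\<Sum>l\<in>J - {j}. v l i)))"
      using J j by (intro prod.cong refl) (simp add: sum.remove add_ac)
    \<comment> \<open>Expanding the product over the choice between \<open>v j i\<close> and the
      rest; B is the chosen set X together with a.\<close>
    also have "\<dots> = (\<Sum>X\<in>Pow (A - {a}). (\<Prod>i\<in>X. v j i) * (\<Prod>i\<in>A - {a} - X. c i + (\<Sum>l\<in>J - {j}. v l i)))"
      by (rule prod_add) (use A in simp)
    finally have "v j a * (\<Prod>i\<in>A - {a}. c i + (\<Sum>j\<in>J. v j i)) =
        (\<Sum>X\<in>Pow (A - {a}). v j a * ((\<Prod>i\<in>X. v j i) * (\<Prod>i\<in>A - {a} - X. c i + (\<Sum>l\<in>J - {j}. v l i))))"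
      by (simp only: sum_distrib_left)
    also have "\<dots> = (\<Sum>B | a \<in> B \<and> B \<subseteq> A. (\<Prod>i\<in>B. v j i) * (\<Prod>i\<in>A - B. c i + (\<Sum>l\<in>J - {j}. v l i)))"
    proof (rule sum.reindex_bij_witness[where i = "\<lambda>B. B - {a}" and j = "insert a"])
      fix X assume X: "X \<in> Pow (A - {a})"
      then have "finite X" "a \<notin> X" "A - insert a X = A - {a} - X"
        using A(1) by (auto intro: finite_subset[of X A])
      then show "(\<Prod>i\<in>insert a X. v j i) * (\<Prod>i\<in>A - insert a X. c i + (\<Sum>l\<in>J - {j}. v l i)) =
          v j a * ((\<Prod>i\<in>X. v j i) * (\<Prod>i\<in>A - {a} - X. c i + (\<Sum>l\<in>J - {j}. v l i)))"
        by (simp add: mult.assoc)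
    qed (use A(2) in auto)
    finally show ?thesis .
  qed
  have "(\<Prod>i\<in>A. c i + (\<Sum>j\<in>J. v j i)) =
      (c a + (\<Sum>j\<in>J. v j a)) * (\<Prod>i\<in>A - {a}. c i + (\<Sum>j\<in>J. v j i))"
    by (rule prod.remove) (use A in auto)
  also have "\<dots> = c a * (\<Prod>i\<in>A - {a}. c i + (\<Sum>j\<in>J. v j i)) +
      (\<Sum>j\<in>J. v j a * (\<Prod>i\<in>A - {a}. c i + (\<Sum>j\<in>J. v j i)))"
    by (simp add: distrib_right sum_distrib_right)
  also have "(\<Sum>j\<in>J. v j a * (\<Prod>i\<in>A - {a}. c i + (\<Sum>j\<in>J. v j i))) =
      (\<Sum>j\<in>J. \<Sum>B | a \<in> B \<and> B \<subseteq> A. (\<Prod>i\<in>B. v j i) * (\<Prod>i\<in>A - B. c i + (\<Sum>l\<in>J - {j}. v l i)))"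
    by (rule sum.cong[OF refl 1])
  also have "\<dots> = (\<Sum>B | a \<in> B \<and> B \<subseteq> A. \<Sum>j\<in>J. (\<Prod>i\<in>B. v j i) * (\<Prod>i\<in>A - B. c i + (\<Sum>l\<in>J - {j}. v l i)))"
    by (rule sum.swap)
  finally show ?thesis .
qed

section \<open>Integrating out independent subtrees\<close>

context prob_space
begin

text \<open>The hypothesis \<open>indep\<close> integrates out the marks of one point j against the
  product built from the other points. After splitting off the pivot, what remains has the same
  shape with J - {j} and a smaller index set, so induction on A applies.\<close>

lemma nn_integral_prod_marks:
  fixes v :: "nat \<Rightarrow> nat \<Rightarrow> 'a \<Rightarrow> ennreal" and x :: "nat \<Rightarrow> 'b"
  assumes "finite A" "finite J"
    and v: "\<And>j i. i \<in> A \<Longrightarrow> v j i \<in> borel_measurable M"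
    and indep: "\<And>j J' B B'. finite J' \<Longrightarrow> j \<notin> J' \<Longrightarrow> B \<subseteq> A \<Longrightarrow> B' \<subseteq> A \<Longrightarrow>
      (\<integral>\<^sup>+\<omega>. (\<Prod>i\<in>B. v j i \<omega>) * (\<Prod>i\<in>B'. c i + (\<Sum>l\<in>J'. v l i \<omega>)) \<partial>M) =
      m B (x j) * (\<integral>\<^sup>+\<omega>. (\<Prod>i\<in>B'. c i + (\<Sum>l\<in>J'. v l i \<omega>)) \<partial>M)"
  shows "(\<integral>\<^sup>+\<omega>. (\<Prod>i\<in>A. c i + (\<Sum>j\<in>J. v j i \<omega>)) \<partial>M) =
    cluster_moment c m A (image_mset x (mset_set J))"
  using assms
proof (induction A arbitrary: J rule: finite_psubset_induct)
  case (psubset A)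
  show ?case
  proof (cases "A = {}")
    case True
    then show ?thesis by (simp add: emeasure_space_1)
  next
    case False
    then have a: "Min A \<in> A" using psubset.hyps by simp
    note J = psubset.prems(1)
    have meas: "(\<lambda>\<omega>. \<Prod>i\<in>B. c i + (\<Sum>j\<in>J. v j i \<omega>)) \<in> borel_measurable M" if "B \<subseteq> A" for B J
      by (intro borel_measurable_prod_ennreal borel_measurable_add borel_measurable_const borel_measurable_sum)
        (use psubset.prems(2) that in auto)
    have meas': "(\<lambda>\<omega>. \<Prod>i\<in>B. v j i \<omega>) \<in> borel_measurable M" if "B \<subseteq> A" for B j
      by (intro borel_measurable_prod_ennreal) (use psubset.prems(2) that in auto)
    have IH: "(\<integral>\<^sup>+\<omega>. (\<Prod>i\<in>A - B. c i + (\<Sum>j\<in>J'. v j i \<omega>)) \<partial>M) =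
        cluster_moment c m (A - B) (image_mset x (mset_set J'))" if "Min A \<in> B" "finite J'" for B J'
    proof (rule psubset.IH)
      show "A - B \<subset> A" using a that by auto
      show "finite J'" by fact
      show "v j i \<in> borel_measurable M" if "i \<in> A - B" for j i
        using that psubset.prems(2) by simp
      show "(\<integral>\<^sup>+\<omega>. (\<Prod>i\<in>C. v j i \<omega>) * (\<Prod>i\<in>C'. c i + (\<Sum>l\<in>J'. v l i \<omega>)) \<partial>M) =
          m C (x j) * (\<integral>\<^sup>+\<omega>. (\<Prod>i\<in>C'. c i + (\<Sum>l\<in>J'. v l i \<omega>)) \<partial>M)"
        if "finite J'" "j \<notin> J'" "C \<subseteq> A - B" "C' \<subseteq> A - B" for j J' C C'
        by (rule psubset.prems(3)) (use that in auto)
    qed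
    have "(\<integral>\<^sup>+\<omega>. (\<Prod>i\<in>A. c i + (\<Sum>j\<in>J. v j i \<omega>)) \<partial>M) =
        (\<integral>\<^sup>+\<omega>. c (Min A) * (\<Prod>i\<in>A - {Min A}. c i + (\<Sum>j\<in>J. v j i \<omega>)) +
          (\<Sum>B | Min A \<in> B \<and> B \<subseteq> A. \<Sum>j\<in>J.
            (\<Prod>i\<in>B. v j i \<omega>) * (\<Prod>i\<in>A - B. c i + (\<Sum>l\<in>J - {j}. v l i \<omega>))) \<partial>M)"
      by (subst prod_split_first[OF psubset.hyps(1) a J]) (rule refl)
    also have "\<dots> = (\<integral>\<^sup>+\<omega>. c (Min A) * (\<Prod>i\<in>A - {Min A}. c i + (\<Sum>j\<in>J. v j i \<omega>)) \<partial>M) +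
        (\<integral>\<^sup>+\<omega>. (\<Sum>B | Min A \<in> B \<and> B \<subseteq> A. \<Sum>j\<in>J.
            (\<Prod>i\<in>B. v j i \<omega>) * (\<Prod>i\<in>A - B. c i + (\<Sum>l\<in>J - {j}. v l i \<omega>))) \<partial>M)"
      by (intro nn_integral_add borel_measurable_times_ennreal borel_measurable_const borel_measurable_sum meas meas') auto
    also have "(\<integral>\<^sup>+\<omega>. c (Min A) * (\<Prod>i\<in>A - {Min A}. c i + (\<Sum>j\<in>J. v j i \<omega>)) \<partial>M) =
        c (Min A) * (\<integral>\<^sup>+\<omega>. (\<Prod>i\<in>A - {Min A}. c i + (\<Sum>j\<in>J. v j i \<omega>)) \<partial>M)"
      by (intro nn_integral_cmult meas) auto
    also have "(\<integral>\<^sup>+\<omega>. (\<Prod>i\<in>A - {Min A}. c i + (\<Sum>j\<in>J. v j i \<omega>)) \<partial>M) =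
        cluster_moment c m (A - {Min A}) (image_mset x (mset_set J))"
      by (rule IH) (use J in auto)
    also have "(\<integral>\<^sup>+\<omega>. (\<Sum>B | Min A \<in> B \<and> B \<subseteq> A. \<Sum>j\<in>J.
            (\<Prod>i\<in>B. v j i \<omega>) * (\<Prod>i\<in>A - B. c i + (\<Sum>l\<in>J - {j}. v l i \<omega>))) \<partial>M) =
        (\<Sum>B | Min A \<in> B \<and> B \<subseteq> A. \<integral>\<^sup>+\<omega>. (\<Sum>j\<in>J.
            (\<Prod>i\<in>B. v j i \<omega>) * (\<Prod>i\<in>A - B. c i + (\<Sum>l\<in>J - {j}. v l i \<omega>))) \<partial>M)"
      by (intro nn_integral_sum borel_measurable_times_ennreal borel_measurable_sum meas meas') auto
    also have "\<dots> = (\<Sum>B | Min A \<in> B \<and> B \<subseteq> A. \<Sum>y\<in>#image_mset x (mset_set J).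
        m B y * cluster_moment c m (A - B) (image_mset x (mset_set J) - {#y#}))"
    proof (rule sum.cong[OF refl], elim CollectE conjE)
      fix B assume B: "Min A \<in> B" "B \<subseteq> A"
      have "(\<integral>\<^sup>+\<omega>. (\<Sum>j\<in>J. (\<Prod>i\<in>B. v j i \<omega>) * (\<Prod>i\<in>A - B. c i + (\<Sum>l\<in>J - {j}. v l i \<omega>))) \<partial>M) =
          (\<Sum>j\<in>J. \<integral>\<^sup>+\<omega>. (\<Prod>i\<in>B. v j i \<omega>) * (\<Prod>i\<in>A - B. c i + (\<Sum>l\<in>J - {j}. v l i \<omega>)) \<partial>M)"
        using B by (intro nn_integral_sum borel_measurable_times_ennreal meas meas') auto
      also have "\<dots> = (\<Sum>j\<in>J. m B (x j) * cluster_moment c m (A - B) (image_mset x (mset_set J) - {#x j#}))"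
      proof (rule sum.cong[OF refl])
        fix j assume j: "j \<in> J"
        have "image_mset x (mset_set (J - {j})) = image_mset x (mset_set J) - {#x j#}"
          using J j by (simp add: mset_set_Diff image_mset_Diff)
        moreover have "(\<integral>\<^sup>+\<omega>. (\<Prod>i\<in>B. v j i \<omega>) * (\<Prod>i\<in>A - B. c i + (\<Sum>l\<in>J - {j}. v l i \<omega>)) \<partial>M) =
            m B (x j) * (\<integral>\<^sup>+\<omega>. (\<Prod>i\<in>A - B. c i + (\<Sum>l\<in>J - {j}. v l i \<omega>)) \<partial>M)"
          by (rule psubset.prems(3)) (use J B in auto)
        ultimately show "(\<integral>\<^sup>+\<omega>. (\<Prod>i\<in>B. v j i \<omega>) * (\<Prod>i\<in>A - B. c i + (\<Sum>l\<in>J - {j}. v l i \<omega>)) \<partial>M) =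
            m B (x j) * cluster_moment c m (A - B) (image_mset x (mset_set J) - {#x j#})"
          using IH[OF B(1), of "J - {j}"] J by simp
      qed
      also have "\<dots> = (\<Sum>y\<in>#image_mset x (mset_set J).
          m B y * cluster_moment c m (A - B) (image_mset x (mset_set J) - {#y#}))"
        unfolding image_mset.compositionality comp_def by (simp add: sum_unfold_sum_mset)
      finally show "(\<integral>\<^sup>+\<omega>. (\<Sum>j\<in>J. (\<Prod>i\<in>B. v j i \<omega>) * (\<Prod>i\<in>A - B. c i + (\<Sum>l\<in>J - {j}. v l i \<omega>))) \<partial>M) =
          (\<Sum>y\<in>#image_mset x (mset_set J).
            m B y * cluster_moment c m (A - B) (image_mset x (mset_set J) - {#y#}))" .
    qed
    finally show ?thesis
      unfolding cluster_moment_rec[OF psubset.hyps(1) False] .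
  qed
qed

text \<open>Under independence the joint law is a product, so Fubini allows Y to be evaluated at a
  separate outcome \<omega>'. This replaces conditioning on X.\<close>

lemma nn_integral_indep_pair:
  assumes ind: "indep_var S X T Y"
    and F: "(\<lambda>(x, y). F x y) \<in> borel_measurable (S \<Otimes>\<^sub>M T)"
  shows "(\<integral>\<^sup>+\<omega>. F (X \<omega>) (Y \<omega>) \<partial>M) = (\<integral>\<^sup>+\<omega>. (\<integral>\<^sup>+\<omega>'. F (X \<omega>) (Y \<omega>') \<partial>M) \<partial>M)"
proof -
  have rv[measurable]: "X \<in> measurable M S" "Y \<in> measurable M T"
    using ind indep_var_rv1 indep_var_rv2 by blast+
  interpret X: prob_space "distr M S X" by (rule prob_space_distr) fact
  interpret Y: prob_space "distr M T Y" by (rule prob_space_distr) fact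
  have F': "(\<lambda>(x, y). F x y) \<in> borel_measurable (distr M S X \<Otimes>\<^sub>M distr M T Y)"
    using F by (simp cong: measurable_cong_sets)
  have FX: "F x \<in> borel_measurable T" if "x \<in> space S" for x
    using measurable_Pair2[OF F that] by simp
  have "(\<integral>\<^sup>+\<omega>. F (X \<omega>) (Y \<omega>) \<partial>M) = (\<integral>\<^sup>+p. F (fst p) (snd p) \<partial>distr M (S \<Otimes>\<^sub>M T) (\<lambda>\<omega>. (X \<omega>, Y \<omega>)))"
    by (subst nn_integral_distr) (use F in \<open>auto simp: case_prod_beta\<close>)
  also have "\<dots> = (\<integral>\<^sup>+p. F (fst p) (snd p) \<partial>(distr M S X \<Otimes>\<^sub>M distr M T Y))"
    using ind unfolding indep_var_distribution_eq by simp
  also have "\<dots> = (\<integral>\<^sup>+x. (\<integral>\<^sup>+y. F x y \<partial>distr M T Y) \<partial>distr M S X)"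
    using Y.nn_integral_fst[OF F'] by (simp add: split_beta')
  also have "\<dots> = (\<integral>\<^sup>+x. (\<integral>\<^sup>+\<omega>'. F x (Y \<omega>') \<partial>M) \<partial>distr M S X)"
    by (intro nn_integral_cong nn_integral_distr) (use FX in auto)
  also have "\<dots> = (\<integral>\<^sup>+\<omega>. (\<integral>\<^sup>+\<omega>'. F (X \<omega>) (Y \<omega>') \<partial>M) \<partial>M)"
  proof -
    have "(\<lambda>p. F (fst p) (Y (snd p))) \<in> borel_measurable (S \<Otimes>\<^sub>M M)"
      using measurable_compose[OF _ F, of "\<lambda>p. (fst p, Y (snd p))" "S \<Otimes>\<^sub>M M"] by simp
    then have "(\<lambda>x. \<integral>\<^sup>+\<omega>'. F x (Y \<omega>') \<partial>M) \<in> borel_measurable S"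
      using borel_measurable_nn_integral_fst[of "\<lambda>p. F (fst p) (Y (snd p))" S] by simp
    then show ?thesis by (subst nn_integral_distr) simp_all
  qed
  finally show ?thesis .
qed

lemma nn_integral_indep_mult:
  fixes F G :: "_ \<Rightarrow> ennreal"
  assumes ind: "indep_var S X T Y"
    and F: "F \<in> borel_measurable S" and G: "G \<in> borel_measurable T"
  shows "(\<integral>\<^sup>+\<omega>. F (X \<omega>) * G (Y \<omega>) \<partial>M) = (\<integral>\<^sup>+\<omega>. F (X \<omega>) \<partial>M) * (\<integral>\<^sup>+\<omega>. G (Y \<omega>) \<partial>M)"
proof -
  have rv[measurable]: "X \<in> measurable M S" "Y \<in> measurable M T"
    using ind indep_var_rv1 indep_var_rv2 by blast+
  note [measurable] = F G
  have "(\<integral>\<^sup>+\<omega>. F (X \<omega>) * G (Y \<omega>) \<partial>M) = (\<integral>\<^sup>+\<omega>. (\<integral>\<^sup>+\<omega>'. F (X \<omega>) * G (Y \<omega>') \<partial>M) \<partial>M)"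
    by (rule nn_integral_indep_pair[OF ind]) measurable
  then show ?thesis
    by (simp add: nn_integral_cmult nn_integral_multc)
qed

lemma indep_vars_reindex:
  assumes ind: "indep_vars (\<lambda>_. S) D UNIV" and inj: "inj h"
  shows "indep_vars (\<lambda>_. S) (\<lambda>u. D (h u)) UNIV"
proof -
  have "indep_vars (\<lambda>j. PiM {h j} (\<lambda>_. S)) (\<lambda>j \<omega>. restrict (\<lambda>i. D i \<omega>) {h j}) UNIV"
    by (rule indep_vars_restrict[OF ind])
      (use inj in \<open>auto simp: disjoint_family_on_def inj_def\<close>)
  then have "indep_vars (\<lambda>_. S) (\<lambda>j \<omega>. (restrict (\<lambda>i. D i \<omega>) {h j}) (h j)) UNIV"
    by (rule indep_vars_compose2) (rule measurable_component_singleton, simp)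
  then show ?thesis by simp
qed

text \<open>Phrased for an arbitrary family of offspring data, so that the property passes to the
  families of subtrees.\<close>

definition branching_family ::
    "'b::euclidean_space measure \<Rightarrow> (nat list \<Rightarrow> 'a \<Rightarrow> 'b offspring) \<Rightarrow> bool" where
  "branching_family \<gamma> D \<longleftrightarrow> indep_vars (\<lambda>_. offspring_space) D UNIV \<and>
     (\<forall>u. poisson_point_process \<gamma>
        (\<lambda>\<omega>. image_mset (\<lambda>j. snd (D u \<omega>) j) (mset_set {..<fst (D u \<omega>)})))"

lemma branching_family_subtree:
  "branching_family \<gamma> D \<Longrightarrow> branching_family \<gamma> (\<lambda>w. D (j # w))"
  unfolding branching_family_def using indep_vars_reindex[of offspring_space D "\<lambda>w. j # w"] by simp

lemma branching_family_measurable: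
  assumes "branching_family \<gamma> D"
  shows "D u \<in> measurable M offspring_space"
    and "(\<lambda>\<omega> u. D u \<omega>) \<in> measurable M (PiM UNIV (\<lambda>_. offspring_space))"
proof -
  show 1: "D u \<in> measurable M offspring_space" for u
    using assms unfolding branching_family_def indep_vars_def by simp
  show "(\<lambda>\<omega> u. D u \<omega>) \<in> measurable M (PiM UNIV (\<lambda>_. offspring_space))"
    by (rule measurable_PiM_single') (use 1 in \<open>auto simp: space_pair_measure space_PiM\<close>)
qed

definition tree_moment ::
    "nat \<Rightarrow> (nat \<Rightarrow> 'b \<Rightarrow> ennreal) \<Rightarrow> (nat list \<Rightarrow> 'a \<Rightarrow> 'b::euclidean_space offspring) \<Rightarrow>
      nat set \<Rightarrow> 'b \<Rightarrow> ennreal" where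
  "tree_moment k f D A z = (\<integral>\<^sup>+\<omega>. (\<Prod>i\<in>A. tree_sum k (f i) (\<lambda>u. D u \<omega>) z) \<partial>M)"

lemma measurable_tree_moment:
  assumes D: "branching_family \<gamma> D" and f: "\<And>i. i \<in> A \<Longrightarrow> f i \<in> borel_measurable borel"
  shows "tree_moment k f D A \<in> borel_measurable borel"
proof -
  note branching_family_measurable(2)[OF D, measurable]
  have "(\<lambda>p. \<Prod>i\<in>A. tree_sum k (f i) (\<lambda>u. D u (snd p)) (fst p)) \<in> borel_measurable (borel \<Otimes>\<^sub>M M)"
    by (intro borel_measurable_prod_ennreal measurable_tree_sum f
        measurable_compose[OF measurable_snd branching_family_measurable(2)[OF D]]) simp_all
  then show ?thesis
    using borel_measurable_nn_integral_fst[of "\<lambda>p. \<Prod>i\<in>A. tree_sum k (f i) (\<lambda>u. D u (snd p)) (fst p)" borel]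
    by (simp add: tree_moment_def[abs_def])
qed

text \<open>The sum over the subtree of j reads only coordinates with labels beginning with j, so it
  is measurable on any product whose index set contains these labels.\<close>

lemma measurable_subtree_sum:
  fixes g :: "'b::euclidean_space \<Rightarrow> ennreal"
  assumes "g \<in> borel_measurable borel" "\<And>w. j # w \<in> K"
  shows "(\<lambda>r. tree_sum k g (\<lambda>w. r (j # w)) y) \<in> borel_measurable (PiM K (\<lambda>_. offspring_space))"
proof -
  have "(\<lambda>r w. r (j # w)) \<in> measurable (PiM K (\<lambda>_. offspring_space)) (PiM UNIV (\<lambda>_. offspring_space :: 'b offspring measure))"
    by (rule measurable_PiM_single')
      (use assms(2) in \<open>auto simp: space_pair_measure space_PiM intro: measurable_component_singleton\<close>)
  then show ?thesis
    by (intro measurable_tree_sum assms(1)) simp_all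
qed

text \<open>Subtrees of different children read disjoint sets of labels and are therefore
  independent, which is what \<open>nn_integral_prod_marks\<close> asks for. The positions x and the
  number n of children are fixed here; they are made random by the next step.\<close>

lemma nn_integral_subtrees:
  fixes D :: "nat list \<Rightarrow> 'a \<Rightarrow> 'b::euclidean_space offspring"
  assumes D: "branching_family \<gamma> D" and A: "finite A"
    and f: "\<And>i. i \<in> A \<Longrightarrow> f i \<in> borel_measurable borel"
    and m: "\<And>j B y. B \<subseteq> A \<Longrightarrow> tree_moment k f (\<lambda>w. D (j # w)) B y = m B y"
  shows "(\<integral>\<^sup>+\<omega>. (\<Prod>i\<in>A. c i + (\<Sum>j<n. tree_sum k (f i) (\<lambda>w. D (j # w) \<omega>) (x j))) \<partial>M) =
    cluster_moment c m A (image_mset x (mset_set {..<n}))"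
proof (rule nn_integral_prod_marks[OF A])
  have ind: "indep_vars (\<lambda>_. offspring_space) D UNIV"
    using D by (simp add: branching_family_def)
  show "(\<lambda>\<omega>. tree_sum k (f i) (\<lambda>w. D (j # w) \<omega>) (x j)) \<in> borel_measurable M" if "i \<in> A" for i j
    by (intro measurable_tree_sum f that
        branching_family_measurable(2)[OF branching_family_subtree[OF D]]) simp
  fix j :: nat and J' B B' :: "nat set"
  assume J': "finite J'" "j \<notin> J'" and B: "B \<subseteq> A" "B' \<subseteq> A"
  define K1 where "K1 = range (\<lambda>w. j # w)"
  define K2 where "K2 = {l # w | l w. l \<in> J'}"
  define F where "F r = (\<Prod>i\<in>B. tree_sum k (f i) (\<lambda>w. r (j # w)) (x j))" for r :: "nat list \<Rightarrow> 'b offspring"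
  define G where "G r = (\<Prod>i\<in>B'. c i + (\<Sum>l\<in>J'. tree_sum k (f i) (\<lambda>w. r (l # w)) (x l)))" for r :: "nat list \<Rightarrow> 'b offspring"
  have "indep_var (PiM K1 (\<lambda>_. offspring_space)) (\<lambda>\<omega>. restrict (\<lambda>u. D u \<omega>) K1)
      (PiM K2 (\<lambda>_. offspring_space)) (\<lambda>\<omega>. restrict (\<lambda>u. D u \<omega>) K2)"
    by (rule indep_var_restrict[OF ind]) (use J' in \<open>auto simp: K1_def K2_def\<close>)
  moreover have "F \<in> borel_measurable (PiM K1 (\<lambda>_. offspring_space))"
    unfolding F_def[abs_def]
    by (intro borel_measurable_prod_ennreal measurable_subtree_sum f) (use B in \<open>auto simp: K1_def\<close>)
  moreover have "G \<in> borel_measurable (PiM K2 (\<lambda>_. offspring_space))"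
    unfolding G_def[abs_def]
    by (intro borel_measurable_prod_ennreal borel_measurable_add borel_measurable_sum borel_measurable_const
        measurable_subtree_sum f) (use B in \<open>auto simp: K2_def\<close>)
  ultimately have "(\<integral>\<^sup>+\<omega>. F (restrict (\<lambda>u. D u \<omega>) K1) * G (restrict (\<lambda>u. D u \<omega>) K2) \<partial>M) =
      (\<integral>\<^sup>+\<omega>. F (restrict (\<lambda>u. D u \<omega>) K1) \<partial>M) * (\<integral>\<^sup>+\<omega>. G (restrict (\<lambda>u. D u \<omega>) K2) \<partial>M)"
    by (rule nn_integral_indep_mult)
  moreover have "F (restrict (\<lambda>u. D u \<omega>) K1) = (\<Prod>i\<in>B. tree_sum k (f i) (\<lambda>w. D (j # w) \<omega>) (x j))" for \<omega>
    by (simp add: F_def K1_def)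
  moreover have "G (restrict (\<lambda>u. D u \<omega>) K2) =
      (\<Prod>i\<in>B'. c i + (\<Sum>l\<in>J'. tree_sum k (f i) (\<lambda>w. D (l # w) \<omega>) (x l)))" for \<omega>
    unfolding G_def by (intro prod.cong sum.cong arg_cong2[where f = "(+)"] refl) (simp add: K2_def)
  moreover have "(\<integral>\<^sup>+\<omega>. (\<Prod>i\<in>B. tree_sum k (f i) (\<lambda>w. D (j # w) \<omega>) (x j)) \<partial>M) = m B (x j)"
    using m[OF B(1), of j "x j"] by (simp add: tree_moment_def)
  ultimately show "(\<integral>\<^sup>+\<omega>. (\<Prod>i\<in>B. tree_sum k (f i) (\<lambda>w. D (j # w) \<omega>) (x j)) *
        (\<Prod>i\<in>B'. c i + (\<Sum>l\<in>J'. tree_sum k (f i) (\<lambda>w. D (l # w) \<omega>) (x l))) \<partial>M) =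
      m B (x j) * (\<integral>\<^sup>+\<omega>. (\<Prod>i\<in>B'. c i + (\<Sum>l\<in>J'. tree_sum k (f i) (\<lambda>w. D (l # w) \<omega>) (x l))) \<partial>M)"
    by simp
qed simp

text \<open>The data of the root are independent of all other data. With the root frozen at
  \<omega>, the children sit at fixed places and the integral over \<omega>' is the conditional
  expectation \<open>cluster_moment\<close>. The common moment function m for all children is an
  assumption at this stage.\<close>

lemma tree_moment_Suc:
  fixes D :: "nat list \<Rightarrow> 'a \<Rightarrow> 'b::euclidean_space offspring"
  assumes D: "branching_family \<gamma> D" and A: "finite A"
    and f: "\<And>i. i \<in> A \<Longrightarrow> f i \<in> borel_measurable borel"
    and m: "\<And>j B y. B \<subseteq> A \<Longrightarrow> tree_moment k f (\<lambda>w. D (j # w)) B y = m B y"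
  shows "tree_moment (Suc k) f D A z = (\<integral>\<^sup>+\<omega>. cluster_moment (\<lambda>i. f i z) (\<lambda>B x. m B (z + x)) A
      (image_mset (\<lambda>j. snd (D [] \<omega>) j) (mset_set {..<fst (D [] \<omega>)})) \<partial>M)"
proof -
  define K2 :: "nat list set" where "K2 = - {[]}"
  \<comment> \<open>Reassembles a tree from root data r and the data r' of all other individuals, so
    that the tree sum becomes a function of an independent pair.\<close>
  define glue :: "(nat list \<Rightarrow> 'b offspring) \<Rightarrow> (nat list \<Rightarrow> 'b offspring) \<Rightarrow> nat list \<Rightarrow> 'b offspring"
    where "glue r r' u = (if u = [] then r [] else r' u)" for r r' u
  define F where "F r r' = (\<Prod>i\<in>A. tree_sum (Suc k) (f i) (glue r r') z)" for r r'
  have ind: "indep_vars (\<lambda>_. offspring_space) D UNIV"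
    using D by (simp add: branching_family_def)
  have "indep_var (PiM {[]} (\<lambda>_. offspring_space)) (\<lambda>\<omega>. restrict (\<lambda>u. D u \<omega>) {[]})
      (PiM K2 (\<lambda>_. offspring_space)) (\<lambda>\<omega>. restrict (\<lambda>u. D u \<omega>) K2)"
    by (rule indep_var_restrict[OF ind]) (auto simp: K2_def)
  moreover have "(\<lambda>(r, r'). F r r') \<in> borel_measurable
      (PiM {[]} (\<lambda>_. offspring_space) \<Otimes>\<^sub>M PiM K2 (\<lambda>_. offspring_space))"
  proof -
    have "(\<lambda>p. glue (fst p) (snd p) u) \<in> measurable
        (PiM {[]} (\<lambda>_. offspring_space) \<Otimes>\<^sub>M PiM K2 (\<lambda>_. offspring_space)) offspring_space" for u
    proof (cases "u = []")
      case True
      then show ?thesis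
        unfolding glue_def using measurable_compose[OF measurable_fst measurable_component_singleton[of "[]" "{[]}"]]
        by simp
    next
      case False
      then show ?thesis
        unfolding glue_def using measurable_compose[OF measurable_snd measurable_component_singleton[of u K2]]
        by (simp add: K2_def)
    qed
    then have "(\<lambda>p. glue (fst p) (snd p)) \<in> measurable
        (PiM {[]} (\<lambda>_. offspring_space) \<Otimes>\<^sub>M PiM K2 (\<lambda>_. offspring_space)) (PiM UNIV (\<lambda>_. offspring_space))"
      by (intro measurable_PiM_single'[where f = "\<lambda>u p. glue (fst p) (snd p) u"])
        (auto simp: space_pair_measure space_PiM)
    then show ?thesis
      unfolding F_def case_prod_beta by (intro borel_measurable_prod_ennreal measurable_tree_sum f) simp_all
  qed
  ultimately have "(\<integral>\<^sup>+\<omega>. F (restrict (\<lambda>u. D u \<omega>) {[]}) (restrict (\<lambda>u. D u \<omega>) K2) \<partial>M) =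
      (\<integral>\<^sup>+\<omega>. (\<integral>\<^sup>+\<omega>'. F (restrict (\<lambda>u. D u \<omega>) {[]}) (restrict (\<lambda>u. D u \<omega>') K2) \<partial>M) \<partial>M)"
    by (rule nn_integral_indep_pair)
  moreover have "glue (restrict (\<lambda>u. D u \<omega>) {[]}) (restrict (\<lambda>u. D u \<omega>) K2) = (\<lambda>u. D u \<omega>)" for \<omega>
    by (auto simp: glue_def K2_def)
  then have "(\<integral>\<^sup>+\<omega>. F (restrict (\<lambda>u. D u \<omega>) {[]}) (restrict (\<lambda>u. D u \<omega>) K2) \<partial>M) = tree_moment (Suc k) f D A z"
    by (simp add: F_def tree_moment_def del: tree_sum.simps)
  moreover have "(\<integral>\<^sup>+\<omega>'. F (restrict (\<lambda>u. D u \<omega>) {[]}) (restrict (\<lambda>u. D u \<omega>') K2) \<partial>M) =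
      cluster_moment (\<lambda>i. f i z) (\<lambda>B x. m B (z + x)) A
        (image_mset (\<lambda>j. snd (D [] \<omega>) j) (mset_set {..<fst (D [] \<omega>)}))" for \<omega>
  proof -
    have "F (restrict (\<lambda>u. D u \<omega>) {[]}) (restrict (\<lambda>u. D u \<omega>') K2) =
        (\<Prod>i\<in>A. f i z + (\<Sum>j<fst (D [] \<omega>). tree_sum k (f i) (\<lambda>w. D (j # w) \<omega>') (z + snd (D [] \<omega>) j)))" for \<omega>'
      by (simp add: F_def glue_def K2_def)
    then have "(\<integral>\<^sup>+\<omega>'. F (restrict (\<lambda>u. D u \<omega>) {[]}) (restrict (\<lambda>u. D u \<omega>') K2) \<partial>M) =
        cluster_moment (\<lambda>i. f i z) m A (image_mset (\<lambda>j. z + snd (D [] \<omega>) j) (mset_set {..<fst (D [] \<omega>)}))"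
      by (simp only:) (rule nn_integral_subtrees[OF D A]; (rule f | rule m); assumption)
    also have "\<dots> = cluster_moment (\<lambda>i. f i z) m A
        (image_mset (\<lambda>x. z + x) (image_mset (\<lambda>j. snd (D [] \<omega>) j) (mset_set {..<fst (D [] \<omega>)})))"
      by (simp add: image_mset.compositionality comp_def)
    also have "\<dots> = cluster_moment (\<lambda>i. f i z) (\<lambda>B x. m B (z + x)) A
        (image_mset (\<lambda>j. snd (D [] \<omega>) j) (mset_set {..<fst (D [] \<omega>)}))"
      by (rule cluster_moment_image_mset[OF A])
    finally show ?thesis .
  qed
  ultimately show ?thesis by simp
qed

text \<open>The Mecke recursion involves the process only through its intensity, so induction on A
  shows that it determines the expectation.\<close>

lemma poisson_cluster_moment_unique:
  fixes \<eta> \<eta>' :: "'a \<Rightarrow> 'b multiset"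
  assumes ppp: "poisson_point_process \<gamma> \<eta>" "poisson_point_process \<gamma> \<eta>'"
    and \<gamma>: "space \<gamma> = UNIV" "finite_measure \<gamma>"
    and A: "finite A"
    and m: "\<And>B. B \<subseteq> A \<Longrightarrow> m B \<in> borel_measurable \<gamma>"
  shows "(\<integral>\<^sup>+\<omega>. cluster_moment c m A (\<eta> \<omega>) \<partial>M) = (\<integral>\<^sup>+\<omega>. cluster_moment c m A (\<eta>' \<omega>) \<partial>M)"
  using A m
proof (induction A rule: finite_psubset_induct)
  case (psubset A)
  show ?case
  proof (cases "A = {}")
    case False
    then have a: "Min A \<in> A" using psubset.hyps by simp
    have IH: "(\<integral>\<^sup>+\<omega>. cluster_moment c m (A - B) (\<eta> \<omega>) \<partial>M) = (\<integral>\<^sup>+\<omega>. cluster_moment c m (A - B) (\<eta>' \<omega>) \<partial>M)"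
      if "Min A \<in> B" for B
      by (rule psubset.IH) (use a that psubset.prems in auto)
    have eq: "(\<integral>\<^sup>+\<omega>. cluster_moment c m A (\<zeta> \<omega>) \<partial>M) =
      c (Min A) * (\<integral>\<^sup>+\<omega>. cluster_moment c m (A - {Min A}) (\<zeta> \<omega>) \<partial>M) +
      (\<Sum>B | Min A \<in> B \<and> B \<subseteq> A. (\<integral>\<^sup>+x. m B x \<partial>\<gamma>) * (\<integral>\<^sup>+\<omega>. cluster_moment c m (A - B) (\<zeta> \<omega>) \<partial>M))"
      if "poisson_point_process \<gamma> \<zeta>" for \<zeta>
      by (rule poisson_cluster_moment[OF that \<gamma> psubset.hyps(1) False psubset.prems])
    show ?thesis
      unfolding eq[OF ppp(1)] eq[OF ppp(2)]
      by (intro arg_cong2[where f = "(+)"] sum.cong refl arg_cong2[where f = "(*)"] IH) auto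
  qed simp
qed

text \<open>The order in which the children of an individual are listed may depend on the individual in
  an arbitrary way, so different subtrees need not be equal in distribution. Only moments of
  functionals of the point configurations agree.\<close>

lemma tree_moment_unique:
  assumes \<gamma>: "sets \<gamma> = sets borel" "finite_measure \<gamma>"
    and D: "branching_family \<gamma> D" "branching_family \<gamma> D'" and A: "finite A"
    and f: "\<And>i. i \<in> A \<Longrightarrow> f i \<in> borel_measurable borel"
  shows "tree_moment k f D A z = tree_moment k f D' A z"
  using D A f
proof (induction k arbitrary: D D' A z)
  case 0
  then show ?case by (simp add: tree_moment_def)
next
  case (Suc k)
  define m where "m = tree_moment k f D"
  have sp: "space \<gamma> = UNIV" using sets_eq_imp_space_eq[OF \<gamma>(1)] by simp
  \<comment> \<open>The induction hypothesis compares each subtree of either family with the whole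
    family D, so one function m serves all children of both roots.\<close>
  have m: "tree_moment k f (\<lambda>w. D'' (j # w)) B y = m B y"
    if "B \<subseteq> A" "branching_family \<gamma> D''" for j B y D''
    unfolding m_def
    by (rule Suc.IH[OF branching_family_subtree[OF that(2)] Suc.prems(1) finite_subset[OF that(1) Suc.prems(3)]])
      (rule Suc.prems(4), use that in blast)
  have "m B \<in> borel_measurable borel" if "B \<subseteq> A" for B
    unfolding m_def by (rule measurable_tree_moment[OF Suc.prems(1)]) (use Suc.prems(4) that in auto)
  then have meas: "(\<lambda>x. m B (z + x)) \<in> borel_measurable \<gamma>" if "B \<subseteq> A" for B
    using that \<gamma>(1) by (simp cong: measurable_cong_sets)
  have eq: "tree_moment (Suc k) f D'' A z =
      (\<integral>\<^sup>+\<omega>. cluster_moment (\<lambda>i. f i z) (\<lambda>B x. m B (z + x)) A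
        (image_mset (\<lambda>j. snd (D'' [] \<omega>) j) (mset_set {..<fst (D'' [] \<omega>)})) \<partial>M)"
    if D'': "branching_family \<gamma> D''" for D''
  proof (rule tree_moment_Suc[OF D'' Suc.prems(3)])
    show "f i \<in> borel_measurable borel" if "i \<in> A" for i by (rule Suc.prems(4)[OF that])
    show "tree_moment k f (\<lambda>w. D'' (j # w)) B y = m B y" if "B \<subseteq> A" for j B y
      by (rule m[OF that D''])
  qed
  show ?case
    unfolding eq[OF Suc.prems(1)] eq[OF Suc.prems(2)]
  proof (rule poisson_cluster_moment_unique[OF _ _ sp \<gamma>(2) Suc.prems(3)])
    show "(\<lambda>x. m B (z + x)) \<in> borel_measurable \<gamma>" if "B \<subseteq> A" for B by (rule meas[OF that])
  qed (use Suc.prems(1,2) in \<open>auto simp: branching_family_def\<close>)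
qed

text \<open>Subtrees have the same moments as the whole family, so a single moment function appears
  on both sides. A child heads a tree with one generation less, hence k in the integral and
  \<open>Suc k\<close> in the remaining factor.\<close>

lemma tree_moment_rec:
  assumes \<gamma>: "sets \<gamma> = sets borel" "finite_measure \<gamma>"
    and D: "branching_family \<gamma> D" and A: "finite A" "A \<noteq> {}"
    and f: "\<And>i. i \<in> A \<Longrightarrow> f i \<in> borel_measurable borel"
  shows "tree_moment (Suc k) f D A z = f (Min A) z * tree_moment (Suc k) f D (A - {Min A}) z +
    (\<Sum>B | Min A \<in> B \<and> B \<subseteq> A.
      (\<integral>\<^sup>+x. tree_moment k f D B (z + x) \<partial>\<gamma>) * tree_moment (Suc k) f D (A - B) z)"
proof -
  define \<eta> where "\<eta> \<omega> = image_mset (\<lambda>j. snd (D [] \<omega>) j) (mset_set {..<fst (D [] \<omega>)})" for \<omega>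
  have sp: "space \<gamma> = UNIV" using sets_eq_imp_space_eq[OF \<gamma>(1)] by simp
  have ppp: "poisson_point_process \<gamma> \<eta>"
    using D unfolding branching_family_def \<eta>_def[abs_def] by blast
  have "tree_moment k f D B \<in> borel_measurable borel" if "B \<subseteq> A" for B
    by (rule measurable_tree_moment[OF D]) (use f that in auto)
  then have meas: "(\<lambda>x. tree_moment k f D B (z + x)) \<in> borel_measurable \<gamma>" if "B \<subseteq> A" for B
    using that \<gamma>(1) by (simp cong: measurable_cong_sets)
  have eq: "tree_moment (Suc k) f D B z =
      (\<integral>\<^sup>+\<omega>. cluster_moment (\<lambda>i. f i z) (\<lambda>B x. tree_moment k f D B (z + x)) B (\<eta> \<omega>) \<partial>M)"
    if B: "B \<subseteq> A" for B
    unfolding \<eta>_def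
  proof (rule tree_moment_Suc[OF D finite_subset[OF B A(1)]])
    show "f i \<in> borel_measurable borel" if "i \<in> B" for i using f B that by auto
    show "tree_moment k f (\<lambda>w. D (j # w)) C y = tree_moment k f D C y" if "C \<subseteq> B" for j C y
    proof (rule tree_moment_unique[OF \<gamma> branching_family_subtree[OF D] D])
      show "finite C" by (rule finite_subset[OF that finite_subset[OF B A(1)]])
      show "f i \<in> borel_measurable borel" if "i \<in> C" for i using f B that \<open>C \<subseteq> B\<close> by auto
    qed
  qed
  have sub: "A - B \<subseteq> A" for B by auto
  show ?thesis
    unfolding eq[OF subset_refl] eq[OF sub]
  proof (rule poisson_cluster_moment[OF ppp sp \<gamma>(2) A])
    show "(\<lambda>x. tree_moment k f D B (z + x)) \<in> borel_measurable \<gamma>" if "B \<subseteq> A" for B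
      by (rule meas[OF that])
  qed
qed

end

section \<open>Moments of the whole cluster\<close>

text \<open>A supremum of truncations instead of a sum over all individuals: it is meaningful,
  measurable and accessible to monotone convergence before the tree is known to be finite.\<close>

definition tree_total ::
    "('a::euclidean_space \<Rightarrow> ennreal) \<Rightarrow> (nat list \<Rightarrow> 'a offspring) \<Rightarrow> 'a \<Rightarrow> ennreal" where
  "tree_total g d z = (SUP k. tree_sum k g d z)"

lemma incseq_tree_sum: "incseq (\<lambda>k. tree_sum k g d z)"
  by (simp add: incseq_def tree_sum_mono)

lemma measurable_tree_total [measurable (raw)]:
  fixes g :: "'a::euclidean_space \<Rightarrow> ennreal"
  assumes "g \<in> borel_measurable borel"
    and "d \<in> measurable L (PiM UNIV (\<lambda>_. offspring_space))" "z \<in> borel_measurable L"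
  shows "(\<lambda>x. tree_total g (d x) (z x)) \<in> borel_measurable L"
  unfolding tree_total_def by (intro borel_measurable_SUP measurable_tree_sum assms) simp

lemma tree_total_mono:
  assumes "\<And>x. g x \<le> h x"
  shows "tree_total g d z \<le> tree_total h d z"
proof -
  have "tree_sum k g d z \<le> tree_sum k h d z" for k
    by (induction k arbitrary: d z) (auto intro!: add_mono sum_mono assms)
  then show ?thesis unfolding tree_total_def by (intro SUP_mono) auto
qed

lemma prod_mono_ennreal:
  fixes f g :: "'i \<Rightarrow> ennreal"
  assumes "\<And>i. i \<in> I \<Longrightarrow> f i \<le> g i"
  shows "prod f I \<le> prod g I"
  using assms by (induction I rule: infinite_finite_induct) (auto intro!: mult_mono)

lemma incseq_prod_ennreal:
  fixes f :: "'i \<Rightarrow> nat \<Rightarrow> ennreal"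
  assumes "\<And>i. i \<in> I \<Longrightarrow> incseq (f i)"
  shows "incseq (\<lambda>n. \<Prod>i\<in>I. f i n)"
  using assms by (auto simp: incseq_def intro!: prod_mono_ennreal)

lemma SUP_prod_incseq_ennreal:
  fixes f :: "'i \<Rightarrow> nat \<Rightarrow> ennreal"
  assumes "finite I" "\<And>i. i \<in> I \<Longrightarrow> incseq (f i)"
  shows "(SUP n. \<Prod>i\<in>I. f i n) = (\<Prod>i\<in>I. SUP n. f i n)"
  using assms
proof (induction I)
  case (insert x I)
  then show ?case by (simp add: SUP_mult_incseq_ennreal incseq_prod_ennreal)
qed simp

lemma SUP_Suc_incseq:
  fixes f :: "nat \<Rightarrow> ennreal"
  assumes "incseq f"
  shows "(SUP n. f (Suc n)) = (SUP n. f n)"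
proof (rule antisym)
  show "(SUP n. f n) \<le> (SUP n. f (Suc n))"
  proof (rule SUP_mono)
    fix n show "\<exists>m\<in>UNIV. f n \<le> f (Suc m)" using incseq_SucD[OF assms, of n] by blast
  qed
qed (auto intro: SUP_mono)

context prob_space
begin

definition total_moment ::
    "(nat \<Rightarrow> 'b \<Rightarrow> ennreal) \<Rightarrow> (nat list \<Rightarrow> 'a \<Rightarrow> 'b::euclidean_space offspring) \<Rightarrow>
      nat set \<Rightarrow> 'b \<Rightarrow> ennreal" where
  "total_moment f D A z = (\<integral>\<^sup>+\<omega>. (\<Prod>i\<in>A. tree_total (f i) (\<lambda>u. D u \<omega>) z) \<partial>M)"

lemma incseq_tree_moment: "incseq (\<lambda>k. tree_moment k f D A z)"
  unfolding tree_moment_def incseq_def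
  by (intro allI impI nn_integral_mono prod_mono_ennreal) (auto intro: tree_sum_mono)

lemma total_moment_SUP:
  assumes D: "branching_family \<gamma> D" and A: "finite A"
    and f: "\<And>i. i \<in> A \<Longrightarrow> f i \<in> borel_measurable borel"
  shows "total_moment f D A z = (SUP k. tree_moment k f D A z)"
proof -
  have "total_moment f D A z = (\<integral>\<^sup>+\<omega>. (SUP k. \<Prod>i\<in>A. tree_sum k (f i) (\<lambda>u. D u \<omega>) z) \<partial>M)"
    unfolding total_moment_def tree_total_def
    by (subst SUP_prod_incseq_ennreal[OF A incseq_tree_sum]) simp
  also have "\<dots> = (SUP k. tree_moment k f D A z)"
    unfolding tree_moment_def
  proof (rule nn_integral_monotone_convergence_SUP)
    show "incseq (\<lambda>k \<omega>. \<Prod>i\<in>A. tree_sum k (f i) (\<lambda>u. D u \<omega>) z)"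
      by (auto simp: incseq_def le_fun_def intro!: prod_mono_ennreal tree_sum_mono)
    show "(\<lambda>\<omega>. \<Prod>i\<in>A. tree_sum k (f i) (\<lambda>u. D u \<omega>) z) \<in> borel_measurable M" for k
      by (intro borel_measurable_prod_ennreal measurable_tree_sum f branching_family_measurable(2)[OF D]) simp_all
  qed
  finally show ?thesis .
qed

lemma measurable_total_moment:
  assumes D: "branching_family \<gamma> D" and A: "finite A"
    and f: "\<And>i. i \<in> A \<Longrightarrow> f i \<in> borel_measurable borel"
  shows "total_moment f D A \<in> borel_measurable borel"
proof -
  have "total_moment f D A = (\<lambda>z. SUP k. tree_moment k f D A z)"
    by (rule ext) (rule total_moment_SUP[OF D A f])
  then show ?thesis
    by (simp only:) (intro borel_measurable_SUP measurable_tree_moment[OF D] f; simp)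
qed

lemma total_moment_empty [simp]: "total_moment f D {} z = 1"
  by (simp add: total_moment_def emeasure_space_1)

text \<open>Every term of the truncated recursion increases with k, and the mismatch between k and
  \<open>Suc k\<close> disappears in the supremum.\<close>

lemma total_moment_rec:
  assumes \<gamma>: "sets \<gamma> = sets borel" "finite_measure \<gamma>"
    and D: "branching_family \<gamma> D" and A: "finite A" "A \<noteq> {}"
    and f: "\<And>i. i \<in> A \<Longrightarrow> f i \<in> borel_measurable borel"
  shows "total_moment f D A z = f (Min A) z * total_moment f D (A - {Min A}) z +
    (\<Sum>B | Min A \<in> B \<and> B \<subseteq> A.
      (\<integral>\<^sup>+x. total_moment f D B (z + x) \<partial>\<gamma>) * total_moment f D (A - B) z)"
proof -
  define T where "T k B = tree_moment k f D B z" for k B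
  define I where "I k B = (\<integral>\<^sup>+x. tree_moment k f D B (z + x) \<partial>\<gamma>)" for k B
  have T: "incseq (\<lambda>k. T k B)" "(SUP k. T (Suc k) B) = total_moment f D B z" if "B \<subseteq> A" for B
  proof -
    show inc: "incseq (\<lambda>k. T k B)" unfolding T_def by (rule incseq_tree_moment)
    show "(SUP k. T (Suc k) B) = total_moment f D B z"
      unfolding SUP_Suc_incseq[OF inc] unfolding T_def
      by (rule total_moment_SUP[symmetric, OF D finite_subset[OF that A(1)]]) (use f that in auto)
  qed
  have T': "incseq (\<lambda>k. T (Suc k) B)" if "B \<subseteq> A" for B
    using T(1)[OF that] by (simp add: incseq_def)
  have I: "incseq (\<lambda>k. I k B)" "(SUP k. I k B) = (\<integral>\<^sup>+x. total_moment f D B (z + x) \<partial>\<gamma>)"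
    if B: "B \<subseteq> A" for B
  proof -
    show "incseq (\<lambda>k. I k B)"
      unfolding I_def using incseq_tree_moment[of f D B]
      by (auto simp: incseq_def intro!: nn_integral_mono)
    have "tree_moment k f D B \<in> borel_measurable borel" for k
      by (rule measurable_tree_moment[OF D]) (use f B in auto)
    then have meas: "(\<lambda>x. tree_moment k f D B (z + x)) \<in> borel_measurable \<gamma>" for k
      using \<gamma>(1) by (simp cong: measurable_cong_sets)
    have tot: "total_moment f D B y = (SUP k. tree_moment k f D B y)" for y
      by (rule total_moment_SUP[OF D finite_subset[OF B A(1)]]) (use f B in auto)
    show "(SUP k. I k B) = (\<integral>\<^sup>+x. total_moment f D B (z + x) \<partial>\<gamma>)"
      unfolding I_def tot
      by (rule nn_integral_monotone_convergence_SUP[symmetric])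
        (use meas incseq_tree_moment[of f D B] in \<open>auto simp: incseq_def le_fun_def\<close>)
  qed
  have rec: "T (Suc k) A = f (Min A) z * T (Suc k) (A - {Min A}) +
      (\<Sum>B | Min A \<in> B \<and> B \<subseteq> A. I k B * T (Suc k) (A - B))" for k
    unfolding T_def I_def by (rule tree_moment_rec[OF \<gamma> D A f])
  have 1: "incseq (\<lambda>k. f (Min A) z * T (Suc k) (A - {Min A}))"
    by (rule incseq_mult_ennreal) (use T' in \<open>auto simp: incseq_def\<close>)
  have 2: "incseq (\<lambda>k. I k B * T (Suc k) (A - B))" if "B \<subseteq> A" for B
    by (rule incseq_mult_ennreal) (use I T' that in auto)
  have 3: "incseq (\<lambda>k. \<Sum>B | Min A \<in> B \<and> B \<subseteq> A. I k B * T (Suc k) (A - B))"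
    by (rule incseq_sum_ennreal) (use 2 in auto)
  have "total_moment f D A z = (SUP k. T (Suc k) A)"
    using T(2)[of A] by simp
  also have "\<dots> = (SUP k. f (Min A) z * T (Suc k) (A - {Min A})) +
      (SUP k. \<Sum>B | Min A \<in> B \<and> B \<subseteq> A. I k B * T (Suc k) (A - B))"
    unfolding rec by (rule ennreal_SUP_add[OF 1 3])
  also have "(SUP k. f (Min A) z * T (Suc k) (A - {Min A})) = f (Min A) z * (SUP k. T (Suc k) (A - {Min A}))"
    by (rule SUP_mult_left_ennreal[symmetric])
  also have "(SUP k. \<Sum>B | Min A \<in> B \<and> B \<subseteq> A. I k B * T (Suc k) (A - B)) =
      (\<Sum>B | Min A \<in> B \<and> B \<subseteq> A. SUP k. I k B * T (Suc k) (A - B))"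
    by (rule ennreal_SUP_sum) (use 2 in auto)
  also have "\<dots> = (\<Sum>B | Min A \<in> B \<and> B \<subseteq> A. (SUP k. I k B) * (SUP k. T (Suc k) (A - B)))"
    by (intro sum.cong refl SUP_mult_incseq_ennreal I T') auto
  also have "\<dots> = (\<Sum>B | Min A \<in> B \<and> B \<subseteq> A.
      (\<integral>\<^sup>+x. total_moment f D B (z + x) \<partial>\<gamma>) * total_moment f D (A - B) z)"
    by (intro sum.cong refl arg_cong2[where f = "(*)"] I T) auto
  also have "(SUP k. T (Suc k) (A - {Min A})) = total_moment f D (A - {Min A}) z"
    by (rule T) auto
  finally show ?thesis .
qed

end

section \<open>Ulam-Harris labels and almost sure finiteness of the tree\<close>

lemma alive_Nil [simp]: "alive N \<omega> []"
  by (simp add: alive_def)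

lemma alive_Cons: "alive N \<omega> (j # w) \<longleftrightarrow> j < N [] \<omega> \<and> alive (\<lambda>u. N (j # u)) \<omega> w"
  by (simp add: alive_def All_less_Suc2)

lemma position_Nil [simp]: "position X \<omega> [] = 0"
  by (simp add: position_def)

lemma position_Cons: "position X \<omega> (j # w) = X [] j \<omega> + position (\<lambda>u. X (j # u)) \<omega> w"
  unfolding position_def length_Cons sum.lessThan_Suc_shift by simp

definition alive_upto :: "(nat list \<Rightarrow> 'w \<Rightarrow> nat) \<Rightarrow> 'w \<Rightarrow> nat \<Rightarrow> nat list set" where
  "alive_upto N \<omega> k = {u. alive N \<omega> u \<and> length u \<le> k}"

lemma alive_upto_0: "alive_upto N \<omega> 0 = {[]}"
  by (auto simp: alive_upto_def)

lemma alive_upto_Suc: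
  "alive_upto N \<omega> (Suc k) = insert [] (\<Union>j<N [] \<omega>. (\<lambda>w. j # w) ` alive_upto (\<lambda>u. N (j # u)) \<omega> k)"
proof (intro set_eqI)
  fix u
  show "u \<in> alive_upto N \<omega> (Suc k) \<longleftrightarrow>
    u \<in> insert [] (\<Union>j<N [] \<omega>. (\<lambda>w. j # w) ` alive_upto (\<lambda>u. N (j # u)) \<omega> k)"
    by (cases u) (auto simp: alive_upto_def alive_Cons)
qed

lemma finite_alive_upto: "finite (alive_upto N \<omega> k)"
  by (induction k arbitrary: N) (auto simp: alive_upto_0 alive_upto_Suc)

lemma tree_sum_eq_sum_alive:
  fixes X :: "nat list \<Rightarrow> nat \<Rightarrow> 'w \<Rightarrow> 'a::euclidean_space"
  shows "tree_sum k g (\<lambda>u. (N u \<omega>, \<lambda>i. X u i \<omega>)) z = (\<Sum>u\<in>alive_upto N \<omega> k. g (z + position X \<omega> u))"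
proof (induction k arbitrary: N X z)
  case 0
  then show ?case by (simp add: alive_upto_0)
next
  case (Suc k)
  have "(\<Sum>u\<in>alive_upto N \<omega> (Suc k). g (z + position X \<omega> u)) =
      g z + (\<Sum>u\<in>(\<Union>j<N [] \<omega>. (\<lambda>w. j # w) ` alive_upto (\<lambda>u. N (j # u)) \<omega> k). g (z + position X \<omega> u))"
    unfolding alive_upto_Suc by (subst sum.insert) (auto simp: finite_alive_upto)
  also have "(\<Sum>u\<in>(\<Union>j<N [] \<omega>. (\<lambda>w. j # w) ` alive_upto (\<lambda>u. N (j # u)) \<omega> k). g (z + position X \<omega> u)) =
      (\<Sum>j<N [] \<omega>. \<Sum>u\<in>(\<lambda>w. j # w) ` alive_upto (\<lambda>u. N (j # u)) \<omega> k. g (z + position X \<omega> u))"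
    by (rule sum.UNION_disjoint) (auto simp: finite_alive_upto)
  also have "\<dots> = (\<Sum>j<N [] \<omega>. tree_sum k g (\<lambda>w. (N (j # w) \<omega>, \<lambda>i. X (j # w) i \<omega>)) (z + X [] j \<omega>))"
  proof (rule sum.cong[OF refl])
    fix j
    show "(\<Sum>u\<in>(\<lambda>w. j # w) ` alive_upto (\<lambda>u. N (j # u)) \<omega> k. g (z + position X \<omega> u)) =
        tree_sum k g (\<lambda>w. (N (j # w) \<omega>, \<lambda>i. X (j # w) i \<omega>)) (z + X [] j \<omega>)"
      using Suc[of "\<lambda>u. N (j # u)" "\<lambda>u. X (j # u)" "z + X [] j \<omega>"]
      by (subst sum.reindex) (auto simp: inj_on_def position_Cons add.assoc)
  qed
  finally show ?case by simp
qed

locale subcritical_branching = poisson_branching M \<gamma> N X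
  for M :: "'w measure" and \<gamma> :: "'a::euclidean_space measure" and N X +
  assumes sets_\<gamma>: "sets \<gamma> = sets borel" and mass_less_1: "emeasure \<gamma> UNIV < 1"
begin

definition offspring_family :: "nat list \<Rightarrow> 'w \<Rightarrow> 'a offspring" where
  "offspring_family u \<omega> = (N u \<omega>, \<lambda>i. X u i \<omega>)"

abbreviation tree :: "'w \<Rightarrow> nat list \<Rightarrow> 'a offspring" where
  "tree \<omega> \<equiv> \<lambda>u. offspring_family u \<omega>"

lemma space_\<gamma>: "space \<gamma> = UNIV"
  using sets_eq_imp_space_eq[OF sets_\<gamma>] by simp

lemma finite_measure_\<gamma>: "finite_measure \<gamma>"
  by (rule finite_measureI) (use mass_less_1 in \<open>auto simp: space_\<gamma>\<close>)

sublocale \<gamma>: finite_measure \<gamma> by (rule finite_measure_\<gamma>)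

lemma measurable_\<gamma>: "f \<in> borel_measurable borel \<Longrightarrow> f \<in> borel_measurable \<gamma>"
  using sets_\<gamma> by (simp cong: measurable_cong_sets)

lemma branching: "branching_family \<gamma> offspring_family"
  using offspring_indep offspring_poisson
  unfolding branching_family_def offspring_family_def[abs_def] by simp

lemmas measurable_tree = branching_family_measurable(2)[OF branching]

lemma tree_sum_tree: "tree_sum k g (tree \<omega>) z = (\<Sum>u\<in>alive_upto N \<omega> k. g (z + position X \<omega> u))"
  unfolding offspring_family_def by (rule tree_sum_eq_sum_alive)

definition finite_tree :: "'w \<Rightarrow> bool" where
  "finite_tree \<omega> \<longleftrightarrow> finite {u. alive N \<omega> u}"

lemma tree_total_finite_tree:
  assumes "finite_tree \<omega>"
  shows "tree_total g (tree \<omega>) z = (\<Sum>u | alive N \<omega> u. g (z + position X \<omega> u))"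
proof (rule antisym)
  have fin: "finite {u. alive N \<omega> u}" using assms by (simp add: finite_tree_def)
  show "tree_total g (tree \<omega>) z \<le> (\<Sum>u | alive N \<omega> u. g (z + position X \<omega> u))"
    unfolding tree_total_def tree_sum_tree
    by (intro SUP_least sum_mono2 fin) (auto simp: alive_upto_def)
  define k where "k = Max (length ` {u. alive N \<omega> u})"
  have "alive_upto N \<omega> k = {u. alive N \<omega> u}"
    using fin by (auto simp: alive_upto_def k_def)
  then show "(\<Sum>u | alive N \<omega> u. g (z + position X \<omega> u)) \<le> tree_total g (tree \<omega>) z"
    unfolding tree_total_def tree_sum_tree by (intro SUP_upper2[of k]) auto
qed

text \<open>The total of the constant function 1 counts the individuals. This expresses finiteness
  through a measurable functional whose expectation can be bounded.\<close>

lemma finite_tree_iff: "finite_tree \<omega> \<longleftrightarrow> tree_total (\<lambda>_. 1) (tree \<omega>) z < \<infinity>"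
proof
  assume "finite_tree \<omega>"
  then show "tree_total (\<lambda>_. 1) (tree \<omega>) z < \<infinity>"
    by (simp add: tree_total_finite_tree of_nat_less_top)
next
  assume fin: "tree_total (\<lambda>_. 1) (tree \<omega>) z < \<infinity>"
  show "finite_tree \<omega>"
  proof (rule ccontr)
    assume "\<not> finite_tree \<omega>"
    then have inf: "infinite {u. alive N \<omega> u}" by (simp add: finite_tree_def)
    have "of_nat n \<le> tree_total (\<lambda>_. 1) (tree \<omega>) z" for n
    proof -
      obtain S where S: "S \<subseteq> {u. alive N \<omega> u}" "finite S" "card S = n"
        using infinite_arbitrarily_large[OF inf] by blast
      define k where "k = Max (length ` S)"
      have "S \<subseteq> alive_upto N \<omega> k"
      proof
        fix u assume u: "u \<in> S"
        then have "length u \<le> k"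
          unfolding k_def using S(2) by (intro Max_ge) simp_all
        then show "u \<in> alive_upto N \<omega> k"
          using S(1) u by (auto simp: alive_upto_def)
      qed
      then have "n \<le> card (alive_upto N \<omega> k)"
        using card_mono[OF finite_alive_upto] S(3) by metis
      then have "of_nat n \<le> tree_sum k (\<lambda>_. 1) (tree \<omega>) z"
        unfolding tree_sum_tree by simp
      then show ?thesis
        unfolding tree_total_def by (rule SUP_upper2[OF UNIV_I])
    qed
    then have "(SUP n. of_nat n :: ennreal) \<le> tree_total (\<lambda>_. 1) (tree \<omega>) z"
      by (intro SUP_least)
    with fin show False by (simp add: ennreal_SUP_of_nat_eq_top top_unique)
  qed
qed

text \<open>With q the mass of \<gamma>, the recursion for one constant function reads t' = 1 + q t,
  and 1 / (1 - q) is its fixed point; a bound by the fixed point is preserved in each step.\<close>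

lemma mean_progeny: "tree_moment k (\<lambda>_ _. 1) offspring_family {0} z \<le> 1 / (1 - emeasure \<gamma> UNIV)"
proof (induction k arbitrary: z)
  define q where "q = measure \<gamma> UNIV"
  have q: "emeasure \<gamma> UNIV = ennreal q" "0 \<le> q" "q < 1"
    using mass_less_1 by (auto simp: q_def \<gamma>.emeasure_eq_measure ennreal_less_one_iff)
  have c: "1 / (1 - emeasure \<gamma> UNIV) = ennreal (1 / (1 - q))"
    using q by (simp add: divide_ennreal ennreal_minus flip: ennreal_1)
  case 0
  show ?case
    using q unfolding c by (simp add: tree_moment_def emeasure_space_1)
next
  define q where "q = measure \<gamma> UNIV"
  have q: "emeasure \<gamma> UNIV = ennreal q" "0 \<le> q" "q < 1"
    using mass_less_1 by (auto simp: q_def \<gamma>.emeasure_eq_measure ennreal_less_one_iff)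
  have c: "1 / (1 - emeasure \<gamma> UNIV) = ennreal (1 / (1 - q))"
    using q by (simp add: divide_ennreal ennreal_minus flip: ennreal_1)
  case (Suc k)
  have B: "{B. (0::nat) \<in> B \<and> B \<subseteq> {0}} = {{0}}" by auto
  have e: "tree_moment l f offspring_family {} z = 1" for l f
    by (simp add: tree_moment_def emeasure_space_1)
  have "tree_moment (Suc k) (\<lambda>_ _. 1) offspring_family {0} z =
      1 + (\<integral>\<^sup>+x. tree_moment k (\<lambda>_ _. 1) offspring_family {0} (z + x) \<partial>\<gamma>)"
    using tree_moment_rec[OF sets_\<gamma> finite_measure_\<gamma> branching, of "{0}" "\<lambda>_ _. 1" k z] by (simp add: B e)
  also have "\<dots> \<le> 1 + (\<integral>\<^sup>+x. ennreal (1 / (1 - q)) \<partial>\<gamma>)"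
    using Suc unfolding c by (intro add_mono nn_integral_mono) auto
  also have "\<dots> = ennreal (1 + 1 / (1 - q) * q)"
    using q by (simp add: space_\<gamma> q(1) ennreal_mult[symmetric] flip: ennreal_1 ennreal_plus)
  also have "1 + 1 / (1 - q) * q = 1 / (1 - q)"
    using q by (simp add: field_simps)
  finally show ?case unfolding c .
qed

lemma AE_finite_tree: "AE \<omega> in M. finite_tree \<omega>"
proof -
  have meas: "(\<lambda>\<omega>. tree_total (\<lambda>_. 1) (tree \<omega>) 0) \<in> borel_measurable M"
    by (intro measurable_tree_total measurable_tree) simp_all
  have "(\<integral>\<^sup>+\<omega>. tree_total (\<lambda>_. 1) (tree \<omega>) 0 \<partial>M) = total_moment (\<lambda>_ _. 1) offspring_family {0} 0"
    by (simp add: total_moment_def)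
  also have "\<dots> = (SUP k. tree_moment k (\<lambda>_ _. 1) offspring_family {0} 0)"
    by (rule total_moment_SUP[OF branching]) auto
  also have "\<dots> \<le> 1 / (1 - emeasure \<gamma> UNIV)"
    by (intro SUP_least mean_progeny)
  also have "\<dots> < \<infinity>"
    using mass_less_1 by (simp add: ennreal_divide_eq_top_iff less_top[symmetric] diff_eq_0_iff_ennreal not_le)
  finally have "(\<integral>\<^sup>+\<omega>. tree_total (\<lambda>_. 1) (tree \<omega>) 0 \<partial>M) \<noteq> \<infinity>" by simp
  from nn_integral_PInf_AE[OF meas this] show ?thesis
    by eventually_elim (auto simp: finite_tree_iff[of _ 0] less_top)
qed

section \<open>Real cluster sums and their moments\<close>

definition cluster_sum :: "('a \<Rightarrow> real) \<Rightarrow> 'w \<Rightarrow> 'a \<Rightarrow> real" where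
  "cluster_sum g \<omega> z = g z + (\<Sum>x\<in>#cluster N X \<omega>. g (z + x))"

lemma cluster_sum_not_finite_tree:
  assumes "\<not> finite_tree \<omega>"
  shows "cluster_sum g \<omega> z = g z"
proof -
  have "{u. alive N \<omega> u} = insert [] {u. u \<noteq> [] \<and> alive N \<omega> u}" by auto
  then have "infinite {u. u \<noteq> [] \<and> alive N \<omega> u}"
    using assms by (simp add: finite_tree_def)
  then show ?thesis by (simp add: cluster_sum_def cluster_def)
qed

lemma cluster_sum_finite_tree:
  assumes "finite_tree \<omega>"
  shows "cluster_sum g \<omega> z = (\<Sum>u | alive N \<omega> u. g (z + position X \<omega> u))"
proof -
  have *: "{u. alive N \<omega> u} = insert [] {u. u \<noteq> [] \<and> alive N \<omega> u}" by auto
  then have "finite {u. u \<noteq> [] \<and> alive N \<omega> u}"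
    using assms by (simp add: finite_tree_def)
  then show ?thesis
    unfolding * by (simp add: cluster_sum_def cluster_def image_mset.compositionality comp_def sum_unfold_sum_mset)
qed

text \<open>Holds for every outcome: on infinite trees the cluster is empty by default, and the sum
  reduces to its value at the ancestor.\<close>

lemma cluster_sum_diff:
  "cluster_sum (\<lambda>x. g x - h x) \<omega> z = cluster_sum g \<omega> z - cluster_sum h \<omega> z"
  by (cases "finite_tree \<omega>")
    (simp_all add: cluster_sum_finite_tree cluster_sum_not_finite_tree sum_subtractf)

lemma abs_cluster_sum_le: "\<bar>cluster_sum g \<omega> z\<bar> \<le> cluster_sum (\<lambda>x. \<bar>g x\<bar>) \<omega> z"
  by (cases "finite_tree \<omega>")
    (simp_all add: cluster_sum_finite_tree cluster_sum_not_finite_tree sum_abs)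

lemma cluster_sum_mono:
  assumes "\<And>x. g x \<le> h x"
  shows "cluster_sum g \<omega> z \<le> cluster_sum h \<omega> z"
  by (cases "finite_tree \<omega>")
    (simp_all add: cluster_sum_finite_tree cluster_sum_not_finite_tree sum_mono assms)

lemma cluster_sum_nonneg: "(\<And>x. 0 \<le> g x) \<Longrightarrow> 0 \<le> cluster_sum g \<omega> z"
  by (cases "finite_tree \<omega>")
    (simp_all add: cluster_sum_finite_tree cluster_sum_not_finite_tree sum_nonneg)

lemma ennreal_cluster_sum:
  assumes "finite_tree \<omega>" "\<And>x. 0 \<le> g x"
  shows "ennreal (cluster_sum g \<omega> z) = tree_total (\<lambda>x. ennreal (g x)) (tree \<omega>) z"
  using assms by (simp add: cluster_sum_finite_tree tree_total_finite_tree)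

text \<open>For nonnegative g the sum is read off from \<open>tree_total\<close> on finite trees,
  which avoids a sigma-algebra on multisets; general g is a difference of two such functions. Joint
  measurability in the starting point is what makes moments measurable functions of it.\<close>

lemma measurable_cluster_sum:
  assumes g: "g \<in> borel_measurable borel"
  shows "(\<lambda>p. cluster_sum g (snd p) (fst p)) \<in> borel_measurable (borel \<Otimes>\<^sub>M M)"
proof -
  have pos: "(\<lambda>p. cluster_sum g (snd p) (fst p)) \<in> borel_measurable (borel \<Otimes>\<^sub>M M)"
    if g: "g \<in> borel_measurable borel" "\<And>x. 0 \<le> g x" for g
  proof -
    have tree: "(\<lambda>p. tree (snd p)) \<in> measurable ((borel :: 'a measure) \<Otimes>\<^sub>M M) (PiM UNIV (\<lambda>_. offspring_space))"
      by (rule measurable_compose[OF measurable_snd measurable_tree])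
    have [measurable]: "Measurable.pred (borel \<Otimes>\<^sub>M M) (\<lambda>p :: 'a \<times> 'w. finite_tree (snd p))"
      unfolding finite_tree_iff[of _ 0]
      by (intro borel_measurable_pred_less measurable_tree_total tree) simp_all
    have [measurable]: "(\<lambda>p. tree_total (\<lambda>x. ennreal (g x)) (tree (snd p)) (fst p)) \<in> borel_measurable (borel \<Otimes>\<^sub>M M)"
      by (intro measurable_tree_total tree) (use g in simp_all)
    have "cluster_sum g \<omega> z = (if finite_tree \<omega> then enn2real (tree_total (\<lambda>x. ennreal (g x)) (tree \<omega>) z) else g z)" for \<omega> z
    proof (cases "finite_tree \<omega>")
      case True
      have "0 \<le> cluster_sum g \<omega> z" by (rule cluster_sum_nonneg) (rule g(2))
      then show ?thesis
        using True by (simp add: ennreal_cluster_sum[OF True g(2), symmetric])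
    qed (simp add: cluster_sum_not_finite_tree)
    then show ?thesis using g(1) by simp
  qed
  have "g = (\<lambda>x. max 0 (g x) - max 0 (- g x))" by (auto simp: max_def)
  then have "cluster_sum g \<omega> z = cluster_sum (\<lambda>x. max 0 (g x)) \<omega> z - cluster_sum (\<lambda>x. max 0 (- g x)) \<omega> z" for \<omega> z
    by (subst \<open>g = _\<close>) (rule cluster_sum_diff)
  then show ?thesis
    using g by (simp only:) (intro borel_measurable_diff pos; simp)
qed

lemma measurable_cluster_sum_fixed:
  assumes "g \<in> borel_measurable borel"
  shows "(\<lambda>\<omega>. cluster_sum g \<omega> z) \<in> borel_measurable M"
  using measurable_compose[OF _ measurable_cluster_sum[OF assms], of "\<lambda>\<omega>. (z, \<omega>)" M] by simp

definition cmoment :: "(nat \<Rightarrow> 'a \<Rightarrow> real) \<Rightarrow> nat set \<Rightarrow> 'a \<Rightarrow> real" where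
  "cmoment f A z = (\<integral>\<omega>. (\<Prod>i\<in>A. cluster_sum (f i) \<omega> z) \<partial>M)"

definition abs_moment :: "(nat \<Rightarrow> 'a \<Rightarrow> real) \<Rightarrow> nat set \<Rightarrow> 'a \<Rightarrow> ennreal" where
  "abs_moment f A z = total_moment (\<lambda>i x. ennreal \<bar>f i x\<bar>) offspring_family A z"

lemma abs_moment_eq:
  "abs_moment f A z = (\<integral>\<^sup>+\<omega>. ennreal (\<Prod>i\<in>A. cluster_sum (\<lambda>x. \<bar>f i x\<bar>) \<omega> z) \<partial>M)"
  unfolding abs_moment_def total_moment_def
proof (rule nn_integral_cong_AE)
  show "AE \<omega> in M. (\<Prod>i\<in>A. tree_total (\<lambda>x. ennreal \<bar>f i x\<bar>) (tree \<omega>) z) =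
      ennreal (\<Prod>i\<in>A. cluster_sum (\<lambda>x. \<bar>f i x\<bar>) \<omega> z)"
    using AE_finite_tree
    by eventually_elim (simp add: ennreal_cluster_sum cluster_sum_nonneg flip: prod_ennreal)
qed

section \<open>Recursion for signed functions\<close>

text \<open>All subsets and all starting points are included because the recursion descends to
  blocks and moves the starting point to a child.\<close>

definition moments_finite :: "(nat \<Rightarrow> 'a \<Rightarrow> real) \<Rightarrow> nat set \<Rightarrow> bool" where
  "moments_finite f A \<longleftrightarrow> finite A \<and> (\<forall>i\<in>A. f i \<in> borel_measurable borel) \<and>
     (\<forall>B z. B \<subseteq> A \<longrightarrow> abs_moment f B z < \<infinity>)"

lemma moments_finite_subset: "moments_finite f A \<Longrightarrow> B \<subseteq> A \<Longrightarrow> moments_finite f B"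
  unfolding moments_finite_def by (auto intro: finite_subset)

lemma moments_finite_mono:
  assumes "moments_finite f A" "\<And>i. i \<in> A \<Longrightarrow> g i \<in> borel_measurable borel"
    and "\<And>i x. i \<in> A \<Longrightarrow> \<bar>g i x\<bar> \<le> \<bar>f i x\<bar>"
  shows "moments_finite g A"
proof -
  have "abs_moment g B z \<le> abs_moment f B z" if "B \<subseteq> A" for B z
    unfolding abs_moment_def total_moment_def
    by (intro nn_integral_mono prod_mono_ennreal tree_total_mono ennreal_leI assms(3)) (use that in auto)
  then show ?thesis
    using assms(1,2) unfolding moments_finite_def by (meson le_less_trans)
qed

lemma prod_cluster_sum_bound:
  "\<bar>\<Prod>i\<in>A. cluster_sum (f i) \<omega> z\<bar> \<le> (\<Prod>i\<in>A. cluster_sum (\<lambda>x. \<bar>f i x\<bar>) \<omega> z)"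
  unfolding abs_prod by (intro prod_mono) (simp add: abs_cluster_sum_le)

lemma integrable_prod_cluster_sum:
  assumes "moments_finite f A"
  shows "integrable M (\<lambda>\<omega>. \<Prod>i\<in>A. cluster_sum (f i) \<omega> z)"
proof (rule integrableI_bounded)
  show "(\<lambda>\<omega>. \<Prod>i\<in>A. cluster_sum (f i) \<omega> z) \<in> borel_measurable M"
    using assms by (intro borel_measurable_prod measurable_cluster_sum_fixed) (simp add: moments_finite_def)
  have "(\<integral>\<^sup>+\<omega>. ennreal (norm (\<Prod>i\<in>A. cluster_sum (f i) \<omega> z)) \<partial>M) \<le> abs_moment f A z"
    unfolding abs_moment_eq by (intro nn_integral_mono ennreal_leI) (simp add: prod_cluster_sum_bound)
  also have "\<dots> < \<infinity>" using assms by (simp add: moments_finite_def)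
  finally show "(\<integral>\<^sup>+\<omega>. ennreal (norm (\<Prod>i\<in>A. cluster_sum (f i) \<omega> z)) \<partial>M) < \<infinity>" .
qed

lemma abs_cmoment_le:
  assumes "moments_finite f A"
  shows "ennreal \<bar>cmoment f A z\<bar> \<le> abs_moment f A z"
proof -
  have "ennreal \<bar>cmoment f A z\<bar> \<le> (\<integral>\<^sup>+\<omega>. ennreal \<bar>\<Prod>i\<in>A. cluster_sum (f i) \<omega> z\<bar> \<partial>M)"
    unfolding cmoment_def real_norm_def[symmetric]
    by (rule integral_norm_bound_ennreal[OF integrable_prod_cluster_sum[OF assms]])
  also have "\<dots> \<le> abs_moment f A z"
    unfolding abs_moment_eq by (intro nn_integral_mono ennreal_leI prod_cluster_sum_bound)
  finally show ?thesis .
qed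

lemma measurable_cmoment:
  assumes "\<And>i. i \<in> A \<Longrightarrow> f i \<in> borel_measurable borel"
  shows "cmoment f A \<in> borel_measurable borel"
proof -
  have "(\<lambda>(z, \<omega>). \<Prod>i\<in>A. cluster_sum (f i) \<omega> z) \<in> borel_measurable (borel \<Otimes>\<^sub>M M)"
    unfolding case_prod_beta by (intro borel_measurable_prod measurable_cluster_sum assms)
  from borel_measurable_lebesgue_integral[OF this] show ?thesis
    by (simp add: cmoment_def[abs_def])
qed

text \<open>The block B = A of the recursion already bounds the moment from below.\<close>

lemma abs_moment_excessive:
  assumes A: "finite A" "A \<noteq> {}" and f: "\<And>i. i \<in> A \<Longrightarrow> f i \<in> borel_measurable borel"
  shows "(\<integral>\<^sup>+x. abs_moment f A (z + x) \<partial>\<gamma>) \<le> abs_moment f A z"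
proof -
  let ?t = "\<lambda>B. (\<integral>\<^sup>+x. abs_moment f B (z + x) \<partial>\<gamma>) * abs_moment f (A - B) z"
  have "(\<integral>\<^sup>+x. abs_moment f A (z + x) \<partial>\<gamma>) = ?t A"
    by (simp add: abs_moment_def)
  also have "\<dots> \<le> (\<Sum>B | Min A \<in> B \<and> B \<subseteq> A. ?t B)"
    by (rule member_le_sum) (use A in auto)
  also have "\<dots> \<le> abs_moment f A z"
  proof -
    have "abs_moment f A z = ennreal \<bar>f (Min A) z\<bar> * abs_moment f (A - {Min A}) z +
        (\<Sum>B | Min A \<in> B \<and> B \<subseteq> A. ?t B)"
      unfolding abs_moment_def
      by (rule total_moment_rec[OF sets_\<gamma> finite_measure_\<gamma> branching A]) (use f in simp)
    then show ?thesis by (simp add: add_increasing)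
  qed
  finally show ?thesis .
qed

text \<open>Averaging the absolute moment over the position of a child gives at most the absolute
  moment at the parent, which is finite.\<close>

lemma integrable_cmoment_shift:
  assumes f: "moments_finite f A" and A: "A \<noteq> {}"
  shows "integrable \<gamma> (\<lambda>x. cmoment f A (z + x))"
proof (rule integrableI_bounded)
  show "(\<lambda>x. cmoment f A (z + x)) \<in> borel_measurable \<gamma>"
    using f by (intro measurable_\<gamma> measurable_compose[OF _ measurable_cmoment]) (auto simp: moments_finite_def)
  have "(\<integral>\<^sup>+x. ennreal (norm (cmoment f A (z + x))) \<partial>\<gamma>) \<le> (\<integral>\<^sup>+x. abs_moment f A (z + x) \<partial>\<gamma>)"
    by (intro nn_integral_mono) (simp add: abs_cmoment_le[OF f])
  also have "\<dots> \<le> abs_moment f A z"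
    using f A by (intro abs_moment_excessive) (auto simp: moments_finite_def)
  also have "\<dots> < \<infinity>" using f by (simp add: moments_finite_def)
  finally show "(\<integral>\<^sup>+x. ennreal (norm (cmoment f A (z + x))) \<partial>\<gamma>) < \<infinity>" .
qed

lemma cmoment_nonneg: "(\<And>i x. i \<in> A \<Longrightarrow> 0 \<le> f i x) \<Longrightarrow> 0 \<le> cmoment f A z"
  unfolding cmoment_def by (intro integral_nonneg_AE AE_I2 prod_nonneg cluster_sum_nonneg)

lemma abs_moment_eq_cmoment:
  assumes f: "moments_finite f A" and nn: "\<And>i x. i \<in> A \<Longrightarrow> 0 \<le> f i x"
  shows "abs_moment f A z = ennreal (cmoment f A z)"
proof -
  have "abs_moment f A z = (\<integral>\<^sup>+\<omega>. ennreal (\<Prod>i\<in>A. cluster_sum (f i) \<omega> z) \<partial>M)"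
    unfolding abs_moment_eq by (intro nn_integral_cong arg_cong[where f = ennreal] prod.cong refl) (simp add: nn)
  also have "\<dots> = ennreal (cmoment f A z)"
    unfolding cmoment_def
    by (rule nn_integral_eq_integral[OF integrable_prod_cluster_sum[OF f]])
      (intro AE_I2 prod_nonneg cluster_sum_nonneg nn)
  finally show ?thesis .
qed

definition shifted_cmoment :: "(nat \<Rightarrow> 'a \<Rightarrow> real) \<Rightarrow> nat set \<Rightarrow> 'a \<Rightarrow> real" where
  "shifted_cmoment f A z = (\<integral>x. cmoment f A (z + x) \<partial>\<gamma>)"

lemma cmoment_empty [simp]: "cmoment f {} z = 1"
  by (simp add: cmoment_def prob_space)

text \<open>For nonnegative functions every term of the extended recursion is finite and equals the
  corresponding real quantity, so the identity can be read in the reals.\<close>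

lemma cmoment_rec_nonneg:
  assumes f: "moments_finite f A" and A: "A \<noteq> {}" and nn: "\<And>i x. i \<in> A \<Longrightarrow> 0 \<le> f i x"
  shows "cmoment f A z = f (Min A) z * cmoment f (A - {Min A}) z +
    (\<Sum>B | Min A \<in> B \<and> B \<subseteq> A. shifted_cmoment f B z * cmoment f (A - B) z)"
proof -
  have finA: "finite A" using f by (simp add: moments_finite_def)
  then have a: "Min A \<in> A" using A by simp
  have nn': "0 \<le> cmoment f B y" if "B \<subseteq> A" for B y
    by (rule cmoment_nonneg) (use nn that in auto)
  have abs: "total_moment (\<lambda>i x. ennreal \<bar>f i x\<bar>) offspring_family B y = ennreal (cmoment f B y)"
    if "B \<subseteq> A" for B y
    using abs_moment_eq_cmoment[OF moments_finite_subset[OF f that]] nn that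
    unfolding abs_moment_def by blast
  have sh0: "0 \<le> shifted_cmoment f B z" if "B \<subseteq> A" for B
    unfolding shifted_cmoment_def by (intro integral_nonneg_AE AE_I2 nn' that)
  have sh: "(\<integral>\<^sup>+x. total_moment (\<lambda>i x. ennreal \<bar>f i x\<bar>) offspring_family B (z + x) \<partial>\<gamma>) =
      ennreal (shifted_cmoment f B z)" if "B \<subseteq> A" "B \<noteq> {}" for B
    unfolding abs[OF that(1)] shifted_cmoment_def
    by (rule nn_integral_eq_integral[OF integrable_cmoment_shift[OF moments_finite_subset[OF f that(1)] that(2)]])
      (intro AE_I2 nn' that)
  have sub: "A - B \<subseteq> A" for B by auto
  have "ennreal (cmoment f A z) = ennreal (f (Min A) z) * ennreal (cmoment f (A - {Min A}) z) +
      (\<Sum>B | Min A \<in> B \<and> B \<subseteq> A.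
        (\<integral>\<^sup>+x. total_moment (\<lambda>i x. ennreal \<bar>f i x\<bar>) offspring_family B (z + x) \<partial>\<gamma>) * ennreal (cmoment f (A - B) z))"
    using total_moment_rec[OF sets_\<gamma> finite_measure_\<gamma> branching finA A, of "\<lambda>i x. ennreal \<bar>f i x\<bar>" z] f nn a
    unfolding abs[OF subset_refl] abs[OF sub] by (simp add: moments_finite_def)
  also have "(\<Sum>B | Min A \<in> B \<and> B \<subseteq> A.
        (\<integral>\<^sup>+x. total_moment (\<lambda>i x. ennreal \<bar>f i x\<bar>) offspring_family B (z + x) \<partial>\<gamma>) * ennreal (cmoment f (A - B) z)) =
      (\<Sum>B | Min A \<in> B \<and> B \<subseteq> A. ennreal (shifted_cmoment f B z * cmoment f (A - B) z))"
  proof (rule sum.cong[OF refl], elim CollectE conjE)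
    fix B assume B: "Min A \<in> B" "B \<subseteq> A"
    have "B \<noteq> {}" using B(1) by blast
    then show "(\<integral>\<^sup>+x. total_moment (\<lambda>i x. ennreal \<bar>f i x\<bar>) offspring_family B (z + x) \<partial>\<gamma>) * ennreal (cmoment f (A - B) z) =
        ennreal (shifted_cmoment f B z * cmoment f (A - B) z)"
      using sh[OF B(2)] sh0[OF B(2)] nn'[OF sub] by (simp add: ennreal_mult)
  qed
  also have "\<dots> = ennreal (\<Sum>B | Min A \<in> B \<and> B \<subseteq> A. shifted_cmoment f B z * cmoment f (A - B) z)"
    using sh0 nn'[OF sub] by (intro sum_ennreal mult_nonneg_nonneg) auto
  also have "ennreal (f (Min A) z) * ennreal (cmoment f (A - {Min A}) z) + \<dots> =
      ennreal (f (Min A) z * cmoment f (A - {Min A}) z +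
        (\<Sum>B | Min A \<in> B \<and> B \<subseteq> A. shifted_cmoment f B z * cmoment f (A - B) z))"
    using nn[OF a] nn'[OF sub] sh0
    by (subst ennreal_plus) (auto simp: ennreal_mult intro!: sum_nonneg mult_nonneg_nonneg)
  finally show ?thesis
    using nn[OF a] nn'[OF sub] nn'[OF subset_refl] sh0
    by (subst (asm) ennreal_inj) (auto intro!: add_nonneg_nonneg sum_nonneg mult_nonneg_nonneg)
qed

lemma cmoment_cong: "(\<And>i. i \<in> A \<Longrightarrow> f i = g i) \<Longrightarrow> cmoment f A z = cmoment g A z"
  unfolding cmoment_def by (intro Bochner_Integration.integral_cong refl prod.cong) simp

lemma cmoment_diff:
  assumes g: "moments_finite g A" and h: "moments_finite h A"
    and s: "s \<in> A" "f s = (\<lambda>x. g s x - h s x)"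
    and eq: "\<And>i. i \<noteq> s \<Longrightarrow> g i = f i" "\<And>i. i \<noteq> s \<Longrightarrow> h i = f i"
  shows "cmoment f A z = cmoment g A z - cmoment h A z"
proof -
  have finA: "finite A" using g by (simp add: moments_finite_def)
  have "(\<Prod>i\<in>A. cluster_sum (f i) \<omega> z) =
      (\<Prod>i\<in>A. cluster_sum (g i) \<omega> z) - (\<Prod>i\<in>A. cluster_sum (h i) \<omega> z)" for \<omega>
  proof -
    have "(\<Prod>i\<in>A. cluster_sum (k i) \<omega> z) = cluster_sum (k s) \<omega> z * (\<Prod>i\<in>A - {s}. cluster_sum (k i) \<omega> z)" for k
      by (rule prod.remove[OF finA s(1)])
    moreover have "(\<Prod>i\<in>A - {s}. cluster_sum (g i) \<omega> z) = (\<Prod>i\<in>A - {s}. cluster_sum (f i) \<omega> z)"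
      "(\<Prod>i\<in>A - {s}. cluster_sum (h i) \<omega> z) = (\<Prod>i\<in>A - {s}. cluster_sum (f i) \<omega> z)"
      by (intro prod.cong refl; simp add: eq)+
    ultimately show ?thesis
      by (simp add: s(2) cluster_sum_diff left_diff_distrib)
  qed
  then show ?thesis
    unfolding cmoment_def
    by (simp add: Bochner_Integration.integral_diff integrable_prod_cluster_sum[OF g] integrable_prod_cluster_sum[OF h])
qed

text \<open>Both sides of the recursion are linear in each f i separately, so it suffices to split every
  f i into its positive and negative part.\<close>

lemma cmoment_rec:
  assumes f: "moments_finite f A" and A: "A \<noteq> {}"
  shows "cmoment f A z = f (Min A) z * cmoment f (A - {Min A}) z +
    (\<Sum>B | Min A \<in> B \<and> B \<subseteq> A. shifted_cmoment f B z * cmoment f (A - B) z)"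
proof -
  have "cmoment f A z = f (Min A) z * cmoment f (A - {Min A}) z +
    (\<Sum>B | Min A \<in> B \<and> B \<subseteq> A. shifted_cmoment f B z * cmoment f (A - B) z)"
    \<comment> \<open>S contains the indices at which f may change sign; replacing f s by its
      positive or negative part takes s out of S.\<close>
    if "finite S" "S \<subseteq> A" "moments_finite f A" "\<And>i x. i \<in> A - S \<Longrightarrow> 0 \<le> f i x" for S f
    using that
  proof (induction S arbitrary: f)
    case empty
    show ?case by (rule cmoment_rec_nonneg[OF empty.prems(2) A]) (use empty.prems(3) in auto)
  next
    case (insert s S)
    define g where "g = f(s := \<lambda>x. max 0 (f s x))"
    define h where "h = f(s := \<lambda>x. max 0 (- f s x))"
    have s: "s \<in> A" using insert.prems(1) by auto
    have mf: "f i \<in> borel_measurable borel" if "i \<in> A" for i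
      using insert.prems(2) that by (simp add: moments_finite_def)
    have g: "moments_finite g A"
      by (rule moments_finite_mono[OF insert.prems(2)]) (use mf in \<open>auto simp: g_def\<close>)
    have h: "moments_finite h A"
      by (rule moments_finite_mono[OF insert.prems(2)]) (use mf in \<open>auto simp: h_def\<close>)
    have fs: "f s = (\<lambda>x. g s x - h s x)" by (auto simp: g_def h_def max_def)
    have eq: "g i = f i" "h i = f i" if "i \<noteq> s" for i using that by (auto simp: g_def h_def)
    have in1: "cmoment f B y = cmoment g B y - cmoment h B y" if "B \<subseteq> A" "s \<in> B" for B y
      by (rule cmoment_diff[where s = s, OF moments_finite_subset[OF g that(1)] moments_finite_subset[OF h that(1)] that(2), where f = f, OF fs])
        (use eq in auto)
    have out1: "cmoment g B y = cmoment f B y" "cmoment h B y = cmoment f B y" if "s \<notin> B" for B y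
      by (rule cmoment_cong; use eq that in metis)+
    have in2: "shifted_cmoment f B y = shifted_cmoment g B y - shifted_cmoment h B y"
      if B: "B \<subseteq> A" "s \<in> B" for B y
    proof -
      have "B \<noteq> {}" using B(2) by blast
      then show ?thesis
        unfolding shifted_cmoment_def in1[OF B]
        by (intro Bochner_Integration.integral_diff integrable_cmoment_shift moments_finite_subset[OF g B(1)]
            moments_finite_subset[OF h B(1)])
    qed
    have out2: "shifted_cmoment g B y = shifted_cmoment f B y" "shifted_cmoment h B y = shifted_cmoment f B y"
      if "s \<notin> B" for B y
      unfolding shifted_cmoment_def out1[OF that] by (rule refl)+
    let ?R = "\<lambda>f. f (Min A) z * cmoment f (A - {Min A}) z +
      (\<Sum>B | Min A \<in> B \<and> B \<subseteq> A. shifted_cmoment f B z * cmoment f (A - B) z)"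
    have "cmoment g A z = ?R g"
    proof (rule insert.IH[OF _ g])
      show "S \<subseteq> A" using insert.prems(1) by simp
      show "0 \<le> g i x" if "i \<in> A - S" for i x
        using insert.prems(3)[of i x] that by (auto simp: g_def)
    qed
    moreover have "cmoment h A z = ?R h"
    proof (rule insert.IH[OF _ h])
      show "S \<subseteq> A" using insert.prems(1) by simp
      show "0 \<le> h i x" if "i \<in> A - S" for i x
        using insert.prems(3)[of i x] that by (auto simp: h_def)
    qed
    moreover have "f (Min A) z * cmoment f (A - {Min A}) z =
        g (Min A) z * cmoment g (A - {Min A}) z - h (Min A) z * cmoment h (A - {Min A}) z"
    proof (cases "Min A = s")
      case True
      then show ?thesis
        using out1[of "A - {Min A}" z] fs by (simp add: left_diff_distrib)
    next
      case False
      then show ?thesis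
        using in1[of "A - {Min A}" z] s eq[OF False] by (simp add: right_diff_distrib)
    qed
    moreover have "shifted_cmoment f B z * cmoment f (A - B) z =
        shifted_cmoment g B z * cmoment g (A - B) z - shifted_cmoment h B z * cmoment h (A - B) z"
      if "B \<subseteq> A" for B
    proof (cases "s \<in> B")
      case True
      then show ?thesis
        using in2[OF that True] out1[of "A - B" z] by (simp add: left_diff_distrib)
    next
      case False
      then show ?thesis
        using in1[of "A - B" z] out2[OF False] s by (simp add: right_diff_distrib)
    qed
    then have "(\<Sum>B | Min A \<in> B \<and> B \<subseteq> A. shifted_cmoment f B z * cmoment f (A - B) z) =
        (\<Sum>B | Min A \<in> B \<and> B \<subseteq> A. shifted_cmoment g B z * cmoment g (A - B) z) -
        (\<Sum>B | Min A \<in> B \<and> B \<subseteq> A. shifted_cmoment h B z * cmoment h (A - B) z)"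
      unfolding sum_subtractf[symmetric] by (intro sum.cong refl) auto
    ultimately show ?case
      using in1[OF subset_refl s, of z] by linarith
  qed
  from this[of A f] show ?thesis using f by (auto simp: moments_finite_def)
qed

section \<open>Cumulants of cluster sums\<close>

definition ccumulant :: "(nat \<Rightarrow> 'a \<Rightarrow> real) \<Rightarrow> nat set \<Rightarrow> 'a \<Rightarrow> real" where
  "ccumulant f A z = set_cumulant (\<lambda>B. cmoment f B z) A"

lemma cluster_cumulant_eq: "cluster_cumulant M (cluster N X) f A z = ccumulant f A z"
  by (simp add: cluster_cumulant_def joint_cumulant_def ccumulant_def set_cumulant_def cmoment_def cluster_sum_def)

lemma ccumulant_eq_shifted_cmoment:
  assumes f: "moments_finite f A" and A: "2 \<le> card A"
  shows "ccumulant f A z = shifted_cmoment f A z"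
proof -
  \<comment> \<open>The first term of the moment recursion belongs to the block consisting of the
    pivot alone. Attributing it to singletons gives the form required for uniqueness, and it
    vanishes on sets with at least two elements.\<close>
  define c where "c B = shifted_cmoment f B z + (if card B = 1 then f (Min B) z else 0)" for B
  have finA: "finite A" "A \<noteq> {}" using f A by (auto simp: moments_finite_def)
  have "set_cumulant (\<lambda>B. cmoment f B z) A = c A"
  proof (rule set_cumulant_unique[OF finA])
    fix A' assume A': "A' \<subseteq> A" "A' \<noteq> {}"
    have fin: "finite A'" by (rule finite_subset[OF A'(1) finA(1)])
    have a: "Min A' \<in> A'" using fin A'(2) by simp
    have "(\<Sum>B | Min A' \<in> B \<and> B \<subseteq> A'. (if card B = 1 then f (Min B) z else 0) * cmoment f (A' - B) z) =
        (\<Sum>B\<in>{{Min A'}}. f (Min B) z * cmoment f (A' - B) z)"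
    proof (rule sum.mono_neutral_cong_right)
      show "\<forall>B\<in>{B. Min A' \<in> B \<and> B \<subseteq> A'} - {{Min A'}}.
          (if card B = 1 then f (Min B) z else 0) * cmoment f (A' - B) z = 0"
      proof
        fix B assume "B \<in> {B. Min A' \<in> B \<and> B \<subseteq> A'} - {{Min A'}}"
        then have "card B \<noteq> 1" by (auto simp: card_1_singleton_iff)
        then show "(if card B = 1 then f (Min B) z else 0) * cmoment f (A' - B) z = 0" by simp
      qed
    qed (use fin a in auto)
    then have "cmoment f A' z = (\<Sum>B | Min A' \<in> B \<and> B \<subseteq> A'. c B * cmoment f (A' - B) z)"
      using cmoment_rec[OF moments_finite_subset[OF f A'(1)] A'(2), of z]
      by (simp add: c_def distrib_right sum.distrib)
    then show "\<exists>a\<in>A'. cmoment f A' z = (\<Sum>B | a \<in> B \<and> B \<subseteq> A'. c B * cmoment f (A' - B) z)"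
      using a by blast
  qed simp
  then show ?thesis using A by (simp add: ccumulant_def c_def)
qed

lemma cmoment_eq_sum_ccumulant:
  assumes "finite A"
  shows "cmoment f A z = (\<Sum>P | partition_on A P. \<Prod>B\<in>P. ccumulant f B z)"
  unfolding ccumulant_def by (rule moment_eq_sum_cumulants[OF assms]) simp

end

section \<open>Iteration of the offspring kernel\<close>

text \<open>Bounds every summand by the largest one. It serves to pass from moments of the
  individual functions to moments of their sum.\<close>

lemma sum_power_le:
  fixes a :: "'i \<Rightarrow> real"
  assumes "finite A" "\<And>i. i \<in> A \<Longrightarrow> 0 \<le> a i" and p: "1 \<le> p"
  shows "(\<Sum>i\<in>A. a i) ^ p \<le> real (card A) ^ p * (\<Sum>i\<in>A. a i ^ p)"
proof (cases "A = {}")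
  case False
  define m where "m = Max (a ` A)"
  have "m \<in> a ` A" unfolding m_def using assms False by (intro Max_in) auto
  then obtain j where j: "j \<in> A" "m = a j" by blast
  have "a i \<le> a j" if "i \<in> A" for i
    unfolding j(2)[symmetric] m_def using assms(1) that by (intro Max_ge) auto
  then have "(\<Sum>i\<in>A. a i) \<le> real (card A) * a j"
    using sum_bounded_above[of A a "a j"] by simp
  then have "(\<Sum>i\<in>A. a i) ^ p \<le> (real (card A) * a j) ^ p"
    using assms by (intro power_mono sum_nonneg) auto
  also have "\<dots> = real (card A) ^ p * a j ^ p" by (rule power_mult_distrib)
  also have "\<dots> \<le> real (card A) ^ p * (\<Sum>i\<in>A. a i ^ p)"
    using assms j by (intro mult_left_mono member_le_sum) auto
  finally show ?thesis .
qed (use p in \<open>simp add: zero_power\<close>)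

context subcritical_branching
begin

sublocale product_\<gamma>: product_sigma_finite "\<lambda>_ :: nat. \<gamma>"
  by (simp add: product_sigma_finite_def \<gamma>.sigma_finite_measure_axioms)

text \<open>The m-th power of the operator sending \<phi> to the integral of \<phi>(z + y) over
  \<gamma>(dy), written as one integral over a product measure to match the iterated integrals of
  the theorem. For m = 0 it is the identity.\<close>

definition walk_nn :: "nat \<Rightarrow> ('a \<Rightarrow> ennreal) \<Rightarrow> 'a \<Rightarrow> ennreal" where
  "walk_nn m \<phi> z = (\<integral>\<^sup>+x. \<phi> (z + (\<Sum>i\<in>{1..m}. x i)) \<partial>(\<Pi>\<^sub>M i\<in>{1..m}. \<gamma>))"

definition walk :: "nat \<Rightarrow> ('a \<Rightarrow> real) \<Rightarrow> 'a \<Rightarrow> real" where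
  "walk m \<phi> z = (\<integral>x. \<phi> (z + (\<Sum>i\<in>{1..m}. x i)) \<partial>(\<Pi>\<^sub>M i\<in>{1..m}. \<gamma>))"

lemma measurable_walk_position:
  fixes I :: "nat set"
  shows "(\<lambda>x. z + (\<Sum>i\<in>I. x i)) \<in> borel_measurable (\<Pi>\<^sub>M i\<in>I. \<gamma>)"
proof -
  have "(\<lambda>x. x i) \<in> borel_measurable (\<Pi>\<^sub>M i\<in>I. \<gamma>)" if "i \<in> I" for i
    using measurable_component_singleton[OF that, of "\<lambda>_. \<gamma>"] sets_\<gamma> by (simp cong: measurable_cong_sets)
  then show ?thesis by (intro borel_measurable_add borel_measurable_const borel_measurable_sum)
qed

lemma walk_nn_0 [simp]: "walk_nn 0 \<phi> z = \<phi> z"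
  by (simp add: walk_nn_def PiM_empty nn_integral_count_space_finite)

lemma walk_0 [simp]: "walk 0 \<phi> z = \<phi> z"
  by (simp add: walk_def PiM_empty lebesgue_integral_count_space_finite)

lemma walk_nn_mono: "(\<And>w. \<phi> w \<le> \<psi> w) \<Longrightarrow> walk_nn m \<phi> z \<le> walk_nn m \<psi> z"
  unfolding walk_nn_def by (intro nn_integral_mono)

lemma atLeastAtMost_Suc_insert: "{1..Suc m} = insert (Suc m) {1..m}"
  by auto

lemma walk_nn_Suc:
  assumes \<phi>: "\<phi> \<in> borel_measurable borel"
  shows "walk_nn (Suc m) \<phi> z = walk_nn m (\<lambda>w. \<integral>\<^sup>+y. \<phi> (w + y) \<partial>\<gamma>) z"
proof -
  have "walk_nn (Suc m) \<phi> z = (\<integral>\<^sup>+x. (\<integral>\<^sup>+y. \<phi> (z + (\<Sum>i\<in>insert (Suc m) {1..m}. (x(Suc m := y)) i)) \<partial>\<gamma>)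
      \<partial>(\<Pi>\<^sub>M i\<in>{1..m}. \<gamma>))"
    unfolding walk_nn_def atLeastAtMost_Suc_insert
    by (rule product_\<gamma>.product_nn_integral_insert)
      (simp, simp, rule measurable_compose[OF measurable_walk_position \<phi>])
  also have "\<dots> = walk_nn m (\<lambda>w. \<integral>\<^sup>+y. \<phi> (w + y) \<partial>\<gamma>) z"
    unfolding walk_nn_def
  proof (intro nn_integral_cong)
    fix x :: "nat \<Rightarrow> 'a" and y
    have "(\<Sum>i\<in>insert (Suc m) {1..m}. (x(Suc m := y)) i) = y + (\<Sum>i\<in>{1..m}. x i)"
      by (subst sum.insert) (auto intro!: sum.cong)
    then show "\<phi> (z + (\<Sum>i\<in>insert (Suc m) {1..m}. (x(Suc m := y)) i)) = \<phi> (z + (\<Sum>i\<in>{1..m}. x i) + y)"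
      by (simp add: add_ac)
  qed
  finally show ?thesis .
qed

lemma walk_Suc:
  assumes "integrable (\<Pi>\<^sub>M i\<in>{1..Suc m}. \<gamma>) (\<lambda>x. \<phi> (z + (\<Sum>i\<in>{1..Suc m}. x i)))"
  shows "walk (Suc m) \<phi> z = walk m (\<lambda>w. \<integral>y. \<phi> (w + y) \<partial>\<gamma>) z"
proof -
  have "walk (Suc m) \<phi> z = (\<integral>x. (\<integral>y. \<phi> (z + (\<Sum>i\<in>insert (Suc m) {1..m}. (x(Suc m := y)) i)) \<partial>\<gamma>)
      \<partial>(\<Pi>\<^sub>M i\<in>{1..m}. \<gamma>))"
    unfolding walk_def atLeastAtMost_Suc_insert
    by (rule product_\<gamma>.product_integral_insert)
      (simp, simp, use assms in \<open>simp only: atLeastAtMost_Suc_insert\<close>)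
  also have "\<dots> = walk m (\<lambda>w. \<integral>y. \<phi> (w + y) \<partial>\<gamma>) z"
    unfolding walk_def
  proof (intro Bochner_Integration.integral_cong refl)
    fix x :: "nat \<Rightarrow> 'a" and y
    have "(\<Sum>i\<in>insert (Suc m) {1..m}. (x(Suc m := y)) i) = y + (\<Sum>i\<in>{1..m}. x i)"
      by (subst sum.insert) (auto intro!: sum.cong)
    then show "\<phi> (z + (\<Sum>i\<in>insert (Suc m) {1..m}. (x(Suc m := y)) i)) = \<phi> (z + (\<Sum>i\<in>{1..m}. x i) + y)"
      by (simp add: add_ac)
  qed
  finally show ?thesis .
qed

lemma walk_nn_excessive:
  assumes \<phi>: "\<phi> \<in> borel_measurable borel" and ex: "\<And>w. (\<integral>\<^sup>+y. \<phi> (w + y) \<partial>\<gamma>) \<le> \<phi> w"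
  shows "walk_nn m \<phi> z \<le> \<phi> z"
proof (induction m)
  case (Suc m)
  have "walk_nn (Suc m) \<phi> z \<le> walk_nn m \<phi> z"
    unfolding walk_nn_Suc[OF \<phi>] by (rule walk_nn_mono) (rule ex)
  then show ?case using Suc by (rule order_trans)
qed simp

lemma walk_nn_const: "walk_nn m (\<lambda>_. c) z = c * emeasure \<gamma> UNIV ^ m"
proof (induction m arbitrary: c)
  case (Suc m)
  then show ?case by (simp add: walk_nn_Suc space_\<gamma> mult.assoc)
qed simp

end

section \<open>Power moments of a dominating cluster sum\<close>

locale dominated_branching = subcritical_branching M \<gamma> N X
  for M :: "'w measure" and \<gamma> :: "'a::euclidean_space measure" and N X +
  fixes g :: "'a \<Rightarrow> real"
  assumes g_measurable: "g \<in> borel_measurable borel" and g_nonneg: "\<And>x. 0 \<le> g x"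
    and g_moments: "\<And>p z. 1 \<le> p \<Longrightarrow> integrable M (\<lambda>\<omega>. cluster_sum g \<omega> z ^ p)"
begin

definition power_moment :: "nat \<Rightarrow> 'a \<Rightarrow> real" where
  "power_moment p z = (\<integral>\<omega>. cluster_sum g \<omega> z ^ p \<partial>M)"

lemma integrable_power: "integrable M (\<lambda>\<omega>. cluster_sum g \<omega> z ^ p)"
  using g_moments[of p z] by (cases "p = 0") auto

lemma cluster_sum_g_nonneg: "0 \<le> cluster_sum g \<omega> z"
  by (rule cluster_sum_nonneg) (rule g_nonneg)

lemma power_moment_nonneg: "0 \<le> power_moment p z"
  unfolding power_moment_def by (simp add: cluster_sum_g_nonneg)

lemma power_moment_0 [simp]: "power_moment 0 z = 1"
  by (simp add: power_moment_def prob_space)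

lemma ennreal_power_moment: "ennreal (power_moment p z) = (\<integral>\<^sup>+\<omega>. ennreal (cluster_sum g \<omega> z ^ p) \<partial>M)"
  unfolding power_moment_def
  by (rule nn_integral_eq_integral[symmetric, OF integrable_power]) (simp add: cluster_sum_g_nonneg)

text \<open>A power is a product over p copies of g, so the results on products, in particular the
  inequality for averages over children, apply to power moments.\<close>

lemma abs_moment_power_moment: "abs_moment (\<lambda>_. g) {..<p} z = ennreal (power_moment p z)"
  by (simp add: abs_moment_eq ennreal_power_moment g_nonneg)

lemma measurable_power_moment: "power_moment p \<in> borel_measurable borel"
proof -
  have "(\<lambda>(z, \<omega>). cluster_sum g \<omega> z ^ p) \<in> borel_measurable (borel \<Otimes>\<^sub>M M)"
    unfolding case_prod_beta by (intro borel_measurable_power measurable_cluster_sum g_measurable)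
  from borel_measurable_lebesgue_integral[OF this] show ?thesis
    by (simp add: power_moment_def[abs_def])
qed

text \<open>Chebyshev's inequality (T^a - c^a)(T^b - c^b) \<ge> 0 with c^a = E T^a.\<close>

lemma power_moment_mult_le: "power_moment a z * power_moment b z \<le> power_moment (a + b) z"
proof (cases "a = 0")
  case False
  define c where "c = root a (power_moment a z)"
  have c: "0 \<le> c" "c ^ a = power_moment a z"
    using False power_moment_nonneg by (auto simp: c_def real_root_pow_pos2)
  have "0 \<le> (\<integral>\<omega>. (cluster_sum g \<omega> z ^ a - c ^ a) * (cluster_sum g \<omega> z ^ b - c ^ b) \<partial>M)"
  proof (intro integral_nonneg_AE AE_I2)
    fix \<omega>
    show "0 \<le> (cluster_sum g \<omega> z ^ a - c ^ a) * (cluster_sum g \<omega> z ^ b - c ^ b)"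
    proof (cases "c \<le> cluster_sum g \<omega> z")
      case True
      then show ?thesis
        using c(1) by (intro mult_nonneg_nonneg) (simp_all add: power_mono)
    next
      case False
      then show ?thesis
        using cluster_sum_g_nonneg[of \<omega> z] by (intro mult_nonpos_nonpos) (simp_all add: power_mono)
    qed
  qed
  also have "\<dots> = (\<integral>\<omega>. cluster_sum g \<omega> z ^ (a + b) - c ^ a * cluster_sum g \<omega> z ^ b
      - c ^ b * cluster_sum g \<omega> z ^ a + c ^ a * c ^ b \<partial>M)"
    by (intro Bochner_Integration.integral_cong refl) (simp add: algebra_simps power_add)
  also have "\<dots> = power_moment (a + b) z - c ^ a * power_moment b z - c ^ b * power_moment a z + c ^ a * c ^ b"
    unfolding power_moment_def by (simp add: integrable_power prob_space)
  \<comment> \<open>The last two terms cancel because \<open>c ^ a\<close> is the a-th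
    moment.\<close>
  finally show ?thesis using c(2) by (simp add: algebra_simps)
qed simp

lemma prod_power_moment_le:
  assumes "finite P"
  shows "(\<Prod>B\<in>P. power_moment (k B) z) \<le> power_moment (\<Sum>B\<in>P. k B) z"
  using assms
proof (induction P)
  case (insert B P)
  then have "(\<Prod>B\<in>insert B P. power_moment (k B) z) \<le> power_moment (k B) z * power_moment (\<Sum>B\<in>P. k B) z"
    by (simp add: mult_left_mono power_moment_nonneg)
  also have "\<dots> \<le> power_moment (\<Sum>B\<in>insert B P. k B) z"
    using insert power_moment_mult_le by simp
  finally show ?case .
qed simp

text \<open>Its square is the midpoint of the mass of \<gamma> and 1. It is thus at least the mass,
  less than 1, and positive even if \<gamma> vanishes, so that dividing by powers of it is
  legitimate.\<close>

definition rate :: real where "rate = sqrt ((1 + measure \<gamma> UNIV) / 2)"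

lemma rate: "0 < rate" "rate < 1" "measure \<gamma> UNIV \<le> rate ^ 2"
proof -
  have q: "measure \<gamma> UNIV < 1"
    using mass_less_1 by (simp add: \<gamma>.emeasure_eq_measure ennreal_less_one_iff)
  have "0 \<le> measure \<gamma> UNIV" by simp
  with q show "0 < rate" "rate < 1" "measure \<gamma> UNIV \<le> rate ^ 2"
    unfolding rate_def by (simp_all add: add_pos_nonneg)
qed

text \<open>The mass of the m-th convolution power decays geometrically. Trading half of this decay for a
  higher moment, via t \<le> c + t^2 / c with c = rate^(-m), makes the moments themselves decay.\<close>

lemma walk_nn_power_moment_le:
  assumes p: "1 \<le> p"
  shows "walk_nn m (\<lambda>w. ennreal (power_moment p w)) z \<le> ennreal (rate ^ m * (1 + power_moment (2 * p) z))"
proof -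
  define c where "c = 1 / rate ^ m"
  have c: "0 < c" using rate by (simp add: c_def)
  have split: "power_moment p w \<le> c + rate ^ m * power_moment (2 * p) w" for w
  proof -
    have le: "t \<le> c + rate ^ m * t ^ 2" if "0 \<le> t" for t :: real
    proof (cases "t \<le> c")
      case True
      then show ?thesis using rate(1) by (simp add: add_increasing2)
    next
      case False
      then have "1 \<le> rate ^ m * t" using rate(1) by (simp add: c_def field_simps)
      then have "t \<le> rate ^ m * t * t" using that mult_right_mono[of 1 "rate ^ m * t" t] by simp
      then show ?thesis using c by (simp add: power2_eq_square mult.assoc)
    qed
    have "power_moment p w \<le> (\<integral>\<omega>. c + rate ^ m * cluster_sum g \<omega> w ^ (2 * p) \<partial>M)"
      unfolding power_moment_def
    proof (rule integral_mono)
      show "integrable M (\<lambda>\<omega>. c + rate ^ m * cluster_sum g \<omega> w ^ (2 * p))"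
        by (intro Bochner_Integration.integrable_add integrable_mult_right integrable_power) simp
      show "cluster_sum g \<omega> w ^ p \<le> c + rate ^ m * cluster_sum g \<omega> w ^ (2 * p)" for \<omega>
        unfolding power_even_eq using cluster_sum_g_nonneg by (intro le) simp
    qed (rule integrable_power)
    then show ?thesis by (simp add: power_moment_def integrable_power prob_space)
  qed
  have meas: "(\<lambda>w. ennreal (power_moment (2 * p) w)) \<in> borel_measurable borel"
    using measurable_power_moment by simp
  have "walk_nn m (\<lambda>w. ennreal (power_moment p w)) z \<le>
      walk_nn m (\<lambda>w. ennreal c + ennreal (rate ^ m) * ennreal (power_moment (2 * p) w)) z"
    using c rate(1) power_moment_nonneg split
    by (intro walk_nn_mono) (simp add: ennreal_mult[symmetric] ennreal_plus[symmetric] del: ennreal_plus)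
  also have "\<dots> = walk_nn m (\<lambda>_. ennreal c) z + ennreal (rate ^ m) * walk_nn m (\<lambda>w. ennreal (power_moment (2 * p) w)) z"
    unfolding walk_nn_def
    using measurable_compose[OF measurable_walk_position meas]
    by (subst nn_integral_add) (auto simp: nn_integral_cmult)
  also have "walk_nn m (\<lambda>_. ennreal c) z = ennreal (c * measure \<gamma> UNIV ^ m)"
    using c by (simp add: walk_nn_const \<gamma>.emeasure_eq_measure ennreal_power ennreal_mult)
  also have "walk_nn m (\<lambda>w. ennreal (power_moment (2 * p) w)) z \<le> ennreal (power_moment (2 * p) z)"
  proof (rule walk_nn_excessive[OF meas])
    show "(\<integral>\<^sup>+y. ennreal (power_moment (2 * p) (w + y)) \<partial>\<gamma>) \<le> ennreal (power_moment (2 * p) w)" for w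
      unfolding abs_moment_power_moment[symmetric]
      by (rule abs_moment_excessive) (use p g_measurable in \<open>auto simp: lessThan_empty_iff\<close>)
  qed
  \<comment> \<open>Here the square pays off: the constant c grows like \<open>rate\<close> to the
    power -m, while the mass contributes at most \<open>rate\<close> to the power 2 m.\<close>
  also have "ennreal (c * measure \<gamma> UNIV ^ m) \<le> ennreal (rate ^ m)"
  proof (rule ennreal_leI)
    have "c * measure \<gamma> UNIV ^ m \<le> c * (rate ^ 2) ^ m"
      using rate c by (intro mult_left_mono power_mono) auto
    also have "\<dots> = rate ^ m"
      using rate(1) by (simp add: c_def power2_eq_square power_mult_distrib)
    finally show "c * measure \<gamma> UNIV ^ m \<le> rate ^ m" .
  qed
  finally have "walk_nn m (\<lambda>w. ennreal (power_moment p w)) z \<le>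
      ennreal (rate ^ m) + ennreal (rate ^ m) * ennreal (power_moment (2 * p) z)"
    by (simp add: add_mono mult_left_mono)
  also have "\<dots> = ennreal (rate ^ m * (1 + power_moment (2 * p) z))"
    using rate(1) power_moment_nonneg by (simp add: ennreal_mult[symmetric] ennreal_plus[symmetric] distrib_left del: ennreal_plus)
  finally show ?thesis .
qed

definition dominated :: "nat \<Rightarrow> real \<Rightarrow> ('a \<Rightarrow> real) \<Rightarrow> bool" where
  "dominated p C \<phi> \<longleftrightarrow> 1 \<le> p \<and> 0 \<le> C \<and> \<phi> \<in> borel_measurable borel \<and> (\<forall>w. \<bar>\<phi> w\<bar> \<le> C * power_moment p w)"

lemma dominated_walk:
  assumes "dominated p C \<phi>"
  shows "integrable (\<Pi>\<^sub>M i\<in>{1..m}. \<gamma>) (\<lambda>x. \<phi> (z + (\<Sum>i\<in>{1..m}. x i)))"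
    and "\<bar>walk m \<phi> z\<bar> \<le> C * (1 + power_moment (2 * p) z) * rate ^ m"
proof -
  have p: "1 \<le> p" and C: "0 \<le> C" and meas: "\<phi> \<in> borel_measurable borel"
    and le: "\<And>w. \<bar>\<phi> w\<bar> \<le> C * power_moment p w"
    using assms by (auto simp: dominated_def)
  let ?P = "\<Pi>\<^sub>M i\<in>{1..m}. \<gamma>"
  have "(\<integral>\<^sup>+x. ennreal (norm (\<phi> (z + (\<Sum>i\<in>{1..m}. x i)))) \<partial>?P) \<le>
      walk_nn m (\<lambda>w. ennreal C * ennreal (power_moment p w)) z"
    unfolding walk_nn_def using le C power_moment_nonneg
    by (intro nn_integral_mono) (simp add: ennreal_mult[symmetric])
  also have "\<dots> = ennreal C * walk_nn m (\<lambda>w. ennreal (power_moment p w)) z"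
    unfolding walk_nn_def
    using measurable_compose[OF measurable_walk_position measurable_power_moment]
    by (intro nn_integral_cmult) auto
  also have "\<dots> \<le> ennreal C * ennreal (rate ^ m * (1 + power_moment (2 * p) z))"
    by (intro mult_left_mono walk_nn_power_moment_le p) simp
  also have "\<dots> = ennreal (C * (1 + power_moment (2 * p) z) * rate ^ m)"
    using C by (simp add: ennreal_mult'[symmetric] mult_ac)
  finally have bound: "(\<integral>\<^sup>+x. ennreal (norm (\<phi> (z + (\<Sum>i\<in>{1..m}. x i)))) \<partial>?P) \<le>
      ennreal (C * (1 + power_moment (2 * p) z) * rate ^ m)" .
  show int: "integrable ?P (\<lambda>x. \<phi> (z + (\<Sum>i\<in>{1..m}. x i)))"
    by (rule integrableI_bounded)
      (use measurable_compose[OF measurable_walk_position meas] le_less_trans[OF bound] in auto)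
  have "ennreal \<bar>walk m \<phi> z\<bar> \<le> ennreal (C * (1 + power_moment (2 * p) z) * rate ^ m)"
    unfolding walk_def real_norm_def[symmetric]
    by (rule order_trans[OF integral_norm_bound_ennreal[OF int] bound])
  then show "\<bar>walk m \<phi> z\<bar> \<le> C * (1 + power_moment (2 * p) z) * rate ^ m"
    using C rate(1) power_moment_nonneg[of "2 * p" z] by (subst (asm) ennreal_le_iff) auto
qed

lemma dominated_walk_tendsto_0:
  assumes "dominated p C \<phi>"
  shows "(\<lambda>m. walk m \<phi> z) \<longlonglongrightarrow> 0"
proof (rule Lim_null_comparison)
  show "\<forall>\<^sub>F m in sequentially. norm (walk m \<phi> z) \<le> C * (1 + power_moment (2 * p) z) * rate ^ m"
    using dominated_walk(2)[OF assms] by simp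
  show "(\<lambda>m. C * (1 + power_moment (2 * p) z) * rate ^ m) \<longlonglongrightarrow> 0"
    by (intro tendsto_mult_right_zero LIMSEQ_realpow_zero) (use rate in auto)
qed

lemma dominated_walk_summable:
  assumes "dominated p C \<phi>"
  shows "summable (\<lambda>m. walk (Suc m) \<phi> z)"
proof (rule summable_comparison_test[OF exI[of _ 0]], intro allI impI)
  show "summable (\<lambda>m. C * (1 + power_moment (2 * p) z) * rate ^ Suc m)"
    using rate by (intro summable_mult summable_geometric summable_Suc_iff[THEN iffD2]) auto
  show "norm (walk (Suc m) \<phi> z) \<le> C * (1 + power_moment (2 * p) z) * rate ^ Suc m" for m
    using dominated_walk(2)[OF assms, of "Suc m"] by simp
qed

context
  fixes f :: "nat \<Rightarrow> 'a \<Rightarrow> real" and A :: "nat set"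
  assumes finA: "finite A" and f_measurable: "\<And>i. i \<in> A \<Longrightarrow> f i \<in> borel_measurable borel"
    and f_le_g: "\<And>i x. i \<in> A \<Longrightarrow> \<bar>f i x\<bar> \<le> g x"
begin

lemma abs_moment_le_power_moment:
  assumes "B \<subseteq> A"
  shows "abs_moment f B z \<le> ennreal (power_moment (card B) z)"
proof -
  have "(\<Prod>i\<in>B. cluster_sum (\<lambda>x. \<bar>f i x\<bar>) \<omega> z) \<le> (\<Prod>i\<in>B. cluster_sum g \<omega> z)" for \<omega>
    using assms f_le_g by (intro prod_mono conjI cluster_sum_nonneg cluster_sum_mono) auto
  then show ?thesis
    unfolding abs_moment_eq ennreal_power_moment by (intro nn_integral_mono ennreal_leI) simp
qed

lemma moments_finite_f: "moments_finite f A"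
  unfolding moments_finite_def
  using finA f_measurable le_less_trans[OF abs_moment_le_power_moment] by auto

lemma abs_cmoment_le_power_moment:
  assumes "B \<subseteq> A"
  shows "\<bar>cmoment f B z\<bar> \<le> power_moment (card B) z"
  using order_trans[OF abs_cmoment_le[OF moments_finite_subset[OF moments_finite_f assms]]
      abs_moment_le_power_moment[OF assms], of z] power_moment_nonneg
  by (simp add: ennreal_le_iff)

text \<open>The sum of the absolute values of the coefficients in the cumulant formula.\<close>

definition cumulant_bound :: "nat set \<Rightarrow> real" where
  "cumulant_bound B = (\<Sum>P | partition_on B P. fact (card P - 1))"

text \<open>Each term of the cumulant is a product of moments whose orders are the block sizes. By
  supermultiplicativity of power moments it is at most the moment of the total order, which is
  \<open>card B\<close> for every partition.\<close>

lemma dominated_ccumulant: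
  assumes B: "B \<subseteq> A" "B \<noteq> {}"
  shows "dominated (card B) (cumulant_bound B) (ccumulant f B)"
proof -
  have finB: "finite B" by (rule finite_subset[OF B(1) finA])
  have alt: "ccumulant f B w = (\<Sum>P | partition_on B P.
      fact (card P - 1) * (-1) ^ (card P - 1) * (\<Prod>C\<in>P. cmoment f C w))" for w
    unfolding ccumulant_def by (rule set_cumulant_alt[OF finB B(2)])
  have "cmoment f C \<in> borel_measurable borel" if "C \<subseteq> A" for C
    by (rule measurable_cmoment) (use f_measurable that in auto)
  then have "ccumulant f B \<in> borel_measurable borel"
    unfolding alt[abs_def]
    using B by (intro borel_measurable_sum borel_measurable_times borel_measurable_const borel_measurable_prod)
      (auto simp: partition_on_def)
  moreover have "\<bar>ccumulant f B w\<bar> \<le> cumulant_bound B * power_moment (card B) w" for w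
  proof -
    have "\<bar>ccumulant f B w\<bar> \<le> (\<Sum>P | partition_on B P. fact (card P - 1) * power_moment (card B) w)"
      unfolding alt
    proof (rule order_trans[OF sum_abs], rule sum_mono, clarify)
      fix P assume P: "partition_on B P"
      have finP: "finite P" by (rule finite_elements[OF finB P])
      have "\<bar>\<Prod>C\<in>P. cmoment f C w\<bar> \<le> (\<Prod>C\<in>P. power_moment (card C) w)"
        unfolding abs_prod
        using P B by (intro prod_mono conjI abs_cmoment_le_power_moment) (auto simp: partition_on_def)
      also have "\<dots> \<le> power_moment (\<Sum>C\<in>P. card C) w"
        by (rule prod_power_moment_le[OF finP])
      also have "(\<Sum>C\<in>P. card C) = card B"
        by (rule product_partition[symmetric, OF P])
          (use P finB in \<open>auto simp: partition_on_def intro: finite_subset\<close>)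
      finally show "\<bar>fact (card P - 1) * (- 1) ^ (card P - 1) * (\<Prod>C\<in>P. cmoment f C w)\<bar> \<le>
          fact (card P - 1) * power_moment (card B) w"
        by (simp add: abs_mult power_abs)
    qed
    then show ?thesis by (simp add: cumulant_bound_def sum_distrib_right)
  qed
  moreover have "1 \<le> card B" using finB B(2) by (simp add: Suc_le_eq card_gt_0_iff)
  moreover have "0 \<le> cumulant_bound B" unfolding cumulant_bound_def by (intro sum_nonneg) simp
  ultimately show ?thesis by (simp add: dominated_def)
qed

text \<open>Supermultiplicativity once more: the orders of the blocks add up to
  \<open>card A\<close>, so all products over partitions of A share one order of domination.\<close>

lemma dominated_prod_ccumulant:
  assumes P: "partition_on A P" and A: "A \<noteq> {}"
  shows "dominated (card A) (\<Prod>B\<in>P. cumulant_bound B) (\<lambda>w. \<Prod>B\<in>P. ccumulant f B w)"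
proof -
  have finP: "finite P" by (rule finite_elements[OF finA P])
  have dom: "dominated (card B) (cumulant_bound B) (ccumulant f B)" if "B \<in> P" for B
    by (rule dominated_ccumulant) (use that P in \<open>auto simp: partition_on_def\<close>)
  have "\<bar>\<Prod>B\<in>P. ccumulant f B w\<bar> \<le> (\<Prod>B\<in>P. cumulant_bound B) * power_moment (card A) w" for w
  proof -
    have "\<bar>\<Prod>B\<in>P. ccumulant f B w\<bar> \<le> (\<Prod>B\<in>P. cumulant_bound B * power_moment (card B) w)"
      unfolding abs_prod using dom by (intro prod_mono) (auto simp: dominated_def)
    also have "\<dots> = (\<Prod>B\<in>P. cumulant_bound B) * (\<Prod>B\<in>P. power_moment (card B) w)"
      by (rule prod.distrib)
    also have "\<dots> \<le> (\<Prod>B\<in>P. cumulant_bound B) * power_moment (\<Sum>B\<in>P. card B) w"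
      using dom by (intro mult_left_mono prod_power_moment_le[OF finP] prod_nonneg) (auto simp: dominated_def)
    also have "(\<Sum>B\<in>P. card B) = card A"
      by (rule product_partition[symmetric, OF P])
        (use P finA in \<open>auto simp: partition_on_def intro: finite_subset\<close>)
    finally show ?thesis .
  qed
  moreover have "1 \<le> card A" using finA A by (simp add: Suc_le_eq card_gt_0_iff)
  ultimately show ?thesis
    using dom unfolding dominated_def by (auto intro!: prod_nonneg borel_measurable_prod)
qed

lemma ccumulant_step:
  assumes A: "2 \<le> card A"
  shows "ccumulant f A w = (\<integral>y. ccumulant f A (w + y) +
    (\<Sum>P | partition_on A P \<and> 2 \<le> card P. \<Prod>B\<in>P. ccumulant f B (w + y)) \<partial>\<gamma>)"
proof -
  have ne: "A \<noteq> {}" using A by auto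
  have fin: "finite {P. partition_on A P}" by (rule finitely_many_partition_on[OF finA])
  \<comment> \<open>The partition into a single block contributes the cumulant of A itself, the part
    to which the identity is applied again.\<close>
  have split: "{P. partition_on A P} = insert {A} {P. partition_on A P \<and> 2 \<le> card P}"
  proof (intro set_eqI)
    fix P
    show "P \<in> {P. partition_on A P} \<longleftrightarrow> P \<in> insert {A} {P. partition_on A P \<and> 2 \<le> card P}"
      using partition_on_card_1[OF finA ne, of P] card_partition_on_pos[OF finA _ ne, of P]
        partition_on_space[OF ne] by (cases "card P = 1") auto
  qed
  have "cmoment f A y = ccumulant f A y +
      (\<Sum>P | partition_on A P \<and> 2 \<le> card P. \<Prod>B\<in>P. ccumulant f B y)" for y
    unfolding cmoment_eq_sum_ccumulant[OF finA] split
    by (subst sum.insert) (use fin split in \<open>auto intro: finite_subset\<close>)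
  then show ?thesis
    using ccumulant_eq_shifted_cmoment[OF moments_finite_f A, of w] by (simp add: shifted_cmoment_def)
qed

theorem ccumulant_sums:
  assumes A: "2 \<le> card A"
  shows "ccumulant f A z = (\<Sum>P | partition_on A P \<and> 2 \<le> card P.
    \<Sum>m. walk (Suc m) (\<lambda>w. \<Prod>B\<in>P. ccumulant f B w) z)"
proof -
  have ne: "A \<noteq> {}" using A by auto
  define Q where "Q = {P. partition_on A P \<and> 2 \<le> card P}"
  define \<phi> where "\<phi> P w = (\<Prod>B\<in>P. ccumulant f B w)" for P w
  have dom: "dominated (card A) (\<Prod>B\<in>P. cumulant_bound B) (\<phi> P)" if "P \<in> Q" for P
    using dominated_prod_ccumulant[OF _ ne] that unfolding Q_def \<phi>_def[abs_def] by simp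
  note dom' = dominated_ccumulant[OF subset_refl ne]
  \<comment> \<open>Integrability against the product measure justifies both merging the inner
    integral into the walk and splitting the sum over partitions.\<close>
  have step: "walk m (ccumulant f A) z - walk (Suc m) (ccumulant f A) z = (\<Sum>P\<in>Q. walk (Suc m) (\<phi> P) z)" for m
  proof -
    let ?P = "\<Pi>\<^sub>M i\<in>{1..Suc m}. \<gamma>" and ?s = "\<lambda>x. z + (\<Sum>i\<in>{1..Suc m}. x i)"
    have int: "integrable ?P (\<lambda>x. ccumulant f A (?s x))" "\<And>P. P \<in> Q \<Longrightarrow> integrable ?P (\<lambda>x. \<phi> P (?s x))"
      using dominated_walk(1)[OF dom'] dominated_walk(1)[OF dom] by blast+
    have "walk m (ccumulant f A) z = walk m (\<lambda>w. \<integral>y. ccumulant f A (w + y) + (\<Sum>P\<in>Q. \<phi> P (w + y)) \<partial>\<gamma>) z"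
      by (subst ccumulant_step[OF A, abs_def]) (simp add: Q_def \<phi>_def)
    also have "\<dots> = walk (Suc m) (\<lambda>w. ccumulant f A w + (\<Sum>P\<in>Q. \<phi> P w)) z"
      using int by (intro walk_Suc[symmetric] Bochner_Integration.integrable_add Bochner_Integration.integrable_sum)
    also have "\<dots> = walk (Suc m) (ccumulant f A) z + (\<Sum>P\<in>Q. walk (Suc m) (\<phi> P) z)"
      unfolding walk_def using int
      by (subst Bochner_Integration.integral_add) (auto intro: Bochner_Integration.integrable_sum simp: Bochner_Integration.integral_sum)
    finally show ?thesis by simp
  qed
  have "(\<lambda>L. ccumulant f A z - walk L (ccumulant f A) z) \<longlonglongrightarrow> ccumulant f A z - 0"
    by (intro tendsto_diff tendsto_const dominated_walk_tendsto_0[OF dom'])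
  moreover have "(\<Sum>m<L. \<Sum>P\<in>Q. walk (Suc m) (\<phi> P) z) = ccumulant f A z - walk L (ccumulant f A) z" for L
    unfolding step[symmetric]
    using sum_lessThan_telescope'[of "\<lambda>m. walk m (ccumulant f A) z" L] by simp
  ultimately have "(\<lambda>m. \<Sum>P\<in>Q. walk (Suc m) (\<phi> P) z) sums ccumulant f A z"
    unfolding sums_def by simp
  \<comment> \<open>Domination makes the series of each partition converge separately, so the finite
    sum over partitions may be moved outside.\<close>
  moreover have "(\<lambda>m. \<Sum>P\<in>Q. walk (Suc m) (\<phi> P) z) sums (\<Sum>P\<in>Q. \<Sum>m. walk (Suc m) (\<phi> P) z)"
    by (intro sums_sum summable_sums dominated_walk_summable[OF dom])
  ultimately have "ccumulant f A z = (\<Sum>P\<in>Q. \<Sum>m. walk (Suc m) (\<phi> P) z)"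
    by (rule sums_unique2)
  then show ?thesis by (simp add: Q_def \<phi>_def[abs_def])
qed

end

end

text \<open>The moment hypothesis concerns each function separately, whereas domination uses their
  sum; the power of a sum is bounded by a constant times the sum of the powers.\<close>

lemma (in subcritical_branching) integrable_power_sum_cluster_sum:
  fixes h :: "'i \<Rightarrow> 'a \<Rightarrow> real"
  assumes A: "finite A" and h: "\<And>i. i \<in> A \<Longrightarrow> h i \<in> borel_measurable borel" "\<And>i x. 0 \<le> h i x"
    and p: "1 \<le> p" and int: "\<And>i. i \<in> A \<Longrightarrow> integrable M (\<lambda>\<omega>. cluster_sum (h i) \<omega> z ^ p)"
  shows "integrable M (\<lambda>\<omega>. cluster_sum (\<lambda>x. \<Sum>i\<in>A. h i x) \<omega> z ^ p)"
proof (rule Bochner_Integration.integrable_bound)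
  show "integrable M (\<lambda>\<omega>. real (card A) ^ p * (\<Sum>i\<in>A. cluster_sum (h i) \<omega> z ^ p))"
    by (intro integrable_mult_right Bochner_Integration.integrable_sum int)
  show "(\<lambda>\<omega>. cluster_sum (\<lambda>x. \<Sum>i\<in>A. h i x) \<omega> z ^ p) \<in> borel_measurable M"
    by (intro borel_measurable_power measurable_cluster_sum_fixed borel_measurable_sum h(1))
  have eq: "cluster_sum (\<lambda>x. \<Sum>i\<in>A. h i x) \<omega> z = (\<Sum>i\<in>A. cluster_sum (h i) \<omega> z)" for \<omega>
    by (cases "finite_tree \<omega>")
      (simp_all add: cluster_sum_finite_tree cluster_sum_not_finite_tree sum.swap[of _ A])
  have nn: "0 \<le> cluster_sum (h i) \<omega> z" for i \<omega> by (rule cluster_sum_nonneg) (rule h(2))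
  show "AE \<omega> in M. norm (cluster_sum (\<lambda>x. \<Sum>i\<in>A. h i x) \<omega> z ^ p) \<le>
      norm (real (card A) ^ p * (\<Sum>i\<in>A. cluster_sum (h i) \<omega> z ^ p))"
  proof (rule AE_I2)
    fix \<omega>
    have "(\<Sum>i\<in>A. cluster_sum (h i) \<omega> z) ^ p \<le> real (card A) ^ p * (\<Sum>i\<in>A. cluster_sum (h i) \<omega> z ^ p)"
      by (rule sum_power_le[OF A nn p])
    then show "norm (cluster_sum (\<lambda>x. \<Sum>i\<in>A. h i x) \<omega> z ^ p) \<le>
        norm (real (card A) ^ p * (\<Sum>i\<in>A. cluster_sum (h i) \<omega> z ^ p))"
      unfolding eq using nn by (simp add: sum_nonneg)
  qed
qed

text \<open>Integrals and infinite sums are total operations, so the formula alone would not express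
  convergence; integrability and summability are therefore asserted along with it. The series index
  starts at 0, hence \<open>Suc m\<close> displacements.\<close>

theorem proposition3p5:
  fixes M :: "'w measure"
    and \<gamma> :: "(real ^ 'd) measure"
    and N :: "nat list \<Rightarrow> 'w \<Rightarrow> nat"
    and X :: "nat list \<Rightarrow> nat \<Rightarrow> 'w \<Rightarrow> real ^ 'd"
    and \<xi> :: "'w \<Rightarrow> (real ^ 'd) multiset"
    and f :: "nat \<Rightarrow> real ^ 'd \<Rightarrow> real"
    and n :: nat
  defines "\<xi> \<equiv> cluster N X"
  assumes "sets \<gamma> = sets borel"
    and "emeasure \<gamma> UNIV < 1"
    and "poisson_branching M \<gamma> N X"
    and "n \<ge> 2"
    and "\<And>i. i \<in> {1..n} \<Longrightarrow> f i \<in> borel_measurable borel"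
    and "\<And>i z p. i \<in> {1..n} \<Longrightarrow> p \<ge> 1 \<Longrightarrow>
           integrable M (\<lambda>\<omega>. (\<bar>f i z\<bar> + (\<Sum>x\<in>#\<xi> \<omega>. \<bar>f i (z + x)\<bar>)) ^ p)"
  shows "\<forall>z.
     (\<forall>P. partition_on {1..n} P \<and> 2 \<le> card P \<longrightarrow>
        (\<forall>m::nat. integrable (\<Pi>\<^sub>M i\<in>{1..Suc m}. \<gamma>)
                  (\<lambda>x. \<Prod>B\<in>P. cluster_cumulant M \<xi> f B (z + (\<Sum>i\<in>{1..Suc m}. x i)))) \<and>
        summable (\<lambda>m. \<integral>x. (\<Prod>B\<in>P. cluster_cumulant M \<xi> f B (z + (\<Sum>i\<in>{1..Suc m}. x i)))
                         \<partial>(\<Pi>\<^sub>M i\<in>{1..Suc m}. \<gamma>))) \<and>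
     cluster_cumulant M \<xi> f {1..n} z =
       (\<Sum>k=2..n. \<Sum>P | partition_on {1..n} P \<and> card P = k.
          \<Sum>m. \<integral>x. (\<Prod>B\<in>P. cluster_cumulant M \<xi> f B (z + (\<Sum>i\<in>{1..Suc m}. x i)))
                  \<partial>(\<Pi>\<^sub>M i\<in>{1..Suc m}. \<gamma>))"
proof -
  interpret subcritical_branching M \<gamma> N X
    using assms(2-4) by (simp add: subcritical_branching_def subcritical_branching_axioms_def)
  \<comment> \<open>The sum of absolute values dominates all functions at once, so one cluster sum
    controls every cumulant.\<close>
  define g where "g x = (\<Sum>i=1..n. \<bar>f i x\<bar>)" for x
  interpret dominated_branching M \<gamma> N X g
  proof
    show "g \<in> borel_measurable borel"
      unfolding g_def[abs_def] using assms(6) by (intro borel_measurable_sum borel_measurable_abs)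
    show "0 \<le> g x" for x by (simp add: g_def sum_nonneg)
    show "integrable M (\<lambda>\<omega>. cluster_sum g \<omega> z ^ p)" if "1 \<le> p" for p z
      unfolding g_def[abs_def]
    proof (rule integrable_power_sum_cluster_sum)
      show "integrable M (\<lambda>\<omega>. cluster_sum (\<lambda>x. \<bar>f i x\<bar>) \<omega> z ^ p)" if "i \<in> {1..n}" for i
        using assms(7)[OF that \<open>1 \<le> p\<close>, of z] by (simp add: cluster_sum_def \<xi>_def)
    qed (use assms(6) that in auto)
  qed
  have f_le: "\<bar>f i x\<bar> \<le> g x" if "i \<in> {1..n}" for i x
    unfolding g_def by (rule member_le_sum) (use that in auto)
  have n: "2 \<le> card {1..n}" "{1..n} \<noteq> {}" using assms(5) by auto
  have \<kappa>: "cluster_cumulant M \<xi> f B y = ccumulant f B y" for B y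
    unfolding \<xi>_def by (rule cluster_cumulant_eq)
  show ?thesis
    unfolding \<kappa>
  proof (intro allI conjI impI; (elim conjE)?)
    fix z P and m :: nat
    assume P: "partition_on {1..n} P" "2 \<le> card P"
    have dom: "dominated (card {1..n}) (\<Prod>B\<in>P. cumulant_bound B) (\<lambda>w. \<Prod>B\<in>P. ccumulant f B w)"
      by (rule dominated_prod_ccumulant[OF _ assms(6) f_le P(1) n(2)]) auto
    show "integrable (\<Pi>\<^sub>M i\<in>{1..Suc m}. \<gamma>) (\<lambda>x. \<Prod>B\<in>P. ccumulant f B (z + (\<Sum>i\<in>{1..Suc m}. x i)))"
      by (rule dominated_walk(1)[OF dom])
  next
    fix z P
    assume P: "partition_on {1..n} P" "2 \<le> card P"
    have dom: "dominated (card {1..n}) (\<Prod>B\<in>P. cumulant_bound B) (\<lambda>w. \<Prod>B\<in>P. ccumulant f B w)"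
      by (rule dominated_prod_ccumulant[OF _ assms(6) f_le P(1) n(2)]) auto
    show "summable (\<lambda>m. \<integral>x. (\<Prod>B\<in>P. ccumulant f B (z + (\<Sum>i\<in>{1..Suc m}. x i))) \<partial>(\<Pi>\<^sub>M i\<in>{1..Suc m}. \<gamma>))"
      using dominated_walk_summable[OF dom, of z] unfolding walk_def .
  next
    fix z
    have "ccumulant f {1..n} z = (\<Sum>P | partition_on {1..n} P \<and> 2 \<le> card P.
        \<Sum>m. walk (Suc m) (\<lambda>w. \<Prod>B\<in>P. ccumulant f B w) z)"
      by (rule ccumulant_sums[OF _ assms(6) f_le n(1)]) auto
    also have "\<dots> = (\<Sum>k=2..n. \<Sum>P | partition_on {1..n} P \<and> card P = k.
        \<Sum>m. walk (Suc m) (\<lambda>w. \<Prod>B\<in>P. ccumulant f B w) z)"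
      using sum_partition_on_by_card[of "{1..n}" "\<lambda>P. \<Sum>m. walk (Suc m) (\<lambda>w. \<Prod>B\<in>P. ccumulant f B w) z" 2]
      by simp
    finally show "ccumulant f {1..n} z = (\<Sum>k=2..n. \<Sum>P | partition_on {1..n} P \<and> card P = k.
        \<Sum>m. \<integral>x. (\<Prod>B\<in>P. ccumulant f B (z + (\<Sum>i\<in>{1..Suc m}. x i))) \<partial>(\<Pi>\<^sub>M i\<in>{1..Suc m}. \<gamma>))"
      unfolding walk_def .
  qed
qed

end
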